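(* Let $\Bbbk$ be a commutative ring of characteristic not equal to two and $z\in\Bbbk$. There is a unique isomorphism of monoidal supercategories $$\mathcal{AQ}(z)\to\mathcal{AQ}(-z)$$ determined on objects by $\uparrow\mapsto\uparrow$, $\downarrow\mapsto\downarrow$, and sending $$c\mapsto o,\quad o\mapsto c,\quad u^+\mapsto u^-,\quad u^-\mapsto u^+,\quad \mathrm{cap}_R\mapsto\mathrm{cap}_R,\quad \mathrm{cup}_R\mapsto\mathrm{cup}_R.$$ On arbitrary string diagrams, the isomorphism acts by interchanging open Clifford tokens ($o$) and closed Clifford tokens ($c$) and flipping crossings (i.e. interchanging positive crossings $u^+,r^+,d^+,l^+$ with the corresponding negative crossings $u^-,r^-,d^-,l^-$).
   Context: Everything is $\Bbbk$-linear. A supercategory is a category enriched in vector superspaces ($\mathbb{Z}/2$-graded $\Bbbk$-modules) with parity-preserving maps; $\bar f$ is the parity of a homogeneous $f$. In a strict monoidal supercategory (unit $\mathbb{1}$, identities $1_X$) the super interchange law holds: $(f'\otimes g)\circ(f\otimes g')=(-1)^{\bar f\bar g}(f'\circ f)\otimes(g\circ g')$. The quantum isomeric supercategory $\mathcal{Q}(z)$ is the strict monoidal supercategory generated by objects $\uparrow,\downarrow$; even morphisms $u^+,u^-\colon\uparrow\otimes\uparrow\to\uparrow\otimes\uparrow$, $r^-\colon\uparrow\otimes\downarrow\to\downarrow\otimes\uparrow$, $\mathrm{cap}_L\colon\downarrow\otimes\uparrow\to\mathbb{1}$, $\mathrm{cup}_L\colon\mathbb{1}\to\uparrow\otimes\downarrow$;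 and an odd morphism $c\colon\uparrow\to\uparrow$; subject to: $u^-u^+=1=u^+u^-$; $l^+r^-=1_{\uparrow\otimes\downarrow}$; $r^-l^+=1_{\downarrow\otimes\uparrow}$; $(u^+\otimes1_\uparrow)(1_\uparrow\otimes u^+)(u^+\otimes1_\uparrow)=(1_\uparrow\otimes u^+)(u^+\otimes1_\uparrow)(1_\uparrow\otimes u^+)$; $u^+-u^-=z\,1_{\uparrow\otimes\uparrow}$; $c^2=-1_\uparrow$; $u^+(c\otimes1_\uparrow)=(1_\uparrow\otimes c)u^+$; $\mathrm{cap}_R(c\otimes1_\downarrow)\mathrm{cup}_L=0=\mathrm{cap}_R\,\mathrm{cup}_L$; $(1_\uparrow\otimes\mathrm{cap}_L)(\mathrm{cup}_L\otimes1_\uparrow)=1_\uparrow$; $(\mathrm{cap}_L\otimes1_\downarrow)(1_\downarrow\otimes\mathrm{cup}_L)=1_\downarrow$. Here and below (writing $\Phi(f)=(\mathrm{cap}_L\otimes1)(1_\downarrow\otimes f\otimes1_\downarrow)(1\otimes\mathrm{cup}_L)$): $l^\pm:=\Phi(u^\pm)\colon\downarrow\otimes\uparrow\to\uparrow\otimes\downarrow$; $d^\pm:=\Phi(l^\pm)\colon\downarrow\otimes\downarrow\to\downarrow\otimes\downarrow$; $\mathrm{cap}_R:=\mathrm{cap}_L\circ r^-\colon\uparrow\otimes\downarrow\to\mathbb{1}$; $\mathrm{cup}_R:=r^-\circ\mathrm{cup}_L\colon\mathbb{1}\to\downarrow\otimes\uparrow$; $r^+:=r^-+z\,\mathrm{cup}_R\circ\mathrm{cap}_R\colon\uparrow\otimes\downarrow\to\downarrow\otimes\uparrow$.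 The quantum affine isomeric supercategory $\mathcal{AQ}(z)$ is the strict monoidal supercategory obtained from $\mathcal{Q}(z)$ by adjoining an additional odd morphism $o\colon\uparrow\to\uparrow$ subject to $o^2=-1_\uparrow$, $u^+(1_\uparrow\otimes o)=(o\otimes1_\uparrow)u^+$, $\mathrm{cap}_R(o\otimes1_\downarrow)\mathrm{cup}_L=0$. A string diagram is any morphism built by composition and tensor product from identities, the crossings $u^\pm,r^\pm,d^\pm,l^\pm$, the cups and caps $\mathrm{cup}_L,\mathrm{cup}_R,\mathrm{cap}_L,\mathrm{cap}_R$, and the tokens $c,o$. *)

theory Defs
  imports "HOL-Algebra.Module" "HOL-Algebra.Multiplicative_Group" "HOL-Library.Z2"
begin

section \<open>Supercategories\<close>

text \<open>Parities are elements of the field \<^typ>\<open>bit\<close> with two elements.\<close>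

text \<open>The additive order of \<open>1\<close>; it is \<open>0\<close> if that order is infinite.\<close>

definition ring_char :: "('k, 'x) ring_scheme \<Rightarrow> nat"
  where "ring_char R = group.ord (add_monoid R) \<one>\<^bsub>R\<^esub>"

definition super_sign :: "('k, 'x) ring_scheme \<Rightarrow> bit \<Rightarrow> bit \<Rightarrow> 'k"
  where "super_sign R p q = (if p * q = 1 then \<ominus>\<^bsub>R\<^esub> \<one>\<^bsub>R\<^esub> else \<one>\<^bsub>R\<^esub>)"

locale superspace = module R V
  for R :: "('k, 'x) ring_scheme" (structure) and V :: "('k, 'm, 'y) module_scheme" (structure) +
  fixes H :: "bit \<Rightarrow> 'm set"
  assumes homogeneous_submodule: "submodule (H p) R V"
    and homogeneous_direct_sum:
      "v \<in> carrier V \<Longrightarrow> \<exists>!(a, b). a \<in> H 0 \<and> b \<in> H 1 \<and> v = a \<oplus>\<^bsub>V\<^esub> b"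

text \<open>
  Only the carrier, the zero, the addition and the scalar action of the records \<open>Hom C X Y\<close>
  are used; \<open>Homog C X Y p\<close> is the parity \<open>p\<close> part of \<open>Hom C X Y\<close>.
\<close>

record ('o, 'm, 'k) supercat =
  Ob :: "'o set"
  Hom :: "'o \<Rightarrow> 'o \<Rightarrow> ('k, 'm) module"
  Homog :: "'o \<Rightarrow> 'o \<Rightarrow> bit \<Rightarrow> 'm set"
  ident :: "'o \<Rightarrow> 'm"
  cmp :: "'m \<Rightarrow> 'm \<Rightarrow> 'm"

record ('o, 'm, 'k) mon_supercat = "('o, 'm, 'k) supercat" +
  unit_ob :: "'o"
  tens_ob :: "'o \<Rightarrow> 'o \<Rightarrow> 'o"
  tens :: "'m \<Rightarrow> 'm \<Rightarrow> 'm"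

locale supercategory = cring R for R :: "('k, 'x) ring_scheme" (structure) +
  fixes C :: "('o, 'm, 'k, 'y) supercat_scheme"
  assumes hom_superspace:
      "\<lbrakk>X \<in> Ob C; Y \<in> Ob C\<rbrakk> \<Longrightarrow> superspace R (Hom C X Y) (Homog C X Y)"
    and hom_disjoint:
      "\<lbrakk>X \<in> Ob C; Y \<in> Ob C; X' \<in> Ob C; Y' \<in> Ob C;
        f \<in> carrier (Hom C X Y); f \<in> carrier (Hom C X' Y')\<rbrakk> \<Longrightarrow> X = X' \<and> Y = Y'"
    and ident_even: "X \<in> Ob C \<Longrightarrow> ident C X \<in> Homog C X X 0"
    and cmp_closed:
      "\<lbrakk>X \<in> Ob C; Y \<in> Ob C; Z \<in> Ob C; g \<in> carrier (Hom C Y Z); f \<in> carrier (Hom C X Y)\<rbrakk>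
        \<Longrightarrow> cmp C g f \<in> carrier (Hom C X Z)"
    and cmp_parity:
      "\<lbrakk>X \<in> Ob C; Y \<in> Ob C; Z \<in> Ob C; g \<in> Homog C Y Z p; f \<in> Homog C X Y q\<rbrakk>
        \<Longrightarrow> cmp C g f \<in> Homog C X Z (p + q)"
    and cmp_add_left:
      "\<lbrakk>X \<in> Ob C; Y \<in> Ob C; Z \<in> Ob C; g \<in> carrier (Hom C Y Z); g' \<in> carrier (Hom C Y Z);
        f \<in> carrier (Hom C X Y)\<rbrakk>
        \<Longrightarrow> cmp C (g \<oplus>\<^bsub>Hom C Y Z\<^esub> g') f = cmp C g f \<oplus>\<^bsub>Hom C X Z\<^esub> cmp C g' f"
    and cmp_add_right:
      "\<lbrakk>X \<in> Ob C; Y \<in> Ob C; Z \<in> Ob C; g \<in> carrier (Hom C Y Z);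
        f \<in> carrier (Hom C X Y); f' \<in> carrier (Hom C X Y)\<rbrakk>
        \<Longrightarrow> cmp C g (f \<oplus>\<^bsub>Hom C X Y\<^esub> f') = cmp C g f \<oplus>\<^bsub>Hom C X Z\<^esub> cmp C g f'"
    and cmp_smult_left:
      "\<lbrakk>X \<in> Ob C; Y \<in> Ob C; Z \<in> Ob C; a \<in> carrier R; g \<in> carrier (Hom C Y Z);
        f \<in> carrier (Hom C X Y)\<rbrakk>
        \<Longrightarrow> cmp C (a \<odot>\<^bsub>Hom C Y Z\<^esub> g) f = a \<odot>\<^bsub>Hom C X Z\<^esub> cmp C g f"
    and cmp_smult_right:
      "\<lbrakk>X \<in> Ob C; Y \<in> Ob C; Z \<in> Ob C; a \<in> carrier R; g \<in> carrier (Hom C Y Z);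
        f \<in> carrier (Hom C X Y)\<rbrakk>
        \<Longrightarrow> cmp C g (a \<odot>\<^bsub>Hom C X Y\<^esub> f) = a \<odot>\<^bsub>Hom C X Z\<^esub> cmp C g f"
    and cmp_assoc:
      "\<lbrakk>X \<in> Ob C; Y \<in> Ob C; Z \<in> Ob C; W \<in> Ob C; h \<in> carrier (Hom C Z W);
        g \<in> carrier (Hom C Y Z); f \<in> carrier (Hom C X Y)\<rbrakk>
        \<Longrightarrow> cmp C (cmp C h g) f = cmp C h (cmp C g f)"
    and cmp_ident_left:
      "\<lbrakk>X \<in> Ob C; Y \<in> Ob C; f \<in> carrier (Hom C X Y)\<rbrakk> \<Longrightarrow> cmp C (ident C Y) f = f"
    and cmp_ident_right:
      "\<lbrakk>X \<in> Ob C; Y \<in> Ob C; f \<in> carrier (Hom C X Y)\<rbrakk> \<Longrightarrow> cmp C f (ident C X) = f"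

locale strict_monoidal_supercategory = supercategory R C
  for R :: "('k, 'x) ring_scheme" (structure) and C :: "('o, 'm, 'k, 'y) mon_supercat_scheme" +
  assumes unit_ob_closed: "unit_ob C \<in> Ob C"
    and tens_ob_closed: "\<lbrakk>X \<in> Ob C; Y \<in> Ob C\<rbrakk> \<Longrightarrow> tens_ob C X Y \<in> Ob C"
    and tens_ob_assoc:
      "\<lbrakk>X \<in> Ob C; Y \<in> Ob C; Z \<in> Ob C\<rbrakk>
        \<Longrightarrow> tens_ob C (tens_ob C X Y) Z = tens_ob C X (tens_ob C Y Z)"
    and tens_ob_unit_left: "X \<in> Ob C \<Longrightarrow> tens_ob C (unit_ob C) X = X"
    and tens_ob_unit_right: "X \<in> Ob C \<Longrightarrow> tens_ob C X (unit_ob C) = X"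
    and tens_closed:
      "\<lbrakk>X \<in> Ob C; Y \<in> Ob C; X' \<in> Ob C; Y' \<in> Ob C;
        f \<in> carrier (Hom C X Y); g \<in> carrier (Hom C X' Y')\<rbrakk>
        \<Longrightarrow> tens C f g \<in> carrier (Hom C (tens_ob C X X') (tens_ob C Y Y'))"
    and tens_parity:
      "\<lbrakk>X \<in> Ob C; Y \<in> Ob C; X' \<in> Ob C; Y' \<in> Ob C; f \<in> Homog C X Y p; g \<in> Homog C X' Y' q\<rbrakk>
        \<Longrightarrow> tens C f g \<in> Homog C (tens_ob C X X') (tens_ob C Y Y') (p + q)"
    and tens_add_left:
      "\<lbrakk>X \<in> Ob C; Y \<in> Ob C; X' \<in> Ob C; Y' \<in> Ob C; f \<in> carrier (Hom C X Y);
        f' \<in> carrier (Hom C X Y); g \<in> carrier (Hom C X' Y')\<rbrakk>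
        \<Longrightarrow> tens C (f \<oplus>\<^bsub>Hom C X Y\<^esub> f') g
          = tens C f g \<oplus>\<^bsub>Hom C (tens_ob C X X') (tens_ob C Y Y')\<^esub> tens C f' g"
    and tens_add_right:
      "\<lbrakk>X \<in> Ob C; Y \<in> Ob C; X' \<in> Ob C; Y' \<in> Ob C; f \<in> carrier (Hom C X Y);
        g \<in> carrier (Hom C X' Y'); g' \<in> carrier (Hom C X' Y')\<rbrakk>
        \<Longrightarrow> tens C f (g \<oplus>\<^bsub>Hom C X' Y'\<^esub> g')
          = tens C f g \<oplus>\<^bsub>Hom C (tens_ob C X X') (tens_ob C Y Y')\<^esub> tens C f g'"
    and tens_smult_left:
      "\<lbrakk>X \<in> Ob C; Y \<in> Ob C; X' \<in> Ob C; Y' \<in> Ob C; a \<in> carrier R;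
        f \<in> carrier (Hom C X Y); g \<in> carrier (Hom C X' Y')\<rbrakk>
        \<Longrightarrow> tens C (a \<odot>\<^bsub>Hom C X Y\<^esub> f) g
          = a \<odot>\<^bsub>Hom C (tens_ob C X X') (tens_ob C Y Y')\<^esub> tens C f g"
    and tens_smult_right:
      "\<lbrakk>X \<in> Ob C; Y \<in> Ob C; X' \<in> Ob C; Y' \<in> Ob C; a \<in> carrier R;
        f \<in> carrier (Hom C X Y); g \<in> carrier (Hom C X' Y')\<rbrakk>
        \<Longrightarrow> tens C f (a \<odot>\<^bsub>Hom C X' Y'\<^esub> g)
          = a \<odot>\<^bsub>Hom C (tens_ob C X X') (tens_ob C Y Y')\<^esub> tens C f g"
    and tens_assoc:
      "\<lbrakk>X \<in> Ob C; Y \<in> Ob C; X' \<in> Ob C; Y' \<in> Ob C; X'' \<in> Ob C; Y'' \<in> Ob C;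
        f \<in> carrier (Hom C X Y); g \<in> carrier (Hom C X' Y'); h \<in> carrier (Hom C X'' Y'')\<rbrakk>
        \<Longrightarrow> tens C (tens C f g) h = tens C f (tens C g h)"
    and tens_unit_left:
      "\<lbrakk>X \<in> Ob C; Y \<in> Ob C; f \<in> carrier (Hom C X Y)\<rbrakk>
        \<Longrightarrow> tens C (ident C (unit_ob C)) f = f"
    and tens_unit_right:
      "\<lbrakk>X \<in> Ob C; Y \<in> Ob C; f \<in> carrier (Hom C X Y)\<rbrakk>
        \<Longrightarrow> tens C f (ident C (unit_ob C)) = f"
    and tens_ident:
      "\<lbrakk>X \<in> Ob C; Y \<in> Ob C\<rbrakk> \<Longrightarrow> tens C (ident C X) (ident C Y) = ident C (tens_ob C X Y)"
    and super_interchange: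
      "\<lbrakk>X \<in> Ob C; Y \<in> Ob C; Z \<in> Ob C; X' \<in> Ob C; Y' \<in> Ob C; Z' \<in> Ob C;
        f \<in> Homog C X Y p; f' \<in> carrier (Hom C Y Z);
        g \<in> Homog C Y' Z' q; g' \<in> carrier (Hom C X' Y')\<rbrakk>
        \<Longrightarrow> cmp C (tens C f' g) (tens C f g')
          = super_sign R p q \<odot>\<^bsub>Hom C (tens_ob C X X') (tens_ob C Z Z')\<^esub>
              tens C (cmp C f' f) (cmp C g g')"

text \<open>Monoidal superfunctors are strict; on morphism spaces they are linear and parity preserving.\<close>

locale monoidal_superfunctor =
  dom: strict_monoidal_supercategory R C + cod: strict_monoidal_supercategory R D
  for R :: "('k, 'x) ring_scheme" (structure) and C :: "('o, 'm, 'k, 'y) mon_supercat_scheme"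
    and D :: "('p, 'n, 'k, 'z) mon_supercat_scheme" +
  fixes Fo :: "'o \<Rightarrow> 'p" and Fm :: "'m \<Rightarrow> 'n"
  assumes ob_closed: "X \<in> Ob C \<Longrightarrow> Fo X \<in> Ob D"
    and hom_closed:
      "\<lbrakk>X \<in> Ob C; Y \<in> Ob C; f \<in> carrier (Hom C X Y)\<rbrakk> \<Longrightarrow> Fm f \<in> carrier (Hom D (Fo X) (Fo Y))"
    and hom_parity:
      "\<lbrakk>X \<in> Ob C; Y \<in> Ob C; f \<in> Homog C X Y p\<rbrakk> \<Longrightarrow> Fm f \<in> Homog D (Fo X) (Fo Y) p"
    and hom_add:
      "\<lbrakk>X \<in> Ob C; Y \<in> Ob C; f \<in> carrier (Hom C X Y); g \<in> carrier (Hom C X Y)\<rbrakk>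
        \<Longrightarrow> Fm (f \<oplus>\<^bsub>Hom C X Y\<^esub> g) = Fm f \<oplus>\<^bsub>Hom D (Fo X) (Fo Y)\<^esub> Fm g"
    and hom_smult:
      "\<lbrakk>X \<in> Ob C; Y \<in> Ob C; a \<in> carrier R; f \<in> carrier (Hom C X Y)\<rbrakk>
        \<Longrightarrow> Fm (a \<odot>\<^bsub>Hom C X Y\<^esub> f) = a \<odot>\<^bsub>Hom D (Fo X) (Fo Y)\<^esub> Fm f"
    and map_ident: "X \<in> Ob C \<Longrightarrow> Fm (ident C X) = ident D (Fo X)"
    and map_cmp:
      "\<lbrakk>X \<in> Ob C; Y \<in> Ob C; Z \<in> Ob C; g \<in> carrier (Hom C Y Z); f \<in> carrier (Hom C X Y)\<rbrakk>
        \<Longrightarrow> Fm (cmp C g f) = cmp D (Fm g) (Fm f)"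
    and map_unit_ob: "Fo (unit_ob C) = unit_ob D"
    and map_tens_ob:
      "\<lbrakk>X \<in> Ob C; Y \<in> Ob C\<rbrakk> \<Longrightarrow> Fo (tens_ob C X Y) = tens_ob D (Fo X) (Fo Y)"
    and map_tens:
      "\<lbrakk>X \<in> Ob C; Y \<in> Ob C; X' \<in> Ob C; Y' \<in> Ob C;
        f \<in> carrier (Hom C X Y); g \<in> carrier (Hom C X' Y')\<rbrakk>
        \<Longrightarrow> Fm (tens C f g) = tens D (Fm f) (Fm g)"

definition functors_agree ::
    "('o, 'm, 'k, 'y) supercat_scheme \<Rightarrow> ('o \<Rightarrow> 'p) \<Rightarrow> ('m \<Rightarrow> 'n) \<Rightarrow> ('o \<Rightarrow> 'p) \<Rightarrow> ('m \<Rightarrow> 'n) \<Rightarrow> bool"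
  where "functors_agree C Fo Fm Go Gm \<longleftrightarrow>
    (\<forall>X \<in> Ob C. Fo X = Go X) \<and>
    (\<forall>X \<in> Ob C. \<forall>Y \<in> Ob C. \<forall>f \<in> carrier (Hom C X Y). Fm f = Gm f)"

definition monoidal_superisomorphism ::
    "('k, 'x) ring_scheme \<Rightarrow> ('o, 'm, 'k, 'y) mon_supercat_scheme \<Rightarrow>
     ('p, 'n, 'k, 'z) mon_supercat_scheme \<Rightarrow> ('o \<Rightarrow> 'p) \<Rightarrow> ('m \<Rightarrow> 'n) \<Rightarrow> bool"
  where "monoidal_superisomorphism R C D Fo Fm \<longleftrightarrow>
    monoidal_superfunctor R C D Fo Fm \<and>
    (\<exists>Go Gm. monoidal_superfunctor R D C Go Gm \<and>
      functors_agree C (Go \<circ> Fo) (Gm \<circ> Fm) id id \<and>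
      functors_agree D (Fo \<circ> Go) (Fm \<circ> Gm) id id)"


section \<open>Presentations of strict monoidal supercategories\<close>

text \<open>
  Objects are words in the object generators \<open>'a\<close>; morphisms are terms in the morphism
  generators \<open>'g\<close> modulo the smallest congruence that contains the axioms of a strict monoidal
  supercategory over \<open>R\<close> and the given relations.
\<close>

datatype ('a, 'g, 'k) tm =
    Gen 'g
  | Idn "'a list"
  | Zer "'a list" "'a list"
  | Add "('a, 'g, 'k) tm" "('a, 'g, 'k) tm"
  | Scl 'k "('a, 'g, 'k) tm"
  | Cmp "('a, 'g, 'k) tm" "('a, 'g, 'k) tm" (infixl \<open>\<bullet>\<close> 65)
  | Tns "('a, 'g, 'k) tm" "('a, 'g, 'k) tm" (infixl \<open>\<boxtimes>\<close> 70)

record ('a, 'g, 'k) presentation =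
  source :: "'g \<Rightarrow> 'a list"
  target :: "'g \<Rightarrow> 'a list"
  parity :: "'g \<Rightarrow> bit"
  relations :: "(('a, 'g, 'k) tm \<times> ('a, 'g, 'k) tm) set"

inductive typed ::
    "('k, 'x) ring_scheme \<Rightarrow> ('a, 'g, 'k) presentation \<Rightarrow>
     ('a, 'g, 'k) tm \<Rightarrow> 'a list \<Rightarrow> 'a list \<Rightarrow> bool"
  for R P where
    "typed R P (Gen g) (source P g) (target P g)"
  | "typed R P (Idn X) X X"
  | "typed R P (Zer X Y) X Y"
  | "typed R P s X Y \<Longrightarrow> typed R P t X Y \<Longrightarrow> typed R P (Add s t) X Y"
  | "a \<in> carrier R \<Longrightarrow> typed R P t X Y \<Longrightarrow> typed R P (Scl a t) X Y"
  | "typed R P t Y Z \<Longrightarrow> typed R P s X Y \<Longrightarrow> typed R P (t \<bullet> s) X Z"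
  | "typed R P s X Y \<Longrightarrow> typed R P t X' Y' \<Longrightarrow> typed R P (s \<boxtimes> t) (X @ X') (Y @ Y')"

inductive has_parity :: "('a, 'g, 'k) presentation \<Rightarrow> ('a, 'g, 'k) tm \<Rightarrow> bit \<Rightarrow> bool"
  for P where
    "has_parity P (Gen g) (parity P g)"
  | "has_parity P (Idn X) 0"
  | "has_parity P (Zer X Y) p"
  | "has_parity P s p \<Longrightarrow> has_parity P t p \<Longrightarrow> has_parity P (Add s t) p"
  | "has_parity P t p \<Longrightarrow> has_parity P (Scl a t) p"
  | "has_parity P t p \<Longrightarrow> has_parity P s q \<Longrightarrow> has_parity P (t \<bullet> s) (p + q)"
  | "has_parity P s p \<Longrightarrow> has_parity P t q \<Longrightarrow> has_parity P (s \<boxtimes> t) (p + q)"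

inductive eqv ::
    "('k, 'x) ring_scheme \<Rightarrow> ('a, 'g, 'k) presentation \<Rightarrow>
     ('a, 'g, 'k) tm \<Rightarrow> ('a, 'g, 'k) tm \<Rightarrow> bool"
  for R P where
    rel: "(s, t) \<in> relations P \<Longrightarrow> typed R P s X Y \<Longrightarrow> typed R P t X Y \<Longrightarrow> eqv R P s t"
  | refl: "typed R P t X Y \<Longrightarrow> eqv R P t t"
  | sym: "eqv R P s t \<Longrightarrow> eqv R P t s"
  | trans: "eqv R P s t \<Longrightarrow> eqv R P t u \<Longrightarrow> eqv R P s u"
  | cong_add: "eqv R P s s' \<Longrightarrow> eqv R P t t' \<Longrightarrow> typed R P (Add s t) X Y
      \<Longrightarrow> eqv R P (Add s t) (Add s' t')"
  | cong_scl: "a \<in> carrier R \<Longrightarrow> eqv R P t t' \<Longrightarrow> eqv R P (Scl a t) (Scl a t')"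
  | cong_cmp: "eqv R P t t' \<Longrightarrow> eqv R P s s' \<Longrightarrow> typed R P (t \<bullet> s) X Y
      \<Longrightarrow> eqv R P (t \<bullet> s) (t' \<bullet> s')"
  | cong_tns: "eqv R P s s' \<Longrightarrow> eqv R P t t' \<Longrightarrow> eqv R P (s \<boxtimes> t) (s' \<boxtimes> t')"

  | add_assoc: "typed R P s X Y \<Longrightarrow> typed R P t X Y \<Longrightarrow> typed R P u X Y
      \<Longrightarrow> eqv R P (Add (Add s t) u) (Add s (Add t u))"
  | add_comm: "typed R P s X Y \<Longrightarrow> typed R P t X Y \<Longrightarrow> eqv R P (Add s t) (Add t s)"
  | add_zero: "typed R P t X Y \<Longrightarrow> eqv R P (Add t (Zer X Y)) t"
  | scl_zero: "typed R P t X Y \<Longrightarrow> eqv R P (Scl \<zero>\<^bsub>R\<^esub> t) (Zer X Y)"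
  | scl_one: "typed R P t X Y \<Longrightarrow> eqv R P (Scl \<one>\<^bsub>R\<^esub> t) t"
  | scl_mult: "a \<in> carrier R \<Longrightarrow> b \<in> carrier R \<Longrightarrow> typed R P t X Y
      \<Longrightarrow> eqv R P (Scl (a \<otimes>\<^bsub>R\<^esub> b) t) (Scl a (Scl b t))"
  | scl_add_left: "a \<in> carrier R \<Longrightarrow> b \<in> carrier R \<Longrightarrow> typed R P t X Y
      \<Longrightarrow> eqv R P (Scl (a \<oplus>\<^bsub>R\<^esub> b) t) (Add (Scl a t) (Scl b t))"
  | scl_add_right: "a \<in> carrier R \<Longrightarrow> typed R P s X Y \<Longrightarrow> typed R P t X Y
      \<Longrightarrow> eqv R P (Scl a (Add s t)) (Add (Scl a s) (Scl a t))"

  | cmp_assoc: "typed R P u Z W \<Longrightarrow> typed R P t Y Z \<Longrightarrow> typed R P s X Y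
      \<Longrightarrow> eqv R P (u \<bullet> t \<bullet> s) (u \<bullet> (t \<bullet> s))"
  | cmp_idn_left: "typed R P t X Y \<Longrightarrow> eqv R P (Idn Y \<bullet> t) t"
  | cmp_idn_right: "typed R P t X Y \<Longrightarrow> eqv R P (t \<bullet> Idn X) t"
  | cmp_add_left: "typed R P t Y Z \<Longrightarrow> typed R P t' Y Z \<Longrightarrow> typed R P s X Y
      \<Longrightarrow> eqv R P (Add t t' \<bullet> s) (Add (t \<bullet> s) (t' \<bullet> s))"
  | cmp_add_right: "typed R P t Y Z \<Longrightarrow> typed R P s X Y \<Longrightarrow> typed R P s' X Y
      \<Longrightarrow> eqv R P (t \<bullet> Add s s') (Add (t \<bullet> s) (t \<bullet> s'))"
  | cmp_scl_left: "a \<in> carrier R \<Longrightarrow> typed R P t Y Z \<Longrightarrow> typed R P s X Y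
      \<Longrightarrow> eqv R P (Scl a t \<bullet> s) (Scl a (t \<bullet> s))"
  | cmp_scl_right: "a \<in> carrier R \<Longrightarrow> typed R P t Y Z \<Longrightarrow> typed R P s X Y
      \<Longrightarrow> eqv R P (t \<bullet> Scl a s) (Scl a (t \<bullet> s))"

  | tns_assoc: "typed R P s X Y \<Longrightarrow> typed R P t X' Y' \<Longrightarrow> typed R P u X'' Y''
      \<Longrightarrow> eqv R P (s \<boxtimes> t \<boxtimes> u) (s \<boxtimes> (t \<boxtimes> u))"
  | tns_unit_left: "typed R P t X Y \<Longrightarrow> eqv R P (Idn [] \<boxtimes> t) t"
  | tns_unit_right: "typed R P t X Y \<Longrightarrow> eqv R P (t \<boxtimes> Idn []) t"
  | tns_idn: "eqv R P (Idn X \<boxtimes> Idn Y) (Idn (X @ Y))"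
  | tns_add_left: "typed R P s X Y \<Longrightarrow> typed R P s' X Y \<Longrightarrow> typed R P t X' Y'
      \<Longrightarrow> eqv R P (Add s s' \<boxtimes> t) (Add (s \<boxtimes> t) (s' \<boxtimes> t))"
  | tns_add_right: "typed R P s X Y \<Longrightarrow> typed R P t X' Y' \<Longrightarrow> typed R P t' X' Y'
      \<Longrightarrow> eqv R P (s \<boxtimes> Add t t') (Add (s \<boxtimes> t) (s \<boxtimes> t'))"
  | tns_scl_left: "a \<in> carrier R \<Longrightarrow> typed R P s X Y \<Longrightarrow> typed R P t X' Y'
      \<Longrightarrow> eqv R P (Scl a s \<boxtimes> t) (Scl a (s \<boxtimes> t))"
  | tns_scl_right: "a \<in> carrier R \<Longrightarrow> typed R P s X Y \<Longrightarrow> typed R P t X' Y'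
      \<Longrightarrow> eqv R P (s \<boxtimes> Scl a t) (Scl a (s \<boxtimes> t))"
  | interchange: "typed R P s X Y \<Longrightarrow> typed R P s' Y Z \<Longrightarrow> typed R P t Y' Z' \<Longrightarrow> typed R P t' X' Y'
      \<Longrightarrow> has_parity P s p \<Longrightarrow> has_parity P t q
      \<Longrightarrow> eqv R P ((s' \<boxtimes> t) \<bullet> (s \<boxtimes> t')) (Scl (super_sign R p q) ((s' \<bullet> s) \<boxtimes> (t \<bullet> t')))"

definition cls ::
    "('k, 'x) ring_scheme \<Rightarrow> ('a, 'g, 'k) presentation \<Rightarrow> ('a, 'g, 'k) tm \<Rightarrow> ('a, 'g, 'k) tm set"
  where "cls R P t = {s. eqv R P t s}"

text \<open>
  Morphisms are \<^const>\<open>eqv\<close>-classes of well-typed terms. The operations collect the classes of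
  all results on representatives, and these classes coincide.
\<close>

definition presented_hom ::
    "('k, 'x) ring_scheme \<Rightarrow> ('a, 'g, 'k) presentation \<Rightarrow> 'a list \<Rightarrow> 'a list \<Rightarrow>
     ('k, ('a, 'g, 'k) tm set) module"
  where "presented_hom R P X Y =
    \<lparr>carrier = {cls R P t | t. typed R P t X Y},
     mult = undefined,
     one = undefined,
     zero = cls R P (Zer X Y),
     add = (\<lambda>A B. \<Union>s \<in> A. \<Union>t \<in> B. cls R P (Add s t)),
     smult = (\<lambda>a A. \<Union>t \<in> A. cls R P (Scl a t))\<rparr>"

definition presented_supercat ::
    "('k, 'x) ring_scheme \<Rightarrow> ('a, 'g, 'k) presentation \<Rightarrow>
     ('a list, ('a, 'g, 'k) tm set, 'k) mon_supercat"
  where "presented_supercat R P =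
    \<lparr>Ob = UNIV,
     Hom = presented_hom R P,
     Homog = (\<lambda>X Y p. {cls R P t | t. typed R P t X Y \<and> has_parity P t p}),
     ident = (\<lambda>X. cls R P (Idn X)),
     cmp = (\<lambda>B A. \<Union>t \<in> B. \<Union>s \<in> A. cls R P (t \<bullet> s)),
     unit_ob = [],
     tens_ob = (@),
     tens = (\<lambda>A B. \<Union>s \<in> A. \<Union>t \<in> B. cls R P (s \<boxtimes> t))\<rparr>"


section \<open>The quantum affine isomeric supercategory\<close>

datatype orient = Up (\<open>\<up>\<close>) | Down (\<open>\<down>\<close>)

datatype gen = Gen_u_plus | Gen_u_minus | Gen_r_minus | Gen_capL | Gen_cupL | Gen_c | Gen_o

fun gen_source :: "gen \<Rightarrow> orient list" where
  "gen_source Gen_u_plus = [\<up>, \<up>]"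
| "gen_source Gen_u_minus = [\<up>, \<up>]"
| "gen_source Gen_r_minus = [\<up>, \<down>]"
| "gen_source Gen_capL = [\<down>, \<up>]"
| "gen_source Gen_cupL = []"
| "gen_source Gen_c = [\<up>]"
| "gen_source Gen_o = [\<up>]"

fun gen_target :: "gen \<Rightarrow> orient list" where
  "gen_target Gen_u_plus = [\<up>, \<up>]"
| "gen_target Gen_u_minus = [\<up>, \<up>]"
| "gen_target Gen_r_minus = [\<down>, \<up>]"
| "gen_target Gen_capL = []"
| "gen_target Gen_cupL = [\<up>, \<down>]"
| "gen_target Gen_c = [\<up>]"
| "gen_target Gen_o = [\<up>]"

definition gen_parity :: "gen \<Rightarrow> bit"
  where "gen_parity g = (if g \<in> {Gen_c, Gen_o} then 1 else 0)"

type_synonym 'k iterm = "(orient, gen, 'k) tm"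

datatype sign = Pos | Neg

abbreviation capL :: "'k iterm" where "capL \<equiv> Gen Gen_capL"
abbreviation cupL :: "'k iterm" where "cupL \<equiv> Gen Gen_cupL"
abbreviation tok_c :: "'k iterm" where "tok_c \<equiv> Gen Gen_c"
abbreviation tok_o :: "'k iterm" where "tok_o \<equiv> Gen Gen_o"

text \<open>
  \<open>rot A f\<close> is the rotation
  \<open>(cap\<^sub>L \<otimes> 1)(1\<^sub>\<down> \<otimes> f \<otimes> 1\<^sub>\<down>)(1 \<otimes> cup\<^sub>L) : \<down> \<otimes> A \<rightarrow> A \<otimes> \<down>\<close>
  of \<open>f : A \<otimes> \<up> \<rightarrow> \<up> \<otimes> A\<close>.
\<close>

definition rot :: "orient \<Rightarrow> 'k iterm \<Rightarrow> 'k iterm"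
  where "rot A f =
    (capL \<boxtimes> Idn [A, \<down>]) \<bullet> (Idn [\<down>] \<boxtimes> f \<boxtimes> Idn [\<down>]) \<bullet> (Idn [\<down>, A] \<boxtimes> cupL)"

fun cross_u :: "sign \<Rightarrow> 'k iterm" where
  "cross_u Pos = Gen Gen_u_plus"
| "cross_u Neg = Gen Gen_u_minus"

definition cross_l :: "sign \<Rightarrow> 'k iterm" where "cross_l e = rot \<up> (cross_u e)"
definition cross_d :: "sign \<Rightarrow> 'k iterm" where "cross_d e = rot \<down> (cross_l e)"
definition capR :: "'k iterm" where "capR = capL \<bullet> Gen Gen_r_minus"
definition cupR :: "'k iterm" where "cupR = Gen Gen_r_minus \<bullet> cupL"

fun cross_r :: "'k \<Rightarrow> sign \<Rightarrow> 'k iterm" where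
  "cross_r z Pos = Add (Gen Gen_r_minus) (Scl z (cupR \<bullet> capR))"
| "cross_r z Neg = Gen Gen_r_minus"

text \<open>
  The relations of the quantum isomeric supercategory, and the additional ones for the odd
  generator \<^const>\<open>Gen_o\<close> of its affine version.
\<close>

definition isomeric_relations ::
    "('k, 'x) ring_scheme \<Rightarrow> 'k \<Rightarrow> ('k iterm \<times> 'k iterm) set"
  where "isomeric_relations R z =
   (let up = cross_u Pos; um = cross_u Neg; lp = cross_l Pos; rm = cross_r z Neg; I = Idn [\<up>] in
   {(um \<bullet> up, Idn [\<up>, \<up>]),
    (up \<bullet> um, Idn [\<up>, \<up>]),
    (lp \<bullet> rm, Idn [\<up>, \<down>]),
    (rm \<bullet> lp, Idn [\<down>, \<up>]),
    ((up \<boxtimes> I) \<bullet> (I \<boxtimes> up) \<bullet> (up \<boxtimes> I), (I \<boxtimes> up) \<bullet> (up \<boxtimes> I) \<bullet> (I \<boxtimes> up)),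
    (Add up (Scl (\<ominus>\<^bsub>R\<^esub> \<one>\<^bsub>R\<^esub>) um), Scl z (Idn [\<up>, \<up>])),
    (tok_c \<bullet> tok_c, Scl (\<ominus>\<^bsub>R\<^esub> \<one>\<^bsub>R\<^esub>) I),
    (up \<bullet> (tok_c \<boxtimes> I), (I \<boxtimes> tok_c) \<bullet> up),
    (capR \<bullet> (tok_c \<boxtimes> Idn [\<down>]) \<bullet> cupL, Zer [] []),
    (capR \<bullet> cupL, Zer [] []),
    ((I \<boxtimes> capL) \<bullet> (cupL \<boxtimes> I), I),
    ((capL \<boxtimes> Idn [\<down>]) \<bullet> (Idn [\<down>] \<boxtimes> cupL), Idn [\<down>])})"

definition affine_relations ::
    "('k, 'x) ring_scheme \<Rightarrow> ('k iterm \<times> 'k iterm) set"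
  where "affine_relations R =
   {(tok_o \<bullet> tok_o, Scl (\<ominus>\<^bsub>R\<^esub> \<one>\<^bsub>R\<^esub>) (Idn [\<up>])),
    (cross_u Pos \<bullet> (Idn [\<up>] \<boxtimes> tok_o), (tok_o \<boxtimes> Idn [\<up>]) \<bullet> cross_u Pos),
    (capR \<bullet> (tok_o \<boxtimes> Idn [\<down>]) \<bullet> cupL, Zer [] [])}"

definition AQ_presentation ::
    "('k, 'x) ring_scheme \<Rightarrow> 'k \<Rightarrow> (orient, gen, 'k) presentation"
  where "AQ_presentation R z =
    \<lparr>source = gen_source, target = gen_target, parity = gen_parity,
     relations = isomeric_relations R z \<union> affine_relations R\<rparr>"

definition AQ ::
    "('k, 'x) ring_scheme \<Rightarrow> 'k \<Rightarrow> (orient list, 'k iterm set, 'k) mon_supercat"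
  where "AQ R z = presented_supercat R (AQ_presentation R z)"

definition AQ_mor :: "('k, 'x) ring_scheme \<Rightarrow> 'k \<Rightarrow> 'k iterm \<Rightarrow> 'k iterm set"
  where "AQ_mor R z = cls R (AQ_presentation R z)"


section \<open>String diagrams\<close>

datatype diagram =
    D_id "orient list"
  | D_u sign | D_r sign | D_d sign | D_l sign
  | D_cupL | D_cupR | D_capL | D_capR
  | D_c | D_o
  | D_cmp diagram diagram
  | D_tens diagram diagram

inductive diagram_typed :: "diagram \<Rightarrow> orient list \<Rightarrow> orient list \<Rightarrow> bool" where
  "diagram_typed (D_id X) X X"
| "diagram_typed (D_u e) [\<up>, \<up>] [\<up>, \<up>]"
| "diagram_typed (D_r e) [\<up>, \<down>] [\<down>, \<up>]"
| "diagram_typed (D_d e) [\<down>, \<down>] [\<down>, \<down>]"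
| "diagram_typed (D_l e) [\<down>, \<up>] [\<up>, \<down>]"
| "diagram_typed D_cupL [] [\<up>, \<down>]"
| "diagram_typed D_cupR [] [\<down>, \<up>]"
| "diagram_typed D_capL [\<down>, \<up>] []"
| "diagram_typed D_capR [\<up>, \<down>] []"
| "diagram_typed D_c [\<up>] [\<up>]"
| "diagram_typed D_o [\<up>] [\<up>]"
| "diagram_typed e Y Z \<Longrightarrow> diagram_typed d X Y \<Longrightarrow> diagram_typed (D_cmp e d) X Z"
| "diagram_typed d X Y \<Longrightarrow> diagram_typed e X' Y' \<Longrightarrow> diagram_typed (D_tens d e) (X @ X') (Y @ Y')"

fun diagram_mor :: "('k, 'x) ring_scheme \<Rightarrow> 'k \<Rightarrow> diagram \<Rightarrow> 'k iterm set" where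
  "diagram_mor R z (D_id X) = ident (AQ R z) X"
| "diagram_mor R z (D_u e) = AQ_mor R z (cross_u e)"
| "diagram_mor R z (D_r e) = AQ_mor R z (cross_r z e)"
| "diagram_mor R z (D_d e) = AQ_mor R z (cross_d e)"
| "diagram_mor R z (D_l e) = AQ_mor R z (cross_l e)"
| "diagram_mor R z D_cupL = AQ_mor R z cupL"
| "diagram_mor R z D_cupR = AQ_mor R z cupR"
| "diagram_mor R z D_capL = AQ_mor R z capL"
| "diagram_mor R z D_capR = AQ_mor R z capR"
| "diagram_mor R z D_c = AQ_mor R z tok_c"
| "diagram_mor R z D_o = AQ_mor R z tok_o"
| "diagram_mor R z (D_cmp e d) = cmp (AQ R z) (diagram_mor R z e) (diagram_mor R z d)"
| "diagram_mor R z (D_tens d e) = tens (AQ R z) (diagram_mor R z d) (diagram_mor R z e)"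

fun flip_sign :: "sign \<Rightarrow> sign" where
  "flip_sign Pos = Neg"
| "flip_sign Neg = Pos"

fun flip :: "diagram \<Rightarrow> diagram" where
  "flip (D_id X) = D_id X"
| "flip (D_u e) = D_u (flip_sign e)"
| "flip (D_r e) = D_r (flip_sign e)"
| "flip (D_d e) = D_d (flip_sign e)"
| "flip (D_l e) = D_l (flip_sign e)"
| "flip D_cupL = D_cupL"
| "flip D_cupR = D_cupR"
| "flip D_capL = D_capL"
| "flip D_capR = D_capR"
| "flip D_c = D_o"
| "flip D_o = D_c"
| "flip (D_cmp e d) = D_cmp (flip e) (flip d)"
| "flip (D_tens d e) = D_tens (flip d) (flip e)"

definition flips_generators ::
    "('k, 'x) ring_scheme \<Rightarrow> 'k \<Rightarrow> (orient list \<Rightarrow> orient list) \<Rightarrow>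
     ('k iterm set \<Rightarrow> 'k iterm set) \<Rightarrow> bool"
  where "flips_generators R z Fo Fm \<longleftrightarrow>
    Fo [\<up>] = [\<up>] \<and> Fo [\<down>] = [\<down>] \<and>
    Fm (AQ_mor R z tok_c) = AQ_mor R (\<ominus>\<^bsub>R\<^esub> z) tok_o \<and>
    Fm (AQ_mor R z tok_o) = AQ_mor R (\<ominus>\<^bsub>R\<^esub> z) tok_c \<and>
    Fm (AQ_mor R z (cross_u Pos)) = AQ_mor R (\<ominus>\<^bsub>R\<^esub> z) (cross_u Neg) \<and>
    Fm (AQ_mor R z (cross_u Neg)) = AQ_mor R (\<ominus>\<^bsub>R\<^esub> z) (cross_u Pos) \<and>
    Fm (AQ_mor R z capR) = AQ_mor R (\<ominus>\<^bsub>R\<^esub> z) capR \<and>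
    Fm (AQ_mor R z cupR) = AQ_mor R (\<ominus>\<^bsub>R\<^esub> z) cupR"

end

theory Submission
  imports Defs
begin

text \<open>
  The functor exchanges \<open>c\<close> with \<open>o\<close> and \<open>u\<^sup>+\<close> with \<open>u\<^sup>-\<close>, fixes the left cup and cap, and sends the
  generator \<open>r\<^sup>-\<close> to \<open>r\<^sup>+\<close>. The only relations that are not immediate say that \<open>r\<^sup>+\<close> and \<open>l\<^sup>-\<close>
  are mutually inverse; they follow from \<open>l\<^sup>+ = l\<^sup>- + z cup\<^sub>L cap\<^sub>L\<close> and \<open>cap\<^sub>R cup\<^sub>L = 0\<close>. Applying the
  construction twice gives the identity.

  Since the functor is prescribed on the right cup and cap but not on \<open>cap\<^sub>L\<close>, \<open>cup\<^sub>L\<close>, \<open>r\<^sup>-\<close>, uniqueness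
  needs an argument. The images of \<open>cap\<^sub>L\<close> and \<open>cup\<^sub>L\<close> again satisfy the zigzag relations, hence differ
  from \<open>cap\<^sub>L\<close> and \<open>cup\<^sub>L\<close> by an automorphism \<open>\<phi>\<close> of \<open>\<down>\<close>, and preservation of \<open>cap\<^sub>R\<close> becomes
  \<open>cap\<^sub>R (1 \<otimes> \<phi>) = cap\<^sub>R\<close>. The zigzag relation \<open>(1 \<otimes> cap\<^sub>R) (cup\<^sub>R \<otimes> 1) = 1\<close>, which is derived by
  rotating the braid relation twice, then gives \<open>\<phi> = 1\<close>.
\<close>

section \<open>Calculus of morphism classes\<close>

text \<open>The image of r^- is forced: l^+ is the rotation of u^+, so it goes to l^-, and r^-,
  being the inverse of l^+, must go to the inverse of l^-. That r^+ is this inverse rests on the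
  vanishing of the bubble cap_R cup_L: next to l^-, the correction z cup_R cap_R in r^+ turns into
  the correction that separates l^+ from l^-. Next to a left cup or cap the correction meets a
  bubble and dies, so r^+ and r^- define the same right cup and the same right cap; this is why the
  flip fixes them.

  The right zigzag uses a braid relation with one negative crossing. Two rotations turn it into a
  relation between two copies of l^+ and one d^-, and both copies of l^+ then cancel against the r^-
  inside the right cup and the right cap.

  Before that, the presented category has to be a supercategory at all. The delicate point is that
  an even and an odd morphism can agree only if both are zero: the rules of \<open>eqv\<close> also
  pass through inhomogeneous terms, so no parity can simply be read off a class.\<close>

inductive_cases typed_GenE [elim!]: "typed R P (Gen g) X Y"
inductive_cases typed_IdnE [elim!]: "typed R P (Idn Z) X Y"
inductive_cases typed_ZerE [elim!]: "typed R P (Zer Z W) X Y"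
inductive_cases typed_AddE [elim!]: "typed R P (Add s t) X Y"
inductive_cases typed_SclE [elim!]: "typed R P (Scl a t) X Y"
inductive_cases typed_CmpE [elim!]: "typed R P (t \<bullet> s) X Y"
inductive_cases typed_TnsE [elim!]: "typed R P (s \<boxtimes> t) X Y"

lemma typed_unique:
  "typed R P t X Y \<Longrightarrow> typed R P t X' Y' \<Longrightarrow> X' = X \<and> Y' = Y"
  by (induction t X Y arbitrary: X' Y' rule: typed.induct) blast+

lemma typed_simps [simp]:
  "typed R P (Gen g) X Y \<longleftrightarrow> X = source P g \<and> Y = target P g"
  "typed R P (Idn Z) X Y \<longleftrightarrow> X = Z \<and> Y = Z"
  "typed R P (Zer Z W) X Y \<longleftrightarrow> X = Z \<and> Y = W"
  "typed R P (Add s t) X Y \<longleftrightarrow> typed R P s X Y \<and> typed R P t X Y"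
  "typed R P (Scl a t) X Y \<longleftrightarrow> a \<in> carrier R \<and> typed R P t X Y"
  by (auto intro: typed.intros)

lemma typed_Cmp_iff: "typed R P (t \<bullet> s) X Z \<longleftrightarrow> (\<exists>Y. typed R P t Y Z \<and> typed R P s X Y)"
  by (auto intro: typed.intros)

lemma typed_Tns_iff: "typed R P (s \<boxtimes> t) X Y \<longleftrightarrow>
    (\<exists>X1 X2 Y1 Y2. X = X1 @ X2 \<and> Y = Y1 @ Y2 \<and> typed R P s X1 Y1 \<and> typed R P t X2 Y2)"
  by (auto intro: typed.intros)

text \<open>A relation between terms of mixed parity could identify an even morphism with a nonzero
  odd one. Homogeneity of the relations is what lets parity projections descend to classes.\<close>

locale presentation_over = cring R for R :: "('k, 'x) ring_scheme" (structure) +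
  fixes P :: "('a, 'g, 'k) presentation"
  assumes relations_homogeneous:
    "(s, t) \<in> relations P \<Longrightarrow> \<exists>p. has_parity P s p \<and> has_parity P t p"
begin

abbreviation "cl \<equiv> cls R P"
abbreviation "seq f g \<equiv> cmp (presented_supercat R P) g f"
notation seq (infixr \<open>\<triangleright>\<close> 60)
abbreviation "tn \<equiv> tens (presented_supercat R P)"
notation tn (infixr \<open>\<odot>\<close> 70)

text \<open>The addition and the scalar action of \<open>presented_hom R P X Y\<close> do not depend
  on \<open>X\<close> and \<open>Y\<close>. Names without these objects allow rewriting without
  knowing the source and the target.\<close>

definition plus :: "('a, 'g, 'k) tm set \<Rightarrow> ('a, 'g, 'k) tm set \<Rightarrow> ('a, 'g, 'k) tm set" (infixl \<open>\<^bold>+\<close> 55)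
  where "A \<^bold>+ B = (\<Union>s \<in> A. \<Union>t \<in> B. cls R P (Add s t))"
definition scal :: "'k \<Rightarrow> ('a, 'g, 'k) tm set \<Rightarrow> ('a, 'g, 'k) tm set"
  where "scal a A = (\<Union>t \<in> A. cls R P (Scl a t))"

lemma seq_def: "A \<triangleright> B = (\<Union>t \<in> B. \<Union>s \<in> A. cls R P (t \<bullet> s))"
  by (simp add: presented_supercat_def)

lemma tn_def: "A \<odot> B = (\<Union>s \<in> A. \<Union>t \<in> B. cls R P (s \<boxtimes> t))"
  by (simp add: presented_supercat_def)

lemma presented_hom_simps [simp]:
  "A \<oplus>\<^bsub>presented_hom R P X Y\<^esub> B = A \<^bold>+ B"
  "a \<odot>\<^bsub>presented_hom R P X Y\<^esub> A = scal a A"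
  "\<zero>\<^bsub>presented_hom R P X Y\<^esub> = cl (Zer X Y)"
  "carrier (presented_hom R P X Y) = {cl t | t. typed R P t X Y}"
  by (simp_all add: presented_hom_def plus_def scal_def)

lemma presented_supercat_simps [simp]:
  "Ob (presented_supercat R P) = UNIV"
  "Hom (presented_supercat R P) = presented_hom R P"
  "Homog (presented_supercat R P) X Y p = {cl t | t. typed R P t X Y \<and> has_parity P t p}"
  "ident (presented_supercat R P) X = cl (Idn X)"
  "unit_ob (presented_supercat R P) = []"
  "tens_ob (presented_supercat R P) = (@)"
  by (simp_all add: presented_supercat_def)

lemma super_sign_closed [simp]: "super_sign R p q \<in> carrier R"
  by (simp add: super_sign_def)

lemma eqv_typed: "eqv R P s t \<Longrightarrow> \<exists>X Y. typed R P s X Y \<and> typed R P t X Y"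
proof (induction rule: eqv.induct)
  case (trans s t u) then show ?case by (metis typed_unique)
next
  case (cong_add s s' t t' X Y) then show ?case by (metis typed_simps(4) typed_unique)
next
  case (cong_cmp t t' s s' X Y) then show ?case by (metis typed_Cmp_iff typed_unique)
next
  case (cong_tns s s' t t') then show ?case by (metis typed_Tns_iff)
qed (auto 0 4 simp: typed_Cmp_iff typed_Tns_iff simp flip: append_assoc intro: m_closed a_closed;
     metis append.assoc append_Nil append_Nil2)+

lemma eqv_typed_iff: "eqv R P s t \<Longrightarrow> typed R P s X Y \<longleftrightarrow> typed R P t X Y"
  by (metis eqv_typed typed_unique)

lemma cl_eq: "eqv R P s t \<Longrightarrow> cl s = cl t"
  unfolding cls_def by (auto intro: eqv.sym eqv.trans)

lemma mem_cl: "t \<in> cl s \<longleftrightarrow> eqv R P s t"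
  by (simp add: cls_def)

lemma mem_cl_self: "typed R P t X Y \<Longrightarrow> t \<in> cl t"
  by (auto simp: mem_cl intro: eqv.refl)

lemma cl_eqD: "typed R P t X Y \<Longrightarrow> cl s = cl t \<Longrightarrow> eqv R P s t"
  using mem_cl_self mem_cl by blast

text \<open>Every rule of \<open>eqv\<close>, including \<open>refl\<close>, relates only well-typed
  terms, so a term without a type is not even related to itself. The empty set thus plays the role
  of an undefined morphism.\<close>

lemma cl_empty: "cl t = {} \<longleftrightarrow> \<not> (\<exists>X Y. typed R P t X Y)"
  using mem_cl_self mem_cl eqv_typed by blast

text \<open>Congruence makes the union run over a single class. If the composite has no type, both
  sides are empty, so the equation is unconditional and serves as a rewrite rule in both directions;
  the same pattern recurs for the other operations.\<close>

lemma cl_seq: "cl s \<triangleright> cl t = cl (t \<bullet> s)" (is "_ = ?rhs")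
proof (cases "\<exists>X Z. typed R P (t \<bullet> s) X Z")
  case True
  then have "cl (t' \<bullet> s') = cl (t \<bullet> s)" if "t' \<in> cl t" "s' \<in> cl s" for t' s'
    using that by (metis cl_eq eqv.cong_cmp mem_cl)
  moreover have "t \<in> cl t" "s \<in> cl s"
    using True mem_cl_self by (metis typed_Cmp_iff)+
  ultimately show ?thesis unfolding seq_def by blast
next
  case False
  then have "cl (t' \<bullet> s') = {}" if "t' \<in> cl t" "s' \<in> cl s" for t' s'
    using that by (auto simp: cl_empty mem_cl typed_Cmp_iff eqv_typed_iff)
  moreover have e: "?rhs = {}" using False cl_empty by blast
  ultimately show ?thesis unfolding seq_def e by blast
qed

lemma cl_tn: "cl s \<odot> cl t = cl (s \<boxtimes> t)" (is "_ = ?rhs")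
proof (cases "\<exists>X Z. typed R P (s \<boxtimes> t) X Z")
  case True
  then have "cl (s' \<boxtimes> t') = cl (s \<boxtimes> t)" if "t' \<in> cl t" "s' \<in> cl s" for t' s'
    using that by (metis cl_eq eqv.cong_tns mem_cl)
  moreover have "t \<in> cl t" "s \<in> cl s"
    using True mem_cl_self by (metis typed_Tns_iff)+
  ultimately show ?thesis unfolding tn_def by blast
next
  case False
  then have "cl (s' \<boxtimes> t') = {}" if "t' \<in> cl t" "s' \<in> cl s" for t' s'
    using that unfolding cl_empty mem_cl typed_Tns_iff by (metis eqv_typed_iff)
  moreover have e: "?rhs = {}" using False cl_empty by blast
  ultimately show ?thesis unfolding tn_def e by blast
qed

lemma cl_plus: "cl s \<^bold>+ cl t = cl (Add s t)" (is "_ = ?rhs")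
proof (cases "\<exists>X Z. typed R P (Add s t) X Z")
  case True
  then have "cl (Add s' t') = cl (Add s t)" if "t' \<in> cl t" "s' \<in> cl s" for t' s'
    using that by (metis cl_eq eqv.cong_add mem_cl)
  moreover have "t \<in> cl t" "s \<in> cl s"
    using True mem_cl_self by (metis typed_simps(4))+
  ultimately show ?thesis unfolding plus_def by blast
next
  case False
  then have "cl (Add s' t') = {}" if "t' \<in> cl t" "s' \<in> cl s" for t' s'
    using that unfolding cl_empty mem_cl typed_simps by (metis eqv_typed_iff)
  moreover have e: "?rhs = {}" using False cl_empty by blast
  ultimately show ?thesis unfolding plus_def e by blast
qed

lemma cl_scal: "scal a (cl t) = cl (Scl a t)" (is "_ = ?rhs")
proof (cases "\<exists>X Z. typed R P (Scl a t) X Z")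
  case True
  then have "cl (Scl a t') = cl (Scl a t)" if "t' \<in> cl t" for t'
    using that by (metis cl_eq eqv.cong_scl mem_cl typed_simps(5))
  moreover have "t \<in> cl t"
    using True mem_cl_self by (metis typed_simps(5))
  ultimately show ?thesis unfolding scal_def by blast
next
  case False
  then have "cl (Scl a t') = {}" if "t' \<in> cl t" for t'
    using that unfolding cl_empty mem_cl typed_simps by (metis eqv_typed_iff)
  moreover have e: "?rhs = {}" using False cl_empty by blast
  ultimately show ?thesis unfolding scal_def e by blast
qed

definition hom :: "('a, 'g, 'k) tm set \<Rightarrow> 'a list \<Rightarrow> 'a list \<Rightarrow> bool"
  where "hom f X Y \<longleftrightarrow> (\<exists>t. typed R P t X Y \<and> f = cl t)"

definition homog :: "bit \<Rightarrow> ('a, 'g, 'k) tm set \<Rightarrow> 'a list \<Rightarrow> 'a list \<Rightarrow> bool"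
  where "homog p f X Y \<longleftrightarrow> (\<exists>t. typed R P t X Y \<and> has_parity P t p \<and> f = cl t)"

lemma homog_imp_hom: "homog p f X Y \<Longrightarrow> hom f X Y"
  by (auto simp: homog_def hom_def)

lemma hom_cl: "typed R P t X Y \<Longrightarrow> hom (cl t) X Y"
  by (auto simp: hom_def)

lemma homog_cl: "typed R P t X Y \<Longrightarrow> has_parity P t p \<Longrightarrow> homog p (cl t) X Y"
  by (auto simp: homog_def)

lemma hom_unique: "hom f X Y \<Longrightarrow> hom f X' Y' \<Longrightarrow> X' = X \<and> Y' = Y"
  unfolding hom_def by (metis cl_eqD eqv_typed_iff typed_unique)

lemma hom_cl_iff: "hom (cl t) X Y \<longleftrightarrow> typed R P t X Y"
  unfolding hom_def by (metis cl_eqD eqv_typed_iff)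

lemma hom_intros [intro, simp]:
  "hom (cl (Idn X)) X X"
  "hom (cl (Zer X Y)) X Y"
  "hom f X Y \<Longrightarrow> hom g X Y \<Longrightarrow> hom (f \<^bold>+ g) X Y"
  "a \<in> carrier R \<Longrightarrow> hom f X Y \<Longrightarrow> hom (scal a f) X Y"
  "hom f X Y \<Longrightarrow> hom g X' Y' \<Longrightarrow> hom (f \<odot> g) (X @ X') (Y @ Y')"
proof -
  show "hom (cl (Idn X)) X X" "hom (cl (Zer X Y)) X Y"
    by (simp_all add: hom_cl)
  show "hom f X Y \<Longrightarrow> hom g X Y \<Longrightarrow> hom (f \<^bold>+ g) X Y"
    unfolding hom_def by (metis cl_plus typed_simps(4))
  show "a \<in> carrier R \<Longrightarrow> hom f X Y \<Longrightarrow> hom (scal a f) X Y"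
    unfolding hom_def by (metis cl_scal typed_simps(5))
  show "hom f X Y \<Longrightarrow> hom g X' Y' \<Longrightarrow> hom (f \<odot> g) (X @ X') (Y @ Y')"
    unfolding hom_def by (metis cl_tn typed.intros(7))
qed

lemma hom_seq [intro]: "hom f X Y \<Longrightarrow> hom g Y Z \<Longrightarrow> hom (f \<triangleright> g) X Z"
  unfolding hom_def by (metis cl_seq typed.intros(6))

lemma homog_intros [intro, simp]:
  "homog 0 (cl (Idn X)) X X"
  "homog p (cl (Zer X Y)) X Y"
  "homog p f X Y \<Longrightarrow> homog p g X Y \<Longrightarrow> homog p (f \<^bold>+ g) X Y"
  "a \<in> carrier R \<Longrightarrow> homog p f X Y \<Longrightarrow> homog p (scal a f) X Y"
proof -
  show "homog 0 (cl (Idn X)) X X" "homog p (cl (Zer X Y)) X Y"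
    by (simp_all add: homog_cl has_parity.intros)
  show "homog p f X Y \<Longrightarrow> homog p g X Y \<Longrightarrow> homog p (f \<^bold>+ g) X Y"
    unfolding homog_def by (metis cl_plus typed_simps(4) has_parity.intros(4))
  show "a \<in> carrier R \<Longrightarrow> homog p f X Y \<Longrightarrow> homog p (scal a f) X Y"
    unfolding homog_def by (metis cl_scal typed_simps(5) has_parity.intros(5))
qed

lemma homog_tn:
  "homog p f X Y \<Longrightarrow> homog q g X' Y' \<Longrightarrow> homog (p + q) (f \<odot> g) (X @ X') (Y @ Y')"
  unfolding homog_def by (metis cl_tn typed.intros(7) has_parity.intros(7))

lemma homog_seq: "homog p f X Y \<Longrightarrow> homog q g Y Z \<Longrightarrow> homog (q + p) (f \<triangleright> g) X Z"
  unfolding homog_def by (metis cl_seq typed.intros(6) has_parity.intros(6))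

text \<open>
  Classes of terms that are not well typed are empty, so associativity needs no typing hypotheses; the
  same holds for \<open>tn_assoc\<close>, \<open>plus_assoc\<close> and the bilinearity laws below.
\<close>

lemma seq_assoc: "(f \<triangleright> g) \<triangleright> h = f \<triangleright> g \<triangleright> h"
proof -
  have *: "cl ((u \<bullet> t) \<bullet> s) = cl (u \<bullet> (t \<bullet> s))" for u t s
  proof (cases "\<exists>X Y. typed R P (u \<bullet> t \<bullet> s) X Y")
    case True
    then obtain X Y Z W where "typed R P u Z W" "typed R P t Y Z" "typed R P s X Y"
      unfolding typed_Cmp_iff by blast
    then show ?thesis by (intro cl_eq eqv.cmp_assoc)
  next
    case False
    moreover from False have "\<not> (\<exists>X Y. typed R P (u \<bullet> (t \<bullet> s)) X Y)"
      unfolding typed_Cmp_iff by blast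
    ultimately show ?thesis using cl_empty by metis
  qed
  \<comment> \<open>The outer factor is a single raw term, because \<open>f\<close>,
    \<open>g\<close>, \<open>h\<close> are arbitrary sets and not only classes. If the inner
    composite has no type, then neither has the whole, and both sides are empty.\<close>
  have 1: "cl (t \<bullet> s) \<triangleright> {u} = cl (u \<bullet> (t \<bullet> s))" for t s u
  proof -
    have "cl (u \<bullet> s') = cl (u \<bullet> (t \<bullet> s))" if "s' \<in> cl (t \<bullet> s)" for s'
      using that by (metis cl_eq cl_seq mem_cl)
    moreover have "t \<bullet> s \<in> cl (t \<bullet> s) \<or> cl (u \<bullet> (t \<bullet> s)) = {}"
      unfolding cl_empty typed_Cmp_iff by (meson mem_cl_self typed.intros(6))
    ultimately show ?thesis unfolding seq_def by blast
  qed
  have 2: "{s} \<triangleright> cl (u \<bullet> t) = cl (u \<bullet> (t \<bullet> s))" for t s u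
    proof -
      have "cl (s' \<bullet> s) = cl (u \<bullet> t \<bullet> s)" if "s' \<in> cl (u \<bullet> t)" for s'
        using that by (metis cl_eq cl_seq mem_cl)
      moreover have "u \<bullet> t \<in> cl (u \<bullet> t) \<or> cl (u \<bullet> t \<bullet> s) = {}"
        unfolding cl_empty typed_Cmp_iff by (meson mem_cl_self typed.intros(6))
      ultimately show ?thesis unfolding seq_def *[symmetric] by blast
    qed
  have "(f \<triangleright> g) \<triangleright> h = (\<Union>u\<in>h. \<Union>t\<in>g. \<Union>s\<in>f. cl (t \<bullet> s) \<triangleright> {u})"
    unfolding seq_def by blast
  also have "\<dots> = (\<Union>u\<in>h. \<Union>t\<in>g. \<Union>s\<in>f. {s} \<triangleright> cl (u \<bullet> t))"
    by (simp only: 1 2)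
  also have "\<dots> = f \<triangleright> g \<triangleright> h"
    unfolding seq_def by blast
  finally show ?thesis .
qed

lemma tn_assoc: "(f \<odot> g) \<odot> h = f \<odot> g \<odot> h"
proof -
  have *: "cl ((u \<boxtimes> t) \<boxtimes> s) = cl (u \<boxtimes> (t \<boxtimes> s))" for u t s
  proof (cases "\<exists>X Y. typed R P (u \<boxtimes> t \<boxtimes> s) X Y")
    case True
    then obtain X Y X' Y' X'' Y'' where "typed R P u X Y" "typed R P t X' Y'" "typed R P s X'' Y''"
      unfolding typed_Tns_iff by blast
    then show ?thesis by (intro cl_eq eqv.tns_assoc)
  next
    case False
    moreover from False have "\<not> (\<exists>X Y. typed R P (u \<boxtimes> (t \<boxtimes> s)) X Y)"
      unfolding typed_Tns_iff by blast
    ultimately show ?thesis using cl_empty by metis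
  qed
  have 1: "cl (s \<boxtimes> t) \<odot> {u} = cl (s \<boxtimes> (t \<boxtimes> u))" for t s u
  proof -
    have "cl (s' \<boxtimes> u) = cl (s \<boxtimes> t \<boxtimes> u)" if "s' \<in> cl (s \<boxtimes> t)" for s'
      using that by (metis cl_eq cl_tn mem_cl)
    moreover have "s \<boxtimes> t \<in> cl (s \<boxtimes> t) \<or> cl (s \<boxtimes> t \<boxtimes> u) = {}"
      unfolding cl_empty typed_Tns_iff by (meson mem_cl_self typed.intros(7))
    ultimately show ?thesis unfolding tn_def *[symmetric] by blast
  qed
  have 2: "{s} \<odot> cl (t \<boxtimes> u) = cl (s \<boxtimes> (t \<boxtimes> u))" for t s u
    proof -
      have "cl (s \<boxtimes> s') = cl (s \<boxtimes> (t \<boxtimes> u))" if "s' \<in> cl (t \<boxtimes> u)" for s'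
        using that by (metis cl_eq cl_tn mem_cl)
      moreover have "t \<boxtimes> u \<in> cl (t \<boxtimes> u) \<or> cl (s \<boxtimes> (t \<boxtimes> u)) = {}"
        unfolding cl_empty typed_Tns_iff by (meson mem_cl_self typed.intros(7))
      ultimately show ?thesis unfolding tn_def by blast
    qed
  have "(f \<odot> g) \<odot> h = (\<Union>u\<in>h. \<Union>t\<in>g. \<Union>s\<in>f. cl (s \<boxtimes> t) \<odot> {u})"
    unfolding tn_def by blast
  also have "\<dots> = (\<Union>u\<in>h. \<Union>t\<in>g. \<Union>s\<in>f. {s} \<odot> cl (t \<boxtimes> u))"
    by (simp only: 1 2)
  also have "\<dots> = f \<odot> g \<odot> h"
    unfolding tn_def by blast
  finally show ?thesis .
qed

lemma seq_idn [simp]: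
  assumes "hom f X Y"
  shows "cl (Idn X) \<triangleright> f = f" "f \<triangleright> cl (Idn Y) = f"
proof -
  obtain t where t: "typed R P t X Y" "f = cl t"
    using assms unfolding hom_def by blast
  show "cl (Idn X) \<triangleright> f = f" "f \<triangleright> cl (Idn Y) = f"
    unfolding t(2) cl_seq
    by (rule cl_eq, rule eqv.cmp_idn_right, rule t(1))
      (rule cl_eq, rule eqv.cmp_idn_left, rule t(1))
qed

lemma tn_unit [simp]:
  assumes "hom f X Y"
  shows "cl (Idn []) \<odot> f = f" "f \<odot> cl (Idn []) = f"
proof -
  obtain t where t: "typed R P t X Y" "f = cl t"
    using assms unfolding hom_def by blast
  show "cl (Idn []) \<odot> f = f" "f \<odot> cl (Idn []) = f"
    unfolding t(2) cl_tn
    by (rule cl_eq, rule eqv.tns_unit_left, rule t(1))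
      (rule cl_eq, rule eqv.tns_unit_right, rule t(1))
qed

lemma tn_idn [simp]: "cl (Idn A) \<odot> cl (Idn B) = cl (Idn (A @ B))"
  unfolding cl_tn by (rule cl_eq, rule eqv.tns_idn)

text \<open>If neither term has a type, both classes are empty. An equation of classes therefore
  needs a proof only under the assumption that one of its sides is well typed.\<close>

lemma cl_eqI:
  assumes "\<And>X Y. typed R P s X Y \<Longrightarrow> eqv R P s t" "\<And>X Y. typed R P t X Y \<Longrightarrow> eqv R P s t"
  shows "cl s = cl t"
  using assms cl_eq cl_empty by metis

lemma plus_comm: "f \<^bold>+ g = g \<^bold>+ f"
proof -
  have "cl (Add s t) = cl (Add t s)" for s t
    by (rule cl_eqI) (auto intro: eqv.add_comm)
  then show ?thesis unfolding plus_def by blast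
qed

lemma plus_assoc: "(f \<^bold>+ g) \<^bold>+ h = f \<^bold>+ (g \<^bold>+ h)"
proof -
  have *: "cl (Add (Add s t) u) = cl (Add s (Add t u))" for u t s
    by (rule cl_eqI) (auto intro: eqv.add_assoc)
  have 1: "cl (Add s t) \<^bold>+ {u} = cl (Add s (Add t u))" for t s u
  proof -
    have "cl (Add s' u) = cl (Add (Add s t) u)" if "s' \<in> cl (Add s t)" for s'
      using that by (metis cl_eq cl_plus mem_cl)
    moreover have "Add s t \<in> cl (Add s t) \<or> cl (Add (Add s t) u) = {}"
      unfolding cl_empty by (meson mem_cl_self typed_simps(4))
    ultimately show ?thesis unfolding plus_def *[symmetric] by blast
  qed
  have 2: "{s} \<^bold>+ cl (Add t u) = cl (Add s (Add t u))" for t s u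
  proof -
    have "cl (Add s s') = cl (Add s (Add t u))" if "s' \<in> cl (Add t u)" for s'
      using that by (metis cl_eq cl_plus mem_cl)
    moreover have "Add t u \<in> cl (Add t u) \<or> cl (Add s (Add t u)) = {}"
      unfolding cl_empty by (meson mem_cl_self typed_simps(4))
    ultimately show ?thesis unfolding plus_def by blast
  qed
  have "(f \<^bold>+ g) \<^bold>+ h = (\<Union>u\<in>h. \<Union>t\<in>g. \<Union>s\<in>f. cl (Add s t) \<^bold>+ {u})"
    unfolding plus_def by blast
  also have "\<dots> = (\<Union>u\<in>h. \<Union>t\<in>g. \<Union>s\<in>f. {s} \<^bold>+ cl (Add t u))"
    by (simp only: 1 2)
  also have "\<dots> = f \<^bold>+ (g \<^bold>+ h)"
    unfolding plus_def by blast
  finally show ?thesis .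
qed

lemma plus_left_comm: "f \<^bold>+ (g \<^bold>+ h) = g \<^bold>+ (f \<^bold>+ h)"
  by (metis plus_assoc plus_comm)

lemmas plus_ac = plus_assoc plus_comm plus_left_comm

lemma plus_zero [simp]:
  assumes "hom f X Y"
  shows "f \<^bold>+ cl (Zer X Y) = f" "cl (Zer X Y) \<^bold>+ f = f"
proof -
  show 1: "f \<^bold>+ cl (Zer X Y) = f"
    using assms by - (unfold hom_def, elim exE conjE, simp only: cl_plus, rule cl_eq, rule eqv.add_zero)
  show "cl (Zer X Y) \<^bold>+ f = f"
    using plus_comm 1 by metis
qed

lemma scal_zero [simp]: "hom f X Y \<Longrightarrow> scal \<zero> f = cl (Zer X Y)"
  by (unfold hom_def, elim exE conjE, simp only: cl_scal, rule cl_eq, rule eqv.scl_zero)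

lemma scal_one [simp]: "hom f X Y \<Longrightarrow> scal \<one> f = f"
  by (unfold hom_def, elim exE conjE, simp only: cl_scal, rule cl_eq, rule eqv.scl_one)

lemma scal_mult: "a \<in> carrier R \<Longrightarrow> b \<in> carrier R \<Longrightarrow> hom f X Y \<Longrightarrow> scal (a \<otimes> b) f = scal a (scal b f)"
  by (unfold hom_def, elim exE conjE, simp only: cl_scal, rule cl_eq, rule eqv.scl_mult)

lemma scal_add_left: "a \<in> carrier R \<Longrightarrow> b \<in> carrier R \<Longrightarrow> hom f X Y \<Longrightarrow> scal (a \<oplus> b) f = scal a f \<^bold>+ scal b f"
  by (unfold hom_def, elim exE conjE, simp only: cl_scal cl_plus, rule cl_eq, rule eqv.scl_add_left)

text \<open>A distributive law repeats one factor on its right-hand side, and for an arbitrary set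
  the two occurrences could pick different representatives. Being a class, possibly the empty one,
  suffices, and the simplifier can establish it without any objects.\<close>

definition is_cls :: "('a, 'g, 'k) tm set \<Rightarrow> bool"
  where "is_cls f \<longleftrightarrow> f \<in> range cl"

lemma is_cls_intros [simp]:
  "is_cls (cl t)"
  "is_cls f \<Longrightarrow> is_cls g \<Longrightarrow> is_cls (f \<^bold>+ g)"
  "is_cls f \<Longrightarrow> is_cls (scal a f)"
  "is_cls f \<Longrightarrow> is_cls g \<Longrightarrow> is_cls (f \<triangleright> g)"
  "is_cls f \<Longrightarrow> is_cls g \<Longrightarrow> is_cls (f \<odot> g)"
  by (auto simp: is_cls_def cl_plus cl_scal cl_seq cl_tn)

lemma hom_is_cls: "hom f X Y \<Longrightarrow> is_cls f"
  by (auto simp: is_cls_def hom_def)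

lemma scal_plus:
  assumes "is_cls f" "is_cls g"
  shows "scal a (f \<^bold>+ g) = scal a f \<^bold>+ scal a g"
proof -
  have "cl (Scl a (Add s t)) = cl (Add (Scl a s) (Scl a t))" for s t
    by (rule cl_eqI) (auto intro!: eqv.scl_add_right)
  then show ?thesis using assms by (auto simp only: is_cls_def cl_scal cl_plus)
qed

lemma seq_plus_right:
  assumes "is_cls f" "is_cls g" "is_cls h"
  shows "f \<triangleright> (g \<^bold>+ h) = (f \<triangleright> g) \<^bold>+ (f \<triangleright> h)"
proof -
  have *: "typed R P (Add s t \<bullet> r) X Y \<longleftrightarrow> typed R P (Add (s \<bullet> r) (t \<bullet> r)) X Y" for r s t X Y
    by (auto simp: typed_Cmp_iff dest: typed_unique)
  have "cl (Add s t \<bullet> r) = cl (Add (s \<bullet> r) (t \<bullet> r))" for r s t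
  proof (rule cl_eqI)
    fix X Y
    assume "typed R P (Add s t \<bullet> r) X Y"
    then show "eqv R P (Add s t \<bullet> r) (Add (s \<bullet> r) (t \<bullet> r))"
      by (auto simp: typed_Cmp_iff dest: typed_unique intro: eqv.cmp_add_left)
    next
    fix X Y
    assume "typed R P (Add (s \<bullet> r) (t \<bullet> r)) X Y"
    then have "typed R P (Add s t \<bullet> r) X Y" by (simp only: *)
    then show "eqv R P (Add s t \<bullet> r) (Add (s \<bullet> r) (t \<bullet> r))"
      by (auto simp: typed_Cmp_iff dest: typed_unique intro: eqv.cmp_add_left)
  qed
  then show ?thesis using assms by (auto simp only: is_cls_def cl_seq cl_plus)
qed

lemma seq_plus_left:
  assumes "is_cls f" "is_cls g" "is_cls h"
  shows "(f \<^bold>+ g) \<triangleright> h = (f \<triangleright> h) \<^bold>+ (g \<triangleright> h)"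
proof -
  have *: "typed R P (r \<bullet> Add s t) X Y \<longleftrightarrow> typed R P (Add (r \<bullet> s) (r \<bullet> t)) X Y" for r s t X Y
    by (auto simp: typed_Cmp_iff dest: typed_unique)
  have "cl (r \<bullet> Add s t) = cl (Add (r \<bullet> s) (r \<bullet> t))" for r s t
  proof (rule cl_eqI)
    fix X Y
    assume "typed R P (r \<bullet> Add s t) X Y"
    then show "eqv R P (r \<bullet> Add s t) (Add (r \<bullet> s) (r \<bullet> t))"
      by (auto simp: typed_Cmp_iff dest: typed_unique intro: eqv.cmp_add_right)
    next
    fix X Y
    assume "typed R P (Add (r \<bullet> s) (r \<bullet> t)) X Y"
    then have "typed R P (r \<bullet> Add s t) X Y" by (simp only: *)
    then show "eqv R P (r \<bullet> Add s t) (Add (r \<bullet> s) (r \<bullet> t))"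
      by (auto simp: typed_Cmp_iff dest: typed_unique intro: eqv.cmp_add_right)
  qed
  then show ?thesis using assms by (auto simp only: is_cls_def cl_seq cl_plus)
qed

lemma tn_plus_right:
  assumes "is_cls f" "is_cls g" "is_cls h"
  shows "f \<odot> (g \<^bold>+ h) = (f \<odot> g) \<^bold>+ (f \<odot> h)"
proof -
  have *: "typed R P (r \<boxtimes> Add s t) X Y \<longleftrightarrow> typed R P (Add (r \<boxtimes> s) (r \<boxtimes> t)) X Y" for r s t X Y
    by (auto simp: typed_Tns_iff) (metis append_same_eq same_append_eq typed_unique)
  have "cl (r \<boxtimes> Add s t) = cl (Add (r \<boxtimes> s) (r \<boxtimes> t))" for r s t
  proof (rule cl_eqI)
    fix X Y
    assume "typed R P (r \<boxtimes> Add s t) X Y"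
    then show "eqv R P (r \<boxtimes> Add s t) (Add (r \<boxtimes> s) (r \<boxtimes> t))"
      by (auto simp: typed_Tns_iff dest: typed_unique intro: eqv.tns_add_right)
    next
    fix X Y
    assume "typed R P (Add (r \<boxtimes> s) (r \<boxtimes> t)) X Y"
    then have "typed R P (r \<boxtimes> Add s t) X Y" by (simp only: *)
    then show "eqv R P (r \<boxtimes> Add s t) (Add (r \<boxtimes> s) (r \<boxtimes> t))"
      by (auto simp: typed_Tns_iff dest: typed_unique intro: eqv.tns_add_right)
  qed
  then show ?thesis using assms by (auto simp only: is_cls_def cl_tn cl_plus)
qed

lemma tn_plus_left:
  assumes "is_cls f" "is_cls g" "is_cls h"
  shows "(f \<^bold>+ g) \<odot> h = (f \<odot> h) \<^bold>+ (g \<odot> h)"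
proof -
  have *: "typed R P (Add s t \<boxtimes> r) X Y \<longleftrightarrow> typed R P (Add (s \<boxtimes> r) (t \<boxtimes> r)) X Y" for r s t X Y
    by (auto simp: typed_Tns_iff) (metis append_same_eq same_append_eq typed_unique)
  have "cl (Add s t \<boxtimes> r) = cl (Add (s \<boxtimes> r) (t \<boxtimes> r))" for r s t
  proof (rule cl_eqI)
    fix X Y
    assume "typed R P (Add s t \<boxtimes> r) X Y"
    then show "eqv R P (Add s t \<boxtimes> r) (Add (s \<boxtimes> r) (t \<boxtimes> r))"
      by (auto simp: typed_Tns_iff dest: typed_unique intro: eqv.tns_add_left)
    next
    fix X Y
    assume "typed R P (Add (s \<boxtimes> r) (t \<boxtimes> r)) X Y"
    then have "typed R P (Add s t \<boxtimes> r) X Y" by (simp only: *)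
    then show "eqv R P (Add s t \<boxtimes> r) (Add (s \<boxtimes> r) (t \<boxtimes> r))"
      by (auto simp: typed_Tns_iff dest: typed_unique intro: eqv.tns_add_left)
  qed
  then show ?thesis using assms by (auto simp only: is_cls_def cl_tn cl_plus)
qed

lemma seq_scal_right:
  assumes "is_cls f" "is_cls g"
  shows "f \<triangleright> scal a g = scal a (f \<triangleright> g)"
proof -
  have *: "typed R P (Scl a t \<bullet> s) X Y \<longleftrightarrow> typed R P (Scl a (t \<bullet> s)) X Y" for s t X Y
    by (auto simp: typed_Cmp_iff dest: typed_unique)
  have "cl (Scl a t \<bullet> s) = cl (Scl a (t \<bullet> s))" for s t
  proof (rule cl_eqI)
    fix X Y
    assume "typed R P (Scl a t \<bullet> s) X Y"
    then show "eqv R P (Scl a t \<bullet> s) (Scl a (t \<bullet> s))"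
      by (auto simp: typed_Cmp_iff dest: typed_unique intro: eqv.cmp_scl_left)
    next
    fix X Y
    assume "typed R P (Scl a (t \<bullet> s)) X Y"
    then have "typed R P (Scl a t \<bullet> s) X Y" by (simp only: *)
    then show "eqv R P (Scl a t \<bullet> s) (Scl a (t \<bullet> s))"
      by (auto simp: typed_Cmp_iff dest: typed_unique intro: eqv.cmp_scl_left)
  qed
  then show ?thesis using assms by (auto simp only: is_cls_def cl_seq cl_scal)
qed

lemma seq_scal_left:
  assumes "is_cls f" "is_cls g"
  shows "scal a f \<triangleright> g = scal a (f \<triangleright> g)"
proof -
  have *: "typed R P (t \<bullet> Scl a s) X Y \<longleftrightarrow> typed R P (Scl a (t \<bullet> s)) X Y" for s t X Y
    by (auto simp: typed_Cmp_iff dest: typed_unique)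
  have "cl (t \<bullet> Scl a s) = cl (Scl a (t \<bullet> s))" for s t
  proof (rule cl_eqI)
    fix X Y
    assume "typed R P (t \<bullet> Scl a s) X Y"
    then show "eqv R P (t \<bullet> Scl a s) (Scl a (t \<bullet> s))"
      by (auto simp: typed_Cmp_iff dest: typed_unique intro: eqv.cmp_scl_right)
    next
    fix X Y
    assume "typed R P (Scl a (t \<bullet> s)) X Y"
    then have "typed R P (t \<bullet> Scl a s) X Y" by (simp only: *)
    then show "eqv R P (t \<bullet> Scl a s) (Scl a (t \<bullet> s))"
      by (auto simp: typed_Cmp_iff dest: typed_unique intro: eqv.cmp_scl_right)
  qed
  then show ?thesis using assms by (auto simp only: is_cls_def cl_seq cl_scal)
qed

lemma tn_scal_right:
  assumes "is_cls f" "is_cls g"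
  shows "f \<odot> scal a g = scal a (f \<odot> g)"
proof -
  have *: "typed R P (s \<boxtimes> Scl a t) X Y \<longleftrightarrow> typed R P (Scl a (s \<boxtimes> t)) X Y" for s t X Y
    by (auto simp: typed_Tns_iff dest: typed_unique)
  have "cl (s \<boxtimes> Scl a t) = cl (Scl a (s \<boxtimes> t))" for s t
  proof (rule cl_eqI)
    fix X Y
    assume "typed R P (s \<boxtimes> Scl a t) X Y"
    then show "eqv R P (s \<boxtimes> Scl a t) (Scl a (s \<boxtimes> t))"
      by (auto simp: typed_Tns_iff dest: typed_unique intro: eqv.tns_scl_right)
    next
    fix X Y
    assume "typed R P (Scl a (s \<boxtimes> t)) X Y"
    then have "typed R P (s \<boxtimes> Scl a t) X Y" by (simp only: *)
    then show "eqv R P (s \<boxtimes> Scl a t) (Scl a (s \<boxtimes> t))"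
      by (auto simp: typed_Tns_iff dest: typed_unique intro: eqv.tns_scl_right)
  qed
  then show ?thesis using assms by (auto simp only: is_cls_def cl_tn cl_scal)
qed

lemma tn_scal_left:
  assumes "is_cls f" "is_cls g"
  shows "scal a f \<odot> g = scal a (f \<odot> g)"
proof -
  have *: "typed R P (Scl a s \<boxtimes> t) X Y \<longleftrightarrow> typed R P (Scl a (s \<boxtimes> t)) X Y" for s t X Y
    by (auto simp: typed_Tns_iff dest: typed_unique)
  have "cl (Scl a s \<boxtimes> t) = cl (Scl a (s \<boxtimes> t))" for s t
  proof (rule cl_eqI)
    fix X Y
    assume "typed R P (Scl a s \<boxtimes> t) X Y"
    then show "eqv R P (Scl a s \<boxtimes> t) (Scl a (s \<boxtimes> t))"
      by (auto simp: typed_Tns_iff dest: typed_unique intro: eqv.tns_scl_left)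
    next
    fix X Y
    assume "typed R P (Scl a (s \<boxtimes> t)) X Y"
    then have "typed R P (Scl a s \<boxtimes> t) X Y" by (simp only: *)
    then show "eqv R P (Scl a s \<boxtimes> t) (Scl a (s \<boxtimes> t))"
      by (auto simp: typed_Tns_iff dest: typed_unique intro: eqv.tns_scl_left)
  qed
  then show ?thesis using assms by (auto simp only: is_cls_def cl_tn cl_scal)
qed

lemma interchange:
  "homog p f X Y \<Longrightarrow> hom f' Y Z \<Longrightarrow> homog q g Y' Z' \<Longrightarrow> hom g' X' Y' \<Longrightarrow>
    (f \<odot> g') \<triangleright> (f' \<odot> g) = scal (super_sign R p q) ((f \<triangleright> f') \<odot> (g' \<triangleright> g))"
  by (unfold hom_def homog_def, elim exE conjE, simp only: cl_tn cl_scal cl_seq, rule cl_eq, rule eqv.interchange)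

lemma scal_Zer [simp]:
  assumes "a \<in> carrier R"
  shows "scal a (cl (Zer X Y)) = cl (Zer X Y)"
proof -
  have "scal a (cl (Zer X Y)) = scal a (scal \<zero> (cl (Zer X Y)))"
    by (simp only: scal_zero[OF hom_intros(2)])
  also have "\<dots> = scal (a \<otimes> \<zero>) (cl (Zer X Y))"
    by (rule scal_mult[symmetric, OF assms zero_closed hom_intros(2)])
  finally show ?thesis
    using assms by (simp add: scal_zero[OF hom_intros(2)])
qed

text \<open>No rule of \<open>eqv\<close> says that zero absorbs composition. It follows by writing
  zero as \<open>\<zero>\<close> times itself and pulling the scalar out of the composite.\<close>

lemma seq_Zer_left [simp]:
  assumes "hom f Y Z"
  shows "cl (Zer X Y) \<triangleright> f = cl (Zer X Z)"
  using seq_scal_left[of "cl (Zer X Y)" f \<zero>] scal_zero[OF hom_seq[OF hom_intros(2) assms]]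
  by (simp add: hom_is_cls[OF assms] scal_zero[OF hom_intros(2)])

lemma seq_Zer_right [simp]:
  assumes "hom f X Y"
  shows "f \<triangleright> cl (Zer Y Z) = cl (Zer X Z)"
  using seq_scal_right[of f "cl (Zer Y Z)" \<zero>] scal_zero[OF hom_seq[OF assms hom_intros(2)]]
  by (simp add: hom_is_cls[OF assms] scal_zero[OF hom_intros(2)])

lemma tn_Zer_left [simp]:
  assumes "hom f X Y"
  shows "cl (Zer X' Y') \<odot> f = cl (Zer (X' @ X) (Y' @ Y))"
  using tn_scal_left[of "cl (Zer X' Y')" f \<zero>] scal_zero[OF hom_intros(5)[OF hom_intros(2) assms]]
  by (simp add: hom_is_cls[OF assms] scal_zero[OF hom_intros(2)])

lemma tn_Zer_right [simp]:
  assumes "hom f X Y"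
  shows "f \<odot> cl (Zer X' Y') = cl (Zer (X @ X') (Y @ Y'))"
  using tn_scal_right[of f "cl (Zer X' Y')" \<zero>] scal_zero[OF hom_intros(5)[OF assms hom_intros(2)]]
  by (simp add: hom_is_cls[OF assms] scal_zero[OF hom_intros(2)])

section \<open>Parity decomposition\<close>

text \<open>
  The parity \<open>p\<close> part of a term; that it respects \<^const>\<open>eqv\<close> makes the sum of the even and the odd
  morphisms direct.
\<close>

fun parity_proj :: "bit \<Rightarrow> ('a, 'g, 'k) tm \<Rightarrow> ('a, 'g, 'k) tm" where
  "parity_proj p (Gen g) = (if parity P g = p then Gen g else Zer (source P g) (target P g))"
| "parity_proj p (Idn X) = (if p = 0 then Idn X else Zer X X)"
| "parity_proj p (Zer X Y) = Zer X Y"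
| "parity_proj p (Add s t) = Add (parity_proj p s) (parity_proj p t)"
| "parity_proj p (Scl a t) = Scl a (parity_proj p t)"
| "parity_proj p (t \<bullet> s) = Add (parity_proj 0 t \<bullet> parity_proj p s) (parity_proj 1 t \<bullet> parity_proj (p + 1) s)"
| "parity_proj p (s \<boxtimes> t) = Add (parity_proj 0 s \<boxtimes> parity_proj p t) (parity_proj 1 s \<boxtimes> parity_proj (p + 1) t)"

lemma typed_parity_proj: "typed R P t X Y \<Longrightarrow> typed R P (parity_proj p t) X Y"
  by (induction t X Y arbitrary: p rule: typed.induct)
    (auto simp: typed_Cmp_iff intro: typed.intros)

lemma has_parity_parity_proj: "has_parity P (parity_proj p t) p"
proof (induction t arbitrary: p)
  case (Cmp t s)
  have "has_parity P (parity_proj 1 t \<bullet> parity_proj (p + 1) s) (1 + (p + 1))"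
    "has_parity P (parity_proj 0 t \<bullet> parity_proj p s) (0 + p)"
    using Cmp by (blast intro: has_parity.intros)+
  moreover have "1 + (p + 1) = p" "0 + p = p" for p :: bit by (cases p; simp)+
  ultimately show ?case by (auto intro: has_parity.intros)
next
  case (Tns t s)
  have "has_parity P (parity_proj 1 t \<boxtimes> parity_proj (p + 1) s) (1 + (p + 1))"
    "has_parity P (parity_proj 0 t \<boxtimes> parity_proj p s) (0 + p)"
    using Tns by (blast intro: has_parity.intros)+
  moreover have "1 + (p + 1) = p" "0 + p = p" for p :: bit by (cases p; simp)+
  ultimately show ?case by (auto intro: has_parity.intros)
next
  case (Gen g)
  have "has_parity P (Gen g) (parity P g)" by (rule has_parity.intros)
  then show ?case by (auto intro: has_parity.intros)
qed (auto intro: has_parity.intros)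

definition part :: "bit \<Rightarrow> ('a, 'g, 'k) tm \<Rightarrow> ('a, 'g, 'k) tm set"
  where "part p t = cl (parity_proj p t)"

lemma is_cls_part [simp]: "is_cls (part p t)"
  by (simp add: part_def)

lemma hom_part: "typed R P t X Y \<Longrightarrow> hom (part p t) X Y"
  by (simp add: part_def hom_cl typed_parity_proj)

lemma homog_part: "typed R P t X Y \<Longrightarrow> homog p (part p t) X Y"
  by (simp add: part_def homog_cl typed_parity_proj has_parity_parity_proj)

lemma part_simps [simp]:
  "part p (Idn X) = (if p = 0 then cl (Idn X) else cl (Zer X X))"
  "part p (Zer X Y) = cl (Zer X Y)"
  "part p (Add s t) = part p s \<^bold>+ part p t"
  "part p (Scl a t) = scal a (part p t)"
  by (simp_all add: part_def cl_plus cl_scal)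

lemma part_Cmp: "part p (t \<bullet> s) = (part p s \<triangleright> part 0 t) \<^bold>+ (part (p + 1) s \<triangleright> part 1 t)"
  by (simp add: part_def cl_plus cl_seq del: add_bit_eq_xor)

lemma part_Tns: "part p (s \<boxtimes> t) = (part 0 s \<odot> part p t) \<^bold>+ (part 1 s \<odot> part (p + 1) t)"
  by (simp add: part_def cl_plus cl_tn del: add_bit_eq_xor)

lemma part_Cmp_bit:
  "part 0 (t \<bullet> s) = (part 0 s \<triangleright> part 0 t) \<^bold>+ (part 1 s \<triangleright> part 1 t)"
  "part 1 (t \<bullet> s) = (part 1 s \<triangleright> part 0 t) \<^bold>+ (part 0 s \<triangleright> part 1 t)"
  by (simp_all add: part_Cmp)

lemma part_Tns_bit:
  "part 0 (s \<boxtimes> t) = (part 0 s \<odot> part 0 t) \<^bold>+ (part 1 s \<odot> part 1 t)"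
  "part 1 (s \<boxtimes> t) = (part 0 s \<odot> part 1 t) \<^bold>+ (part 1 s \<odot> part 0 t)"
  by (simp_all add: part_Tns)

lemmas part_bit = part_Cmp_bit part_Tns_bit
lemmas distrib = seq_plus_left seq_plus_right tn_plus_left tn_plus_right

lemma cl_eq_parts: "typed R P t X Y \<Longrightarrow> cl t = part 0 t \<^bold>+ part 1 t"
proof (induction t X Y rule: typed.induct)
  case (1 g)
  have "hom (cl (Gen g)) (source P g) (target P g)" by (simp add: hom_cl)
  then show ?case unfolding part_def by (cases "parity P g") simp_all
next
  case (4 s X Y t)
  then show ?case by (simp add: plus_ac flip: cl_plus)
next
  case (5 a t X Y)
  then show ?case by (simp add: scal_plus flip: cl_scal)
next
  case (6 t Y Z s X)
  then show ?case by (simp add: distrib part_bit plus_ac flip: cl_seq)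
next
  case (7 s X Y t X' Y')
  then show ?case by (simp add: distrib part_bit plus_ac flip: cl_tn)
qed auto

text \<open>Parities of terms are not unique, since \<open>Zer\<close> has both. The equation is
  still consistent: a term with both parities has its projection equal to itself and to zero, hence
  is zero.\<close>

lemma part_homog:
  "has_parity P t q \<Longrightarrow> typed R P t X Y \<Longrightarrow> part p t = (if p = q then cl t else cl (Zer X Y))"
proof (induction t q arbitrary: X Y p rule: has_parity.induct)
  case (1 g)
  then show ?case by (auto simp: part_def)
next
  case (4 s p t)
  then show ?case by (auto simp flip: cl_plus)
next
  case (5 t p a)
  then show ?case by (auto simp flip: cl_scal)
next
  case (6 t q s r)
  then obtain Y' where ty: "typed R P t Y' Y" "typed R P s X Y'" by (auto simp: typed_Cmp_iff)
  then have "hom (cl t) Y' Y" "hom (cl s) X Y'" by (simp_all add: hom_cl)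
  moreover from this have "hom (cl s \<triangleright> cl t) X Y" by blast
  moreover have "part p t = (if p = q then cl t else cl (Zer Y' Y))"
    "part p s = (if p = r then cl s else cl (Zer X Y'))" for p
    using 6 ty by blast+
  ultimately show ?case
    by (cases q; cases r; cases p; simp add: part_bit seq_Zer_left[OF hom_intros(2)] flip: cl_seq)
next
  case (7 s q t r)
  then obtain X1 X2 Y1 Y2 where ty: "X = X1 @ X2" "Y = Y1 @ Y2" "typed R P s X1 Y1" "typed R P t X2 Y2"
    by (auto simp: typed_Tns_iff)
  then have "hom (cl s) X1 Y1" "hom (cl t) X2 Y2" by (simp_all add: hom_cl)
  moreover from this have "hom (cl s \<odot> cl t) X Y" using ty by simp
  moreover have "part p s = (if p = q then cl s else cl (Zer X1 Y1))"
    "part p t = (if p = r then cl t else cl (Zer X2 Y2))" for p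
    using 7 ty by blast+
  ultimately show ?case
    by (cases q; cases r; cases p; simp add: part_bit ty(1,2) tn_Zer_left[OF hom_intros(2)] flip: cl_tn)
qed auto

text \<open>Bilinearity handles the structural rules once the projection of a product is expanded.
  Only two rules mention parity: \<open>rel\<close>, where the relations are homogeneous by
  assumption, and the super interchange law.\<close>

lemma part_cong: "eqv R P s t \<Longrightarrow> part p s = part p t"
proof (induction arbitrary: p rule: eqv.induct)
  case (rel s t X Y)
  then obtain q where "has_parity P s q" "has_parity P t q"
    using relations_homogeneous by blast
  with rel show ?case using cl_eq[OF eqv.rel] by (simp add: part_homog)
next
  case (cong_cmp t t' s s' X Y) then show ?case by (simp add: part_Cmp)
next
  case (cong_tns t t' s s') then show ?case by (simp add: part_Tns)
next
  case (add_assoc s X Y t u) then show ?case by (simp add: plus_ac)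
next
  case (add_comm s X Y t) then show ?case by (simp add: plus_ac)
next
  case (add_zero t X Y) then show ?case by (simp add: hom_part)
next
  case (scl_zero t X Y) then show ?case by (simp add: hom_part)
next
  case (scl_one t X Y) then show ?case by (simp add: scal_one[OF hom_part])
next
  case (scl_mult a b t X Y) then show ?case unfolding part_simps by (rule scal_mult[OF _ _ hom_part])
next
  case (scl_add_left a b t X Y) then show ?case unfolding part_simps by (rule scal_add_left[OF _ _ hom_part])
next
  case (scl_add_right a s X Y t) then show ?case by (simp add: scal_plus)
next
  case (cmp_assoc u Z W t Y s X)
  show ?case by (cases p) (simp_all add: part_bit distrib seq_assoc plus_ac)
next
  case (cmp_idn_left t X Y) then show ?case
    by (cases p) (simp_all add: part_bit seq_idn[OF hom_part[OF cmp_idn_left]] seq_Zer_left[OF hom_part[OF cmp_idn_left]] seq_Zer_right[OF hom_part[OF cmp_idn_left]] plus_zero[OF hom_part[OF cmp_idn_left]])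
next
  case (cmp_idn_right t X Y) then show ?case
    by (cases p) (simp_all add: part_bit seq_idn[OF hom_part[OF cmp_idn_right]] seq_Zer_left[OF hom_part[OF cmp_idn_right]] seq_Zer_right[OF hom_part[OF cmp_idn_right]] plus_zero[OF hom_part[OF cmp_idn_right]])
next
  case (cmp_add_left t Y Z t' s X) then show ?case by (simp add: part_Cmp distrib plus_ac)
next
  case (cmp_add_right t Y Z s X s') then show ?case by (simp add: part_Cmp distrib plus_ac)
next
  case (cmp_scl_left a t Y Z s X) then show ?case by (simp add: part_Cmp seq_scal_right scal_plus)
next
  case (cmp_scl_right a t Y Z s X) then show ?case by (simp add: part_Cmp seq_scal_left scal_plus)
next
  case (tns_assoc s X Y t X' Y' u X'' Y'')
  show ?case by (cases p) (simp_all add: part_bit distrib tn_assoc plus_ac)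
next
  case (tns_unit_left t X Y) then show ?case
    by (cases p) (simp_all add: part_bit tn_unit[OF hom_part[OF tns_unit_left]] tn_Zer_left[OF hom_part[OF tns_unit_left]] tn_Zer_right[OF hom_part[OF tns_unit_left]] plus_zero[OF hom_part[OF tns_unit_left]])
next
  case (tns_unit_right t X Y) then show ?case
    by (cases p) (simp_all add: part_bit tn_unit[OF hom_part[OF tns_unit_right]] tn_Zer_left[OF hom_part[OF tns_unit_right]] tn_Zer_right[OF hom_part[OF tns_unit_right]] plus_zero[OF hom_part[OF tns_unit_right]])
next
  case (tns_idn X Y)
  then show ?case
    by (cases p) (simp_all add: part_bit tn_Zer_left[OF hom_intros(2)] tn_Zer_left[OF hom_intros(1)]
        tn_Zer_right[OF hom_intros(1)] plus_zero[OF hom_intros(1)])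
next
  case (tns_add_left s X Y s' t X' Y') then show ?case by (simp add: part_Tns distrib plus_ac)
next
  case (tns_add_right s X Y t X' Y' t') then show ?case by (simp add: part_Tns distrib plus_ac)
next
  case (tns_scl_left a s X Y t X' Y') then show ?case by (simp add: part_Tns tn_scal_left scal_plus)
next
  case (tns_scl_right a s X Y t X' Y') then show ?case by (simp add: part_Tns tn_scal_right scal_plus)
next
  \<comment> \<open>Only \<open>s\<close> and \<open>t\<close> are homogeneous. Each of their
    projections is the whole class or zero, so for every parity just two products of parts of
    \<open>s'\<close> and \<open>t'\<close> survive, and both carry the same sign, which depends on
    \<open>q\<close> and \<open>r\<close> alone.\<close>
  case (interchange s X Y s' Z t Y' Z' t' X' q r)
  have h: "hom (cl s) X Y" "hom (cl t) Y' Z'" "homog q (cl s) X Y" "homog r (cl t) Y' Z'"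
    using interchange by (simp_all add: hom_cl homog_cl)
  have h': "hom (part p s') Y Z" "hom (part p t') X' Y'" for p
    using interchange by (simp_all add: hom_part)
  have e: "part p s = (if p = q then cl s else cl (Zer X Y))"
    "part p t = (if p = r then cl t else cl (Zer Y' Z'))" for p
    using interchange part_homog by blast+
  have i: "(cl s \<odot> part a t') \<triangleright> (part b s' \<odot> cl t) = scal (super_sign R q r) ((cl s \<triangleright> part b s') \<odot> (part a t' \<triangleright> cl t))" for a b
    by (rule presentation_over.interchange[OF presentation_over_axioms]) (use h h' in auto)
  have hh: "hom (cl s \<triangleright> part b s') X Z" "hom (part a t' \<triangleright> cl t) X' Z'" for a b
    using h h' by blast+
  note z = tn_Zer_left[OF h'(2)] tn_Zer_right[OF h'(1)] tn_Zer_left[OF h(2)] tn_Zer_right[OF h(1)]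
     seq_Zer_left[OF h'(1)] seq_Zer_right[OF h'(2)] tn_Zer_left[OF hh(2)] tn_Zer_right[OF hh(1)]
  have zz: "seq (cl (Zer (X@X') (Y@Y'))) (part b s' \<odot> cl t) = cl (Zer (X@X') (Z@Z'))"
     "seq (cl s \<odot> part b t') (cl (Zer (Y@Y') (Z@Z'))) = cl (Zer (X@X') (Z@Z'))" for b
    using h h' by auto
  have hs: "hom (scal (super_sign R q r) ((cl s \<triangleright> part a s') \<odot> (part b t' \<triangleright> cl t))) (X @ X') (Z @ Z')" for a b
    using hh by auto
  have hs': "hom ((cl s \<triangleright> part a s') \<odot> (part b t' \<triangleright> cl t)) (X @ X') (Z @ Z')" for a b
    using hh by auto
  have hw: "hom (cl s \<odot> part a t') (X @ X') (Y @ Y')" "hom (part b s' \<odot> cl t) (Y @ Y') (Z @ Z')" for a b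
    using h h' by auto
  show ?case
    by (cases q; cases r; cases p; simp add: part_bit e z zz i plus_zero[OF hw(1)] plus_zero[OF hw(2)] scal_plus plus_zero[OF hs] plus_zero[OF hs'] plus_zero[OF hh(1)] plus_zero[OF hh(2)] plus_ac plus_zero[OF hom_intros(2)])
qed simp_all

section \<open>Presented categories are strict monoidal supercategories\<close>

lemma hom_iff_carrier: "f \<in> carrier (presented_hom R P X Y) \<longleftrightarrow> hom f X Y"
  by (auto simp: hom_def)

lemma homog_iff_Homog: "f \<in> Homog (presented_supercat R P) X Y p \<longleftrightarrow> homog p f X Y"
  by (auto simp: homog_def)

lemma superspace_presented:
  "superspace R (presented_hom R P X Y) (Homog (presented_supercat R P) X Y)"
proof -
  let ?V = "presented_hom R P X Y"
  \<comment> \<open>The term language has no negation; multiplication by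
    \<open>\<ominus> \<one>\<close> provides additive inverses.\<close>
  have neg: "scal (\<ominus> \<one>) f \<^bold>+ f = cl (Zer X Y)" if "hom f X Y" for f
    using scal_add_left[of "\<ominus> \<one>" \<one> f X Y] that by (simp add: l_neg)
  have grp: "abelian_group ?V"
  proof (rule abelian_groupI)
    fix f g h
    assume "f \<in> carrier ?V" "g \<in> carrier ?V"
    then show "f \<oplus>\<^bsub>?V\<^esub> g \<in> carrier ?V"
      unfolding hom_iff_carrier presented_hom_simps(1) by simp
  next
    fix f assume f: "f \<in> carrier ?V"
    then show "\<exists>g\<in>carrier ?V. g \<oplus>\<^bsub>?V\<^esub> f = \<zero>\<^bsub>?V\<^esub>"
      unfolding hom_iff_carrier by (intro bexI[of _ "scal (\<ominus> \<one>) f"]) (auto simp: neg hom_iff_carrier simp del: presented_hom_simps(4))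
    show "\<zero>\<^bsub>?V\<^esub> \<oplus>\<^bsub>?V\<^esub> f = f"
      using f unfolding hom_iff_carrier by simp
  qed (simp_all add: plus_ac hom_iff_carrier del: presented_hom_simps(4))
  have mod: "module R ?V"
    by (rule moduleI) (use grp is_cring in \<open>auto simp: hom_iff_carrier scal_add_left scal_plus scal_mult hom_is_cls simp del: presented_hom_simps(4)\<close>)
  interpret V: module R ?V by (rule mod)
  have inv: "\<ominus>\<^bsub>?V\<^esub> f = scal (\<ominus> \<one>) f" if "hom f X Y" for f
    by (rule abelian_group.minus_equality[OF grp], unfold presented_hom_simps(1,3) hom_iff_carrier,
        rule neg[OF that], rule that, rule hom_intros(4)[OF _ that], simp)
  have sub: "submodule (Homog (presented_supercat R P) X Y p) R ?V" for p
  proof (rule V.submoduleI)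
    show "Homog (presented_supercat R P) X Y p \<subseteq> carrier ?V"
      by auto
    fix f assume "f \<in> Homog (presented_supercat R P) X Y p"
    then have f: "homog p f X Y" unfolding homog_iff_Homog .
    show "\<ominus>\<^bsub>?V\<^esub> f \<in> Homog (presented_supercat R P) X Y p"
      unfolding inv[OF homog_imp_hom[OF f]] homog_iff_Homog by (rule homog_intros(4)[OF _ f]) simp
  qed (unfold homog_iff_Homog presented_hom_simps(1-3), (rule homog_intros; assumption?)+)
  have ex: "\<exists>!(a, b). a \<in> Homog (presented_supercat R P) X Y 0 \<and>
      b \<in> Homog (presented_supercat R P) X Y 1 \<and> f = a \<oplus>\<^bsub>?V\<^esub> b"
    if "f \<in> carrier ?V" for f
  proof -
    obtain t where t: "typed R P t X Y" "f = cl t"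
      using \<open>f \<in> carrier ?V\<close> by auto
    show ?thesis
    proof (rule ex1I[of _ "(part 0 t, part 1 t)"])
      show "case (part 0 t, part 1 t) of (a, b) \<Rightarrow> a \<in> Homog (presented_supercat R P) X Y 0 \<and>
          b \<in> Homog (presented_supercat R P) X Y 1 \<and> f = a \<oplus>\<^bsub>?V\<^esub> b"
        unfolding homog_iff_Homog presented_hom_simps(1) prod.case t(2)
        using homog_part[OF t(1)] cl_eq_parts[OF t(1)] by blast
      fix ab assume "case ab of (a, b) \<Rightarrow> a \<in> Homog (presented_supercat R P) X Y 0 \<and>
          b \<in> Homog (presented_supercat R P) X Y 1 \<and> f = a \<oplus>\<^bsub>?V\<^esub> b"
      then obtain r s where rs: "ab = (cl r, cl s)" "typed R P r X Y" "typed R P s X Y" "has_parity P r 0"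
          "has_parity P s 1" "cl t = cl (Add r s)"
        unfolding homog_iff_Homog homog_def presented_hom_simps(1) t(2)
        by (cases ab) (auto simp only: prod.case cl_plus)
      \<comment> \<open>Projections recover the summands of any decomposition into an even and an
        odd morphism, which gives uniqueness.\<close>
      have "part p t = part p r \<^bold>+ part p s" for p
        unfolding part_simps(3)[symmetric]
        by (rule part_cong[OF cl_eqD[OF _ rs(6)]]) (rule typed.intros(4)[OF rs(2,3)])
      moreover have "part 0 r = cl r" "part 1 s = cl s" "part 1 r = cl (Zer X Y)" "part 0 s = cl (Zer X Y)"
        using part_homog[OF rs(4,2)] part_homog[OF rs(5,3)] by simp_all
      moreover have "hom (cl r) X Y" "hom (cl s) X Y" using rs by (simp_all add: hom_cl)
      ultimately show "ab = (part 0 t, part 1 t)"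
        using rs(1) by simp
    qed
  qed
  show ?thesis
    by (rule superspace.intro[OF mod]) (rule superspace_axioms.intro[OF sub ex])
qed

lemma supercategory_presented: "supercategory R (presented_supercat R P)"
  apply (rule supercategory.intro[OF is_cring], rule supercategory_axioms.intro)
  unfolding presented_supercat_simps(1,2,4) hom_iff_carrier homog_iff_Homog presented_hom_simps(1,2)
  subgoal by (rule superspace_presented)
  subgoal by (blast dest: hom_unique)
  subgoal by (rule homog_intros(1))
  subgoal by (rule hom_seq)
  subgoal by (rule homog_seq)
  subgoal by (rule seq_plus_right; erule hom_is_cls)
  subgoal by (rule seq_plus_left; erule hom_is_cls)
  subgoal by (rule seq_scal_right; erule hom_is_cls)
  subgoal by (rule seq_scal_left; erule hom_is_cls)
  subgoal by (rule seq_assoc[symmetric])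
  subgoal by (rule seq_idn(2))
  subgoal by (rule seq_idn(1))
  done

lemma strict_monoidal_supercategory_presented:
  "strict_monoidal_supercategory R (presented_supercat R P)"
  apply (rule strict_monoidal_supercategory.intro[OF supercategory_presented],
      rule strict_monoidal_supercategory_axioms.intro)
  unfolding presented_supercat_simps(1,2,4-6) hom_iff_carrier homog_iff_Homog presented_hom_simps(1,2)
  subgoal by simp
  subgoal by simp
  subgoal by simp
  subgoal by simp
  subgoal by simp
  subgoal by (rule hom_intros(5))
  subgoal by (rule homog_tn)
  subgoal by (rule tn_plus_left; erule hom_is_cls)
  subgoal by (rule tn_plus_right; erule hom_is_cls)
  subgoal by (rule tn_scal_left; erule hom_is_cls)
  subgoal by (rule tn_scal_right; erule hom_is_cls)
  subgoal by (rule tn_assoc)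
  subgoal by (rule tn_unit(1))
  subgoal by (rule tn_unit(2))
  subgoal by (rule tn_idn)
  subgoal by (rule interchange)
  done

end

section \<open>Functors between presented supercategories\<close>

text \<open>Every morphism is the class of a term built from generators by operations that each
  superfunctor preserves, so induction on the term suffices.\<close>

lemma (in presentation_over) functors_agreeI:
  fixes D :: "('p, 'n, 'k, 'z) mon_supercat_scheme"
  assumes F: "monoidal_superfunctor R (presented_supercat R P) D Fo Fm"
    and G: "monoidal_superfunctor R (presented_supercat R P) D Go Gm"
    and ob: "\<And>a. Fo [a] = Go [a]" and gen: "\<And>g. Fm (cl (Gen g)) = Gm (cl (Gen g))"
  shows "functors_agree (presented_supercat R P) Fo Fm Go Gm"
proof -
  interpret F: monoidal_superfunctor R "presented_supercat R P" D Fo Fm by (rule F)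
  interpret G: monoidal_superfunctor R "presented_supercat R P" D Go Gm by (rule G)
  note S = presented_supercat_simps(1,2) hom_iff_carrier presented_hom_simps(1,2)
  have Fo: "Fo X = Go X" for X
  proof (induction X)
    case Nil
    then show ?case using F.map_unit_ob G.map_unit_ob by simp
  next
    case (Cons a X)
    then show ?case using F.map_tens_ob[of "[a]" X] G.map_tens_ob[of "[a]" X] ob by simp
  qed
  have "Fm (cl t) = Gm (cl t)" if "typed R P t X Y" for t X Y
    using that
  proof (induction t X Y rule: typed.induct)
    case (1 g) show ?case by (rule gen)
  next
    case (2 X)
    then show ?case using F.map_ident[of X] G.map_ident[of X] Fo by simp
  next
    case (3 X Y)
    \<comment> \<open>Preservation of zero is not an axiom of superfunctors; it follows from
      linearity, since zero is \<open>\<zero>\<close> times itself.\<close>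
    have z: "Hm (cl (Zer X Y)) = \<zero>\<^bsub>Hom D (Ho X) (Ho Y)\<^esub>"
      if "monoidal_superfunctor R (presented_supercat R P) D Ho Hm" for Ho Hm
    proof -
      interpret H: monoidal_superfunctor R "presented_supercat R P" D Ho Hm by (rule that)
      interpret M: superspace R "Hom D (Ho X) (Ho Y)" "Homog D (Ho X) (Ho Y)"
        using F.cod.hom_superspace H.ob_closed by simp
      have "Hm (cl (Zer X Y)) = Hm (scal \<zero> (cl (Zer X Y)))"
        by simp
      also have "\<dots> = \<zero> \<odot>\<^bsub>Hom D (Ho X) (Ho Y)\<^esub> Hm (cl (Zer X Y))"
        by (rule H.hom_smult[unfolded S, OF UNIV_I UNIV_I zero_closed hom_intros(2)])
      also have "\<dots> = \<zero>\<^bsub>Hom D (Ho X) (Ho Y)\<^esub>"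
        by (rule M.smult_l_null[OF H.hom_closed[unfolded S, OF UNIV_I UNIV_I hom_intros(2)]])
      finally show ?thesis .
    qed
    show ?case unfolding z[OF F] z[OF G] Fo ..
  next
    case (4 s X Y t)
    then show ?case using F.hom_add[unfolded S, OF UNIV_I UNIV_I hom_cl hom_cl]
      G.hom_add[unfolded S, OF UNIV_I UNIV_I hom_cl hom_cl] Fo by (metis cl_plus)
  next
    case (5 a t X Y)
    then show ?case using F.hom_smult[unfolded S, OF UNIV_I UNIV_I _ hom_cl]
      G.hom_smult[unfolded S, OF UNIV_I UNIV_I _ hom_cl] Fo by (metis cl_scal)
  next
    case (6 t Y Z s X)
    then show ?case using F.map_cmp[unfolded S, OF UNIV_I UNIV_I UNIV_I hom_cl hom_cl]
      G.map_cmp[unfolded S, OF UNIV_I UNIV_I UNIV_I hom_cl hom_cl] by (metis cl_seq)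
  next
    case (7 s X Y t X' Y')
    then show ?case using F.map_tens[unfolded S, OF UNIV_I UNIV_I UNIV_I UNIV_I hom_cl hom_cl]
      G.map_tens[unfolded S, OF UNIV_I UNIV_I UNIV_I UNIV_I hom_cl hom_cl] by (metis cl_tn)
  qed
  then show ?thesis
    unfolding functors_agree_def by (auto simp: Fo)
qed

primrec subst_gen :: "('g \<Rightarrow> ('a, 'h, 'k) tm) \<Rightarrow> ('a, 'g, 'k) tm \<Rightarrow> ('a, 'h, 'k) tm" where
  "subst_gen \<gamma> (Gen g) = \<gamma> g"
| "subst_gen \<gamma> (Idn X) = Idn X"
| "subst_gen \<gamma> (Zer X Y) = Zer X Y"
| "subst_gen \<gamma> (Add s t) = Add (subst_gen \<gamma> s) (subst_gen \<gamma> t)"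
| "subst_gen \<gamma> (Scl a t) = Scl a (subst_gen \<gamma> t)"
| "subst_gen \<gamma> (t \<bullet> s) = subst_gen \<gamma> t \<bullet> subst_gen \<gamma> s"
| "subst_gen \<gamma> (s \<boxtimes> t) = subst_gen \<gamma> s \<boxtimes> subst_gen \<gamma> t"

text \<open>The data of the universal property of a presentation, for functors that are the identity
  on objects: images of the generators with the right type and parity that satisfy the relations.
  The relations are only required at the level of classes, where they can be verified by diagram
  calculus.\<close>

locale presentation_morphism =
  dom: presentation_over R P + cod: presentation_over R Q
  for R :: "('k, 'x) ring_scheme" (structure) and P :: "('a, 'g, 'k) presentation"
    and Q :: "('a, 'h, 'k) presentation" +
  fixes \<gamma> :: "'g \<Rightarrow> ('a, 'h, 'k) tm"
  assumes image_typed: "typed R Q (\<gamma> g) (source P g) (target P g)"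
    and image_parity: "has_parity Q (\<gamma> g) (parity P g)"
    and image_relation: "(s, t) \<in> relations P \<Longrightarrow> cls R Q (subst_gen \<gamma> s) = cls R Q (subst_gen \<gamma> t)"
begin

lemma typed_subst_gen: "typed R P t X Y \<Longrightarrow> typed R Q (subst_gen \<gamma> t) X Y"
  by (induction t X Y rule: typed.induct) (auto intro: typed.intros image_typed)

lemma parity_subst_gen: "has_parity P t p \<Longrightarrow> has_parity Q (subst_gen \<gamma> t) p"
  by (induction t p rule: has_parity.induct)
    (auto intro: has_parity.intros image_parity simp del: add_bit_eq_xor)

text \<open>Substitution commutes with all term constructors, so each structural rule is carried to
  an instance of itself. Only \<open>rel\<close> uses the assumption on the images of
  relations.\<close>

lemma eqv_subst_gen: "eqv R P s t \<Longrightarrow> eqv R Q (subst_gen \<gamma> s) (subst_gen \<gamma> t)"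
proof (induction rule: eqv.induct)
  case (rel s t X Y)
  show ?case by (rule cod.cl_eqD[OF typed_subst_gen[OF rel(3)] image_relation[OF rel(1)]])
next
  case refl then show ?case by (metis eqv.refl typed_subst_gen)
next
  case sym then show ?case by (metis eqv.sym)
next
  case trans then show ?case by (metis eqv.trans)
next
  case (cong_add s s' t t' X Y)
  show ?case using eqv.cong_add[OF cong_add(4,5)] typed_subst_gen[OF cong_add(3)] by simp
next
  case (cong_cmp s s' t t' X Y)
  show ?case using eqv.cong_cmp[OF cong_cmp(4,5)] typed_subst_gen[OF cong_cmp(3)] by simp
next
  case (interchange s X Y s' Z t Y' Z' t' X' p q)
  show ?case unfolding subst_gen.simps
    by (rule eqv.interchange[OF interchange(1-4)[THEN typed_subst_gen] interchange(5,6)[THEN parity_subst_gen]])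
qed (unfold subst_gen.simps,
    (rule eqv.cong_scl eqv.cong_tns eqv.add_assoc eqv.add_comm eqv.add_zero eqv.scl_zero eqv.scl_one eqv.scl_mult eqv.scl_add_left eqv.scl_add_right eqv.cmp_assoc eqv.cmp_idn_left eqv.cmp_idn_right eqv.cmp_add_left eqv.cmp_add_right eqv.cmp_scl_left eqv.cmp_scl_right eqv.tns_assoc eqv.tns_unit_left eqv.tns_unit_right eqv.tns_idn eqv.tns_add_left eqv.tns_add_right eqv.tns_scl_left eqv.tns_scl_right;
      (assumption | erule typed_subst_gen))+)

definition induced :: "('a, 'g, 'k) tm set \<Rightarrow> ('a, 'h, 'k) tm set"
  where "induced A = (\<Union>t \<in> A. cls R Q (subst_gen \<gamma> t))"

lemma induced_cls:
  assumes "typed R P t X Y"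
  shows "induced (cls R P t) = cls R Q (subst_gen \<gamma> t)"
proof -
  have "cls R Q (subst_gen \<gamma> s) = cls R Q (subst_gen \<gamma> t)" if "s \<in> cls R P t" for s
    using that cod.cl_eq[OF eqv_subst_gen] by (simp add: dom.mem_cl)
  then show ?thesis
    unfolding induced_def using dom.mem_cl_self[OF assms] by blast
qed

lemma monoidal_superfunctor_induced:
  "monoidal_superfunctor R (presented_supercat R P) (presented_supercat R Q) id induced"
proof -
  have I: "cod.hom (induced (cls R P t)) X Y" if "typed R P t X Y" for t X Y
    using that by (simp add: induced_cls cod.hom_cl typed_subst_gen)
  show ?thesis
    apply (rule monoidal_superfunctor.intro[OF dom.strict_monoidal_supercategory_presented
        cod.strict_monoidal_supercategory_presented], rule monoidal_superfunctor_axioms.intro)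
    unfolding dom.presented_supercat_simps(1,2,4-6) cod.presented_supercat_simps(1,2,4-6)
      dom.hom_iff_carrier cod.hom_iff_carrier
      dom.homog_iff_Homog cod.homog_iff_Homog dom.presented_hom_simps(1,2) cod.presented_hom_simps(1,2) id_apply
    subgoal by simp
    subgoal by (auto simp: dom.hom_def I)
    subgoal by (auto simp: dom.homog_def induced_cls intro!: cod.homog_cl typed_subst_gen parity_subst_gen)
    subgoal by (auto simp: dom.hom_def dom.cl_plus cod.cl_plus induced_cls induced_cls[OF typed.intros(4)])
    subgoal by (auto simp: dom.hom_def dom.cl_scal cod.cl_scal induced_cls induced_cls[OF typed.intros(5)])
    subgoal by (simp add: induced_cls[OF typed.intros(2)])
    subgoal by (auto simp: dom.hom_def dom.cl_seq cod.cl_seq induced_cls induced_cls[OF typed.intros(6)])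
    subgoal by simp
    subgoal by simp
    subgoal by (auto simp: dom.hom_def dom.cl_tn cod.cl_tn induced_cls induced_cls[OF typed.intros(7)])
    done
qed

end

text \<open>Induction on terms needs no typing here, because the laws that compute classes of sums,
  multiples, composites and tensor products are unconditional.\<close>

lemma (in presentation_over) cls_subst_gen_inverse:
  assumes "\<And>g. cl (subst_gen \<delta> (\<gamma> g)) = cl (Gen g)"
  shows "cl (subst_gen \<delta> (subst_gen \<gamma> t)) = cl t"
  by (induction t) (simp_all add: assms flip: cl_plus cl_scal cl_seq cl_tn)

text \<open>A computable substitute for the relation \<open>has_parity\<close>, so that parities of
  concrete diagrams can be found by simplification. For \<open>Zer\<close>, which has both parities,
  the value 0 is an arbitrary choice.\<close>

fun parity_of :: "('a, 'g, 'k) presentation \<Rightarrow> ('a, 'g, 'k) tm \<Rightarrow> bit" where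
  "parity_of P (Gen g) = parity P g"
| "parity_of P (Idn X) = 0"
| "parity_of P (Zer X Y) = 0"
| "parity_of P (Add s t) = parity_of P s"
| "parity_of P (Scl a t) = parity_of P t"
| "parity_of P (t \<bullet> s) = parity_of P t + parity_of P s"
| "parity_of P (s \<boxtimes> t) = parity_of P s + parity_of P t"

fun homogeneous :: "('a, 'g, 'k) presentation \<Rightarrow> ('a, 'g, 'k) tm \<Rightarrow> bool" where
  "homogeneous P (Add s t) \<longleftrightarrow> homogeneous P s \<and> homogeneous P t \<and> parity_of P s = parity_of P t"
| "homogeneous P (Scl a t) \<longleftrightarrow> homogeneous P t"
| "homogeneous P (t \<bullet> s) \<longleftrightarrow> homogeneous P t \<and> homogeneous P s"
| "homogeneous P (s \<boxtimes> t) \<longleftrightarrow> homogeneous P s \<and> homogeneous P t"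
| "homogeneous P _ \<longleftrightarrow> True"

lemma has_parity_parity_of: "homogeneous P t \<Longrightarrow> has_parity P t (parity_of P t)"
proof (induction t)
  case (Add s t)
  then show ?case by (metis has_parity.intros(4) homogeneous.simps(1) parity_of.simps(4))
qed (auto intro: has_parity.intros simp del: add_bit_eq_xor)

section \<open>Whiskering and the interchange of layers\<close>

context presentation_over
begin

text \<open>One layer of a string diagram: \<open>f\<close> with vertical strands \<open>A\<close>
  to its left and \<open>B\<close> to its right. Diagrams are kept as composites of such layers,
  which makes isotopy a matter of commuting adjacent layers.\<close>

definition whisker :: "'a list \<Rightarrow> ('a, 'g, 'k) tm set \<Rightarrow> 'a list \<Rightarrow> ('a, 'g, 'k) tm set"
  where "whisker A f B = cl (Idn A) \<odot> f \<odot> cl (Idn B)"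

lemma is_cls_whisker [simp]: "is_cls f \<Longrightarrow> is_cls (whisker A f B)"
  by (simp add: whisker_def)

lemma hom_whisker: "hom f X Y \<Longrightarrow> hom (whisker A f B) (A @ X @ B) (A @ Y @ B)"
  by (simp add: whisker_def)

lemma homog_whisker: "homog p f X Y \<Longrightarrow> homog p (whisker A f B) (A @ X @ B) (A @ Y @ B)"
  using homog_tn[OF homog_intros(1)[of A] homog_tn[OF _ homog_intros(1)[of B]]]
  by (simp add: whisker_def del: add_bit_eq_xor)

lemma whisker_Idn [simp]: "whisker A (cl (Idn X)) B = cl (Idn (A @ X @ B))"
  by (simp add: whisker_def)

lemma whisker_plus: "is_cls f \<Longrightarrow> is_cls g \<Longrightarrow> whisker A (f \<^bold>+ g) B = whisker A f B \<^bold>+ whisker A g B"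
  by (simp add: whisker_def distrib)

lemma whisker_scal: "is_cls f \<Longrightarrow> whisker A (scal a f) B = scal a (whisker A f B)"
  by (simp add: whisker_def tn_scal_left tn_scal_right)

lemma whisker_whisker [simp]: "whisker A (whisker C f D) B = whisker (A @ C) f (D @ B)"
proof -
  have "whisker A (whisker C f D) B = (cl (Idn A) \<odot> cl (Idn C)) \<odot> f \<odot> (cl (Idn D) \<odot> cl (Idn B))"
    unfolding whisker_def tn_assoc ..
  then show ?thesis by (simp add: whisker_def)
qed

lemma whisker_Nil: "hom f X Y \<Longrightarrow> whisker [] f [] = f"
  by (simp add: whisker_def)

text \<open>The super interchange law speaks of homogeneous morphisms only. One factor is therefore
  split into its even and odd parts; no sign arises because the other morphism in question is an
  identity, which is even.\<close>

lemma tn_seq_Idn: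
  assumes "hom f X Y" "hom g Y Z"
  shows "cl (Idn A) \<odot> (f \<triangleright> g) = (cl (Idn A) \<odot> f) \<triangleright> (cl (Idn A) \<odot> g)"
    and "(f \<triangleright> g) \<odot> cl (Idn A) = (f \<odot> cl (Idn A)) \<triangleright> (g \<odot> cl (Idn A))"
proof -
  have one: "super_sign R 0 q = \<one>" "super_sign R q 0 = \<one>" for q
    by (simp_all add: super_sign_def)
  have fg: "hom (f \<triangleright> g) X Z" using assms by blast
  show "(f \<triangleright> g) \<odot> cl (Idn A) = (f \<odot> cl (Idn A)) \<triangleright> (g \<odot> cl (Idn A))"
  proof -
    obtain s where s: "typed R P s X Y" "f = cl s" using assms hom_def by blast
    have "(h \<odot> cl (Idn A)) \<triangleright> (g \<odot> cl (Idn A)) = (h \<triangleright> g) \<odot> cl (Idn A)" if "homog p h X Y" for h p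
      using interchange[OF that assms(2) homog_intros(1)[of A] hom_intros(1)]
        scal_one[OF hom_intros(5)[OF hom_seq[OF homog_imp_hom[OF that] assms(2)] hom_intros(1)]]
      by (simp add: one seq_idn(1)[OF hom_intros(1)])
    from this[OF homog_part[OF s(1)]] show ?thesis
      using assms(2) by (simp add: s(2) cl_eq_parts[OF s(1)] distrib hom_is_cls)
  qed
  show "cl (Idn A) \<odot> (f \<triangleright> g) = (cl (Idn A) \<odot> f) \<triangleright> (cl (Idn A) \<odot> g)"
  proof -
    obtain s where s: "typed R P s Y Z" "g = cl s" using assms hom_def by blast
    have "(cl (Idn A) \<odot> f) \<triangleright> (cl (Idn A) \<odot> h) = cl (Idn A) \<odot> (f \<triangleright> h)" if "homog p h Y Z" for h p
      using interchange[OF homog_intros(1)[of A] hom_intros(1) that assms(1)]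
        scal_one[OF hom_intros(5)[OF hom_intros(1) hom_seq[OF assms(1) homog_imp_hom[OF that]]]]
      by (simp add: one seq_idn(1)[OF hom_intros(1)])
    from this[OF homog_part[OF s(1)]] show ?thesis
      using assms(1) by (simp add: s(2) cl_eq_parts[OF s(1)] distrib hom_is_cls)
  qed
qed

text \<open>For composable classes this is \<open>tn_seq_Idn\<close> applied on both sides.
  Otherwise both sides are empty, so that rewriting needs no intermediate object.\<close>

lemma whisker_seq:
  assumes "is_cls f" "is_cls g"
  shows "whisker A (f \<triangleright> g) B = whisker A f B \<triangleright> whisker A g B"
proof -
  obtain s t where st: "f = cl s" "g = cl t" using assms by (auto simp: is_cls_def)
  show ?thesis
  proof (cases "\<exists>X Z. typed R P (t \<bullet> s) X Z")
    case True
    then obtain X Y Z where fg: "hom f X Y" "hom g Y Z"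
      unfolding st by (metis typed_Cmp_iff hom_cl)
    then have "hom (f \<odot> cl (Idn B)) (X @ B) (Y @ B)" "hom (g \<odot> cl (Idn B)) (Y @ B) (Z @ B)"
      by simp_all
    then show ?thesis unfolding whisker_def tn_seq_Idn(2)[OF fg] by (rule tn_seq_Idn(1))
  next
    case False
    have *: "typed R P (Idn A \<boxtimes> (r \<boxtimes> Idn B)) X Y \<longleftrightarrow> (\<exists>X' Y'. X = A @ X' @ B \<and> Y = A @ Y' @ B \<and> typed R P r X' Y')" for r X Y
      by (auto simp: typed_Tns_iff)
    have "\<not> typed R P (Idn A \<boxtimes> ((t \<bullet> s) \<boxtimes> Idn B)) X Y"
      "\<not> typed R P ((Idn A \<boxtimes> (t \<boxtimes> Idn B)) \<bullet> (Idn A \<boxtimes> (s \<boxtimes> Idn B))) X Y" for X Y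
      using False unfolding typed_Cmp_iff * by auto
    then show ?thesis
      unfolding st whisker_def cl_seq cl_tn using cl_empty by metis
  qed
qed

text \<open>Absorbing the surrounding strands into \<open>F\<close> and \<open>G\<close> makes both
  composites equal to the tensor product of \<open>F\<close> and \<open>G\<close> by the interchange
  law. The sign is trivial because both morphisms are even, as all generators other than the tokens
  are.\<close>

lemma whisker_interchange:
  assumes "homog 0 f X Y" "homog 0 g X' Y'"
  shows "whisker A f (B @ X' @ C) \<triangleright> whisker (A @ Y @ B) g C = whisker (A @ X @ B) g C \<triangleright> whisker A f (B @ Y' @ C)"
proof -
  define F where "F = whisker A f B"
  define G where "G = whisker [] g C"
  have F: "homog 0 F (A @ X @ B) (A @ Y @ B)" and G: "homog 0 G (X' @ C) (Y' @ C)"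
    unfolding F_def G_def using homog_whisker[OF assms(1)] homog_whisker[OF assms(2), of "[]"] by simp_all
  have w: "whisker A f (B @ E) = F \<odot> cl (Idn E)" for E
    by (simp add: F_def whisker_def tn_assoc)
  have w': "whisker (E @ D) g C = cl (Idn (E @ D)) \<odot> G" for E D
    using whisker_whisker[of "E @ D" "[]" g C "[]"] unfolding G_def whisker_def
    by (simp add: tn_assoc)
  have "(F \<odot> cl (Idn (X' @ C))) \<triangleright> (cl (Idn (A @ Y @ B)) \<odot> G) = scal (super_sign R 0 0) ((F \<triangleright> cl (Idn (A @ Y @ B))) \<odot> (cl (Idn (X' @ C)) \<triangleright> G))"
    by (rule interchange[OF F hom_intros(1) G hom_intros(1)])
  moreover have "(cl (Idn (A @ X @ B)) \<odot> G) \<triangleright> (F \<odot> cl (Idn (Y' @ C))) = scal (super_sign R 0 0) ((cl (Idn (A @ X @ B)) \<triangleright> F) \<odot> (G \<triangleright> cl (Idn (Y' @ C))))"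
    by (rule interchange[OF homog_intros(1) homog_imp_hom[OF F] homog_intros(1) homog_imp_hom[OF G]])
  ultimately show ?thesis
    unfolding w w' w'[of "A @ Y", simplified] w'[of "A @ X", simplified]
    by (simp only: seq_idn[OF homog_imp_hom[OF F]] seq_idn[OF homog_imp_hom[OF G]])
qed

lemma tn_Idn_eq_whisker:
  assumes "hom f X Y"
  shows "f \<odot> cl (Idn B) = whisker [] f B" "cl (Idn A) \<odot> f = whisker A f []"
  unfolding whisker_def tn_unit(2)[OF assms] tn_unit(1)[OF hom_intros(5)[OF assms hom_intros(1)]]
  by (rule HOL.refl)+

lemma cl_eq_relation:
  "(s, t) \<in> relations P \<Longrightarrow> hom (cl s) X Y \<Longrightarrow> hom (cl t) X Y \<Longrightarrow> cl s = cl t"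
  unfolding hom_cl_iff by (rule cl_eq, rule eqv.rel)

text \<open>In a composite nested to the right, two adjacent layers do not form a subterm unless
  they come last. Appending a tail \<open>k\<close> turns an equation for two layers into a rewrite
  rule for every position.\<close>

lemma seq_cong: "f \<triangleright> g = h \<Longrightarrow> f \<triangleright> g \<triangleright> k = h \<triangleright> k"
  by (simp flip: seq_assoc)

end

section \<open>Rotation and the right zigzag relation\<close>

lemma AQ_relations_homogeneous:
  assumes "(s, t) \<in> relations (AQ_presentation R z)"
  shows "\<exists>p. has_parity (AQ_presentation R z) s p \<and> has_parity (AQ_presentation R z) t p"
proof -
  let ?P = "AQ_presentation R z"
  \<comment> \<open>The exceptional disjunct is for the bubbles with a token: they are odd, whereas
    \<open>parity_of\<close> assigns 0 to the zero morphism on the other side.\<close>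
  have "homogeneous ?P s \<and> homogeneous ?P t \<and> (parity_of ?P s = parity_of ?P t \<or> t = Zer [] [])"
    using assms
    by (auto simp: AQ_presentation_def isomeric_relations_def affine_relations_def Let_def
        gen_parity_def cross_l_def rot_def capR_def cupR_def)
  then show ?thesis
    using has_parity_parity_of has_parity.intros(3) by metis
qed

locale affine_isomeric = cring R for R :: "('k, 'x) ring_scheme" (structure) +
  fixes z :: 'k
  assumes z_closed [simp]: "z \<in> carrier R"

sublocale affine_isomeric \<subseteq> presentation_over R "AQ_presentation R z"
  by unfold_locales (rule AQ_relations_homogeneous)

context affine_isomeric
begin

definition u_cross :: "sign \<Rightarrow> 'k iterm set" where "u_cross e = cl (cross_u e)"
definition rneg :: "'k iterm set" where "rneg = cl (Gen Gen_r_minus)"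
definition cap :: "'k iterm set" where "cap = cl capL"
definition cup :: "'k iterm set" where "cup = cl cupL"

lemma homog_gen: "homog (gen_parity g) (cl (Gen g)) (gen_source g) (gen_target g)"
proof -
  have "typed R (AQ_presentation R z) (Gen g) (gen_source g) (gen_target g)"
    by (simp add: AQ_presentation_def)
  moreover have "has_parity (AQ_presentation R z) (Gen g) (gen_parity g)"
    using has_parity.intros(1)[of "AQ_presentation R z" g] by (simp add: AQ_presentation_def)
  ultimately show ?thesis by (rule homog_cl)
qed

lemma even_generators:
  "homog 0 (u_cross e) [\<up>, \<up>] [\<up>, \<up>]"
  "homog 0 rneg [\<up>, \<down>] [\<down>, \<up>]"
  "homog 0 cap [\<down>, \<up>] []"
  "homog 0 cup [] [\<up>, \<down>]"
  using homog_gen[of Gen_u_plus] homog_gen[of Gen_u_minus] homog_gen[of Gen_r_minus]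
    homog_gen[of Gen_capL] homog_gen[of Gen_cupL]
  by (cases e; simp add: u_cross_def rneg_def cap_def cup_def gen_parity_def)+

lemma homog_seq0: "homog 0 f X Y \<Longrightarrow> homog 0 g Y Z \<Longrightarrow> homog 0 (f \<triangleright> g) X Z"
  using homog_seq[of 0 f X Y 0 g Z] by simp

text \<open>
  \<open>rho A B f\<close> is the rotation of \<open>f : A \<otimes> \<up> \<rightarrow> \<up> \<otimes> B\<close> to a morphism \<open>\<down> \<otimes> A \<rightarrow> B \<otimes> \<down>\<close>. Composites are
  written in diagrammatic order: \<open>f \<triangleright> g\<close> is \<open>g \<circ> f\<close>.
\<close>

definition rho :: "orient list \<Rightarrow> orient list \<Rightarrow> 'k iterm set \<Rightarrow> 'k iterm set"
  where "rho A B f = whisker (\<down> # A) cup [] \<triangleright> whisker [\<down>] f [\<down>] \<triangleright> whisker [] cap (B @ [\<down>])"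

lemma homog_rho:
  assumes "homog 0 f (A @ [\<up>]) (\<up> # B)"
  shows "homog 0 (rho A B f) (\<down> # A) (B @ [\<down>])"
  unfolding rho_def
  using homog_whisker[OF even_generators(4), of "\<down> # A" "[]"] homog_whisker[OF assms, of "[\<down>]" "[\<down>]"]
    homog_whisker[OF even_generators(3), of "[]" "B @ [\<down>]"]
  by (intro homog_seq0) simp_all

lemma is_cls_homog: "homog p f X Y \<Longrightarrow> is_cls f"
  by (rule hom_is_cls[OF homog_imp_hom])

lemmas is_cls_generators [simp] = even_generators[THEN is_cls_homog]

lemma whisker_rho:
  assumes "is_cls f"
  shows "whisker E (rho A B f) F
    = whisker (E @ \<down> # A) cup F \<triangleright> whisker (E @ [\<down>]) f (\<down> # F) \<triangleright> whisker E cap (B @ \<down> # F)"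
  unfolding rho_def using assms by (simp add: whisker_seq)

lemma rel_imp_eq:
  "(s, t) \<in> isomeric_relations R z \<union> affine_relations R \<Longrightarrow> hom (cl s) X Y \<Longrightarrow> hom (cl t) X Y \<Longrightarrow> cl s = cl t"
  by (rule cl_eq_relation) (simp add: AQ_presentation_def)

lemma zigzag_up: "whisker [] cup [\<up>] \<triangleright> whisker [\<up>] cap [] = cl (Idn [\<up>])"
proof -
  have *: "whisker [] cup [\<up>] \<triangleright> whisker [\<up>] cap [] = cl ((Idn [\<up>] \<boxtimes> capL) \<bullet> (cupL \<boxtimes> Idn [\<up>]))"
    unfolding cl_seq[symmetric] cl_tn[symmetric] cap_def[symmetric] cup_def[symmetric]
    by (simp add: tn_Idn_eq_whisker[OF homog_imp_hom[OF even_generators(3)]] tn_Idn_eq_whisker[OF homog_imp_hom[OF even_generators(4)]])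
  have "hom (whisker [] cup [\<up>] \<triangleright> whisker [\<up>] cap []) [\<up>] [\<up>]"
    using hom_whisker[OF homog_imp_hom[OF even_generators(4)], of "[]" "[\<up>]"]
      hom_whisker[OF homog_imp_hom[OF even_generators(3)], of "[\<up>]" "[]"] by (auto intro: hom_seq)
  note h = this[unfolded *]
  show ?thesis
    unfolding * by (rule rel_imp_eq[OF _ h hom_intros(1)]) (simp add: isomeric_relations_def Let_def)
qed

lemma zigzag_down: "whisker [\<down>] cup [] \<triangleright> whisker [] cap [\<down>] = cl (Idn [\<down>])"
proof -
  have *: "whisker [\<down>] cup [] \<triangleright> whisker [] cap [\<down>] = cl ((capL \<boxtimes> Idn [\<down>]) \<bullet> (Idn [\<down>] \<boxtimes> cupL))"
    unfolding cl_seq[symmetric] cl_tn[symmetric] cap_def[symmetric] cup_def[symmetric]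
    by (simp add: tn_Idn_eq_whisker[OF homog_imp_hom[OF even_generators(3)]] tn_Idn_eq_whisker[OF homog_imp_hom[OF even_generators(4)]])
  have "hom (whisker [\<down>] cup [] \<triangleright> whisker [] cap [\<down>]) [\<down>] [\<down>]"
    using hom_whisker[OF homog_imp_hom[OF even_generators(4)], of "[\<down>]" "[]"]
      hom_whisker[OF homog_imp_hom[OF even_generators(3)], of "[]" "[\<down>]"] by (auto intro: hom_seq)
  note h = this[unfolded *]
  show ?thesis
    unfolding * by (rule rel_imp_eq[OF _ h hom_intros(1)]) (simp add: isomeric_relations_def Let_def)
qed

lemma whisker_zigzag_up: "whisker A cup (\<up> # B) \<triangleright> whisker (A @ [\<up>]) cap B = cl (Idn (A @ \<up> # B))"
  using arg_cong[OF zigzag_up, of "\<lambda>f. whisker A f B"] by (simp add: whisker_seq)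

lemma whisker_zigzag_down: "whisker (A @ [\<down>]) cup B \<triangleright> whisker A cap (\<down> # B) = cl (Idn (A @ \<down> # B))"
  using arg_cong[OF zigzag_down, of "\<lambda>f. whisker A f B"] by (simp add: whisker_seq)

text \<open>The strand that is rotated has already left towards the cap when \<open>g\<close>
  occurs, so \<open>g\<close> slides past the cap. Dually, the next lemma slides a morphism past the
  cup.\<close>

lemma rho_seq_right:
  assumes f: "homog 0 f (A @ [\<up>]) (\<up> # B)" and g: "homog 0 g B B'"
  shows "rho A B' (f \<triangleright> whisker [\<up>] g []) = rho A B f \<triangleright> whisker [] g [\<down>]"
proof -
  have "whisker [] cap (B @ [\<down>]) \<triangleright> whisker [] g [\<down>] = whisker [\<down>, \<up>] g [\<down>] \<triangleright> whisker [] cap (B' @ [\<down>])"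
    using whisker_interchange[OF even_generators(3) g, of "[]" "[]" "[\<down>]"] by simp
  then show ?thesis
    unfolding rho_def using is_cls_homog[OF f] is_cls_homog[OF g]
    by (simp add: whisker_seq seq_assoc)
qed

lemma rho_seq_left:
  assumes f: "homog 0 f (A @ [\<up>]) (\<up> # B)" and g: "homog 0 g A' A"
  shows "rho A' B (whisker [] g [\<up>] \<triangleright> f) = whisker [\<down>] g [] \<triangleright> rho A B f"
proof -
  have "whisker (\<down> # A') cup [] \<triangleright> whisker [\<down>] g [\<up>, \<down>] = whisker [\<down>] g [] \<triangleright> whisker (\<down> # A) cup []"
    using whisker_interchange[OF g even_generators(4), of "[\<down>]" "[]" "[]"] by simp
  from seq_cong[OF this] show ?thesis
    unfolding rho_def using is_cls_homog[OF f] is_cls_homog[OF g]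
    by (simp add: whisker_seq seq_assoc)
qed

text \<open>The mate of a composite along one strand is the composite of the mates in reverse order:
  the bent strand is traversed backwards.\<close>

lemma rho_seq:
  assumes f: "homog 0 f (A @ [\<up>]) (\<up> # B)" and h: "homog 0 h (C @ [\<up>]) (\<up> # D)"
  shows "rho (C @ A) (D @ B) (whisker C f [] \<triangleright> whisker [] h B)
    = whisker [] (rho C D h) A \<triangleright> whisker D (rho A B f) []"
proof -
  note cap = even_generators(3) and cup = even_generators(4)
  \<comment> \<open>The layers of the rotation of \<open>f\<close> are moved in front of those of
    the rotation of \<open>h\<close>, until the cup belonging to \<open>h\<close> meets the cap
    belonging to \<open>f\<close>. The last equation removes this pair by a zigzag.\<close>
  have i:
    "whisker [] cap (D @ \<down> # A) \<triangleright> whisker (D @ \<down> # A) cup [] = whisker (\<down> # \<up> # D @ \<down> # A) cup [] \<triangleright> whisker [] cap (D @ \<down> # A @ [\<up>, \<down>])"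
    "whisker [] cap (D @ \<down> # A @ [\<up>, \<down>]) \<triangleright> whisker (D @ [\<down>]) f [\<down>] = whisker (\<down> # \<up> # D @ [\<down>]) f [\<down>] \<triangleright> whisker [] cap (D @ \<down> # \<up> # B @ [\<down>])"
    "whisker [] cap (D @ \<down> # \<up> # B @ [\<down>]) \<triangleright> whisker D cap (B @ [\<down>]) = whisker (\<down> # \<up> # D) cap (B @ [\<down>]) \<triangleright> whisker [] cap (D @ B @ [\<down>])"
    "whisker [\<down>] h (\<down> # A) \<triangleright> whisker (\<down> # \<up> # D @ \<down> # A) cup [] = whisker (\<down> # C @ \<up> # \<down> # A) cup [] \<triangleright> whisker [\<down>] h (\<down> # A @ [\<up>, \<down>])"
    "whisker [\<down>] h (\<down> # A @ [\<up>, \<down>]) \<triangleright> whisker (\<down> # \<up> # D @ [\<down>]) f [\<down>] = whisker (\<down> # C @ [\<up>, \<down>]) f [\<down>] \<triangleright> whisker [\<down>] h (\<down> # \<up> # B @ [\<down>])"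
    "whisker [\<down>] h (\<down> # \<up> # B @ [\<down>]) \<triangleright> whisker (\<down> # \<up> # D) cap (B @ [\<down>]) = whisker (\<down> # C @ [\<up>]) cap (B @ [\<down>]) \<triangleright> whisker [\<down>] h (B @ [\<down>])"
    "whisker (\<down> # C) cup A \<triangleright> whisker (\<down> # C @ \<up> # \<down> # A) cup [] = whisker (\<down> # C @ A) cup [] \<triangleright> whisker (\<down> # C) cup (A @ [\<up>, \<down>])"
    "whisker (\<down> # C) cup (A @ [\<up>, \<down>]) \<triangleright> whisker (\<down> # C @ [\<up>, \<down>]) f [\<down>] = whisker (\<down> # C) f [\<down>] \<triangleright> whisker (\<down> # C) cup (\<up> # B @ [\<down>])"
    "whisker (\<down> # C) cup (\<up> # B @ [\<down>]) \<triangleright> whisker (\<down> # C @ [\<up>]) cap (B @ [\<down>]) = cl (Idn (\<down> # C @ \<up> # B @ [\<down>]))"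
    using whisker_interchange[OF cap cup, of "[]" "D @ \<down> # A" "[]"]
      whisker_interchange[OF cap f, of "[]" "D @ [\<down>]" "[\<down>]"]
      whisker_interchange[OF cap cap, of "[]" "D" "B @ [\<down>]"]
      whisker_interchange[OF h cup, of "[\<down>]" "\<down> # A" "[]"]
      whisker_interchange[OF h f, of "[\<down>]" "[\<down>]" "[\<down>]"]
      whisker_interchange[OF h cap, of "[\<down>]" "[]" "B @ [\<down>]"]
      whisker_interchange[OF cup cup, of "\<down> # C" "A" "[]"]
      whisker_interchange[OF cup f, of "\<down> # C" "[]" "[\<down>]"]
      whisker_zigzag_up[of "\<down> # C" "B @ [\<down>]"]
    by simp_all
  have "hom (whisker (\<down> # C) f [\<down>]) (\<down> # C @ A @ [\<up>, \<down>]) (\<down> # C @ \<up> # B @ [\<down>])"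
    using hom_whisker[OF homog_imp_hom[OF f], of "\<down> # C" "[\<down>]"] by simp
  note idn = seq_cong[OF seq_idn(2)[OF this]]
  have "whisker [] (rho C D h) A \<triangleright> whisker D (rho A B f) []
    = whisker (\<down> # C) cup A \<triangleright> whisker [\<down>] h (\<down> # A) \<triangleright> whisker [] cap (D @ \<down> # A) \<triangleright>
      whisker (D @ \<down> # A) cup [] \<triangleright> whisker (D @ [\<down>]) f [\<down>] \<triangleright> whisker D cap (B @ [\<down>])"
    using is_cls_homog[OF f] is_cls_homog[OF h] by (simp add: whisker_rho seq_assoc)
  also have "\<dots> = whisker (\<down> # C @ A) cup [] \<triangleright> whisker (\<down> # C) f [\<down>] \<triangleright> whisker [\<down>] h (B @ [\<down>]) \<triangleright> whisker [] cap (D @ B @ [\<down>])"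
    by (simp only: i i[THEN seq_cong] idn seq_assoc)
  also have "\<dots> = rho (C @ A) (D @ B) (whisker C f [] \<triangleright> whisker [] h B)"
    unfolding rho_def using is_cls_homog[OF f] is_cls_homog[OF h] by (simp add: whisker_seq seq_assoc)
  finally show ?thesis ..
qed

text \<open>The cup inside the rotation cancels against the outer cap, so a rotated morphism slides
  over a cap and reappears unrotated.\<close>

lemma rho_cap:
  assumes f: "homog 0 f (A @ [\<up>]) (\<up> # B)"
  shows "whisker [] (rho A B f) [\<up>] \<triangleright> whisker B cap [] = whisker [\<down>] f [] \<triangleright> whisker [] cap B"
proof -
  note cap = even_generators(3) and cup = even_generators(4)
  have i:
    "whisker [] cap (B @ [\<down>, \<up>]) \<triangleright> whisker B cap [] = whisker (\<down> # \<up> # B) cap [] \<triangleright> whisker [] cap B"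
    "whisker [\<down>] f [\<down>, \<up>] \<triangleright> whisker (\<down> # \<up> # B) cap [] = whisker (\<down> # A @ [\<up>]) cap [] \<triangleright> whisker [\<down>] f []"
    "whisker (\<down> # A) cup [\<up>] \<triangleright> whisker (\<down> # A @ [\<up>]) cap [] = cl (Idn (\<down> # A @ [\<up>]))"
    using whisker_interchange[OF cap cap, of "[]" B "[]"]
      whisker_interchange[OF f cap, of "[\<down>]" "[]" "[]"]
      whisker_zigzag_up[of "\<down> # A" "[]"]
    by simp_all
  have "hom (whisker [\<down>] f []) (\<down> # A @ [\<up>]) (\<down> # \<up> # B)"
    using hom_whisker[OF homog_imp_hom[OF f], of "[\<down>]" "[]"] by simp
  note idn = seq_cong[OF seq_idn(1)[OF this]]
  show ?thesis
    using is_cls_homog[OF f] by (simp add: whisker_rho seq_assoc) (simp only: i i[THEN seq_cong] idn seq_assoc)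
qed

text \<open>Dual to \<open>rho_cap\<close>: here the outer cup cancels against the cap inside the
  rotation.\<close>

lemma rho_cup:
  assumes f: "homog 0 f (A @ [\<up>]) (\<up> # B)"
  shows "whisker [] cup A \<triangleright> whisker [\<up>] (rho A B f) [] = whisker A cup [] \<triangleright> whisker [] f [\<down>]"
proof -
  note cap = even_generators(3) and cup = even_generators(4)
  have i:
    "whisker [] cup A \<triangleright> whisker (\<up> # \<down> # A) cup [] = whisker A cup [] \<triangleright> whisker [] cup (A @ [\<up>, \<down>])"
    "whisker [] cup (A @ [\<up>, \<down>]) \<triangleright> whisker [\<up>, \<down>] f [\<down>] = whisker [] f [\<down>] \<triangleright> whisker [] cup (\<up> # B @ [\<down>])"
    "whisker [] cup (\<up> # B @ [\<down>]) \<triangleright> whisker [\<up>] cap (B @ [\<down>]) = cl (Idn (\<up> # B @ [\<down>]))"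
    using whisker_interchange[OF cup cup, of "[]" A "[]"]
      whisker_interchange[OF cup f, of "[]" "[]" "[\<down>]"]
      whisker_zigzag_up[of "[]" "B @ [\<down>]"]
    by simp_all
  have "hom (whisker [] f [\<down>]) (A @ [\<up>, \<down>]) (\<up> # B @ [\<down>])"
    using hom_whisker[OF homog_imp_hom[OF f], of "[]" "[\<down>]"] by simp
  note idn = seq_idn(2)[OF this]
  show ?thesis
    using is_cls_homog[OF f] by (simp add: whisker_rho seq_assoc) (simp only: i i[THEN seq_cong] idn seq_assoc)
qed

notation local.plus (infixl \<open>\<^bold>+\<close> 55)

definition l_cross :: "sign \<Rightarrow> 'k iterm set" where "l_cross e = cl (cross_l e)"
definition d_cross :: "sign \<Rightarrow> 'k iterm set" where "d_cross e = cl (cross_d e)"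

lemma cl_rot:
  assumes "hom (cl t) [a, \<up>] [\<up>, a]"
  shows "cl (rot a t) = rho [a] [a] (cl t)"
proof -
  note h = homog_imp_hom[OF even_generators(3)] homog_imp_hom[OF even_generators(4)]
  have "hom (whisker [\<down>] (cl t) []) [\<down>, a, \<up>] [\<down>, \<up>, a]"
    using hom_whisker[OF assms, of "[\<down>]" "[]"] by simp
  note h = h assms this
  show ?thesis
    unfolding rot_def rho_def
    by (simp add: tn_Idn_eq_whisker[OF h(1)] tn_Idn_eq_whisker[OF h(2)] tn_Idn_eq_whisker[OF h(3)] tn_Idn_eq_whisker[OF h(4)]
       flip: cl_seq cl_tn cap_def cup_def)
qed

lemma l_cross_eq_rho: "l_cross e = rho [\<up>] [\<up>] (u_cross e)"
  unfolding l_cross_def cross_l_def u_cross_def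
  by (rule cl_rot) (use homog_imp_hom[OF even_generators(1)] in \<open>simp add: u_cross_def\<close>)

lemma homog_l_cross: "homog 0 (l_cross e) [\<down>, \<up>] [\<up>, \<down>]"
  unfolding l_cross_eq_rho using homog_rho[of "u_cross e" "[\<up>]" "[\<up>]"] even_generators(1) by simp

lemma d_cross_eq_rho: "d_cross e = rho [\<down>] [\<down>] (l_cross e)"
  unfolding d_cross_def cross_d_def l_cross_def
  by (rule cl_rot) (use homog_imp_hom[OF homog_l_cross] in \<open>simp add: l_cross_def\<close>)

lemma homog_d_cross: "homog 0 (d_cross e) [\<down>, \<down>] [\<down>, \<down>]"
  unfolding d_cross_eq_rho using homog_rho[of "l_cross e" "[\<down>]" "[\<down>]"] homog_l_cross by simp

lemmas is_cls_ld_cross [simp] = homog_l_cross[THEN is_cls_homog] homog_d_cross[THEN is_cls_homog]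

lemmas even = even_generators homog_l_cross homog_d_cross

lemma homog_whisker_even:
  "homog 0 (whisker A (u_cross e) B) (A @ [\<up>, \<up>] @ B) (A @ [\<up>, \<up>] @ B)"
  "homog 0 (whisker A rneg B) (A @ [\<up>, \<down>] @ B) (A @ [\<down>, \<up>] @ B)"
  "homog 0 (whisker A cap B) (A @ [\<down>, \<up>] @ B) (A @ B)"
  "homog 0 (whisker A cup B) (A @ B) (A @ [\<up>, \<down>] @ B)"
  "homog 0 (whisker A (l_cross e) B) (A @ [\<down>, \<up>] @ B) (A @ [\<up>, \<down>] @ B)"
  "homog 0 (whisker A (d_cross e) B) (A @ [\<down>, \<down>] @ B) (A @ [\<down>, \<down>] @ B)"
  using even[THEN homog_whisker] by simp_all

lemmas hom_whisker_even = homog_whisker_even[THEN homog_imp_hom]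

lemmas even_seq = even(1-4)[THEN homog_imp_hom]

section \<open>Defining relations between classes, and rotations of the braid relation\<close>

lemma isomeric_relation_classes:
  "u_cross Pos \<triangleright> u_cross Neg = cl (Idn [\<up>, \<up>])" "u_cross Neg \<triangleright> u_cross Pos = cl (Idn [\<up>, \<up>])"
  "rneg \<triangleright> l_cross Pos = cl (Idn [\<up>, \<down>])" "l_cross Pos \<triangleright> rneg = cl (Idn [\<down>, \<up>])"
  "u_cross Pos \<^bold>+ scal (\<ominus> \<one>) (u_cross Neg) = scal z (cl (Idn [\<up>, \<up>]))"
  "cup \<triangleright> rneg \<triangleright> cap = cl (Zer [] [])"
proof -
  note h = even_seq homog_imp_hom[OF homog_l_cross]
  note defs = u_cross_def l_cross_def rneg_def cap_def cup_def capR_def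
  have hs: "hom (cl (cross_u Pos)) [\<up>, \<up>] [\<up>, \<up>]" "hom (cl (cross_u Neg)) [\<up>, \<up>] [\<up>, \<up>]"
    "hom (cl (Gen Gen_r_minus)) [\<up>, \<down>] [\<down>, \<up>]" "hom (cl (cross_l Pos)) [\<down>, \<up>] [\<up>, \<down>]"
    "hom (cl capL) [\<down>, \<up>] []" "hom (cl cupL) [] [\<up>, \<down>]"
    using h(1)[of Pos] h(1)[of Neg] h(2-4) h(5)[of Pos] by (simp_all add: defs)
  have "cl (cross_u Neg \<bullet> cross_u Pos) = cl (Idn [\<up>, \<up>])"
    by (rule rel_imp_eq[of _ _ "[\<up>, \<up>]" "[\<up>, \<up>]"])
      (simp_all add: isomeric_relations_def Let_def hom_seq[OF hs(1,2)[simplified]] flip: cl_seq)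
  then show "u_cross Pos \<triangleright> u_cross Neg = cl (Idn [\<up>, \<up>])"
    by (simp add: defs cl_seq)
  have "cl (cross_u Pos \<bullet> cross_u Neg) = cl (Idn [\<up>, \<up>])"
    by (rule rel_imp_eq[of _ _ "[\<up>, \<up>]" "[\<up>, \<up>]"])
      (simp_all add: isomeric_relations_def Let_def hom_seq[OF hs(2,1)[simplified]] flip: cl_seq)
  then show "u_cross Neg \<triangleright> u_cross Pos = cl (Idn [\<up>, \<up>])"
    by (simp add: defs cl_seq)
  have "cl (cross_l Pos \<bullet> Gen Gen_r_minus) = cl (Idn [\<up>, \<down>])"
    by (rule rel_imp_eq[of _ _ "[\<up>, \<down>]" "[\<up>, \<down>]"])
      (simp_all add: isomeric_relations_def Let_def hom_seq[OF hs(3,4)[simplified]] flip: cl_seq)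
  then show "rneg \<triangleright> l_cross Pos = cl (Idn [\<up>, \<down>])"
    by (simp add: defs cl_seq)
  have "cl (Gen Gen_r_minus \<bullet> cross_l Pos) = cl (Idn [\<down>, \<up>])"
    by (rule rel_imp_eq[of _ _ "[\<down>, \<up>]" "[\<down>, \<up>]"])
      (simp_all add: isomeric_relations_def Let_def hom_seq[OF hs(4,3)[simplified]] flip: cl_seq)
  then show "l_cross Pos \<triangleright> rneg = cl (Idn [\<down>, \<up>])"
    by (simp add: defs cl_seq)
  have "cl (Add (cross_u Pos) (Scl (\<ominus> \<one>) (cross_u Neg))) = cl (Scl z (Idn [\<up>, \<up>]))"
    by (rule rel_imp_eq[of _ _ "[\<up>, \<up>]" "[\<up>, \<up>]"])
      (use hs(1,2) in \<open>simp_all add: isomeric_relations_def Let_def flip: cl_plus cl_scal\<close>)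
  then show "u_cross Pos \<^bold>+ scal (\<ominus> \<one>) (u_cross Neg) = scal z (cl (Idn [\<up>, \<up>]))"
    by (simp add: defs cl_plus cl_scal)
  have "cl ((capL \<bullet> Gen Gen_r_minus) \<bullet> cupL) = cl (Zer [] [])"
    by (rule rel_imp_eq[of _ _ "[]" "[]"])
      (simp_all add: isomeric_relations_def Let_def capR_def hom_seq[OF hs(6) hom_seq[OF hs(3,5)]] flip: cl_seq)
  then show "cup \<triangleright> rneg \<triangleright> cap = cl (Zer [] [])"
    by (simp add: defs cl_seq)
qed

lemma braid:
  "whisker [] (u_cross Pos) [\<up>] \<triangleright> whisker [\<up>] (u_cross Pos) [] \<triangleright> whisker [] (u_cross Pos) [\<up>]
    = whisker [\<up>] (u_cross Pos) [] \<triangleright> whisker [] (u_cross Pos) [\<up>] \<triangleright> whisker [\<up>] (u_cross Pos) []" (is "?l = ?r")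
proof -
  let ?u = "cross_u Pos" and ?I = "Idn [\<up>]"
  have w: "cl (?u \<boxtimes> ?I) = whisker [] (u_cross Pos) [\<up>]" "cl (?I \<boxtimes> ?u) = whisker [\<up>] (u_cross Pos) []"
    unfolding cl_tn[symmetric] u_cross_def[symmetric] by (rule tn_Idn_eq_whisker[OF even_seq(1)])+
  have s: "cl ((?u \<boxtimes> ?I) \<bullet> (?I \<boxtimes> ?u) \<bullet> (?u \<boxtimes> ?I)) = ?l" "cl ((?I \<boxtimes> ?u) \<bullet> (?u \<boxtimes> ?I) \<bullet> (?I \<boxtimes> ?u)) = ?r"
    unfolding cl_seq[symmetric] w by (rule HOL.refl)+
  have h: "hom (whisker [] (u_cross Pos) [\<up>]) [\<up>, \<up>, \<up>] [\<up>, \<up>, \<up>]" "hom (whisker [\<up>] (u_cross Pos) []) [\<up>, \<up>, \<up>] [\<up>, \<up>, \<up>]"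
    using hom_whisker_even(1)[of "[]" Pos "[\<up>]"] hom_whisker_even(1)[of "[\<up>]" Pos "[]"] by simp_all
  have "hom ?l [\<up>, \<up>, \<up>] [\<up>, \<up>, \<up>]" "hom ?r [\<up>, \<up>, \<up>] [\<up>, \<up>, \<up>]"
    using h by (auto intro: hom_seq)
  note h = this[folded s]
  show ?thesis
    unfolding s[symmetric] by (rule rel_imp_eq[OF _ h]) (simp add: isomeric_relations_def Let_def)
qed

lemma whisker_inverse:
  assumes "is_cls f" "is_cls g" "f \<triangleright> g = cl (Idn X)"
  shows "whisker A f B \<triangleright> whisker A g B = cl (Idn (A @ X @ B))"
  using arg_cong[OF assms(3), of "\<lambda>f. whisker A f B"] by (simp add: whisker_seq assms(1,2))

text \<open>Follows by multiplying \<open>braid\<close> with a negative crossing on either side. The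
  negative crossing is placed so that two rotations turn it into d^- while the two positive ones
  become l^+, whose inverse is the generator r^-.\<close>

lemma braid_mixed:
  "whisker [\<up>] (u_cross Neg) [] \<triangleright> whisker [] (u_cross Pos) [\<up>] \<triangleright> whisker [\<up>] (u_cross Pos) []
    = whisker [] (u_cross Pos) [\<up>] \<triangleright> whisker [\<up>] (u_cross Pos) [] \<triangleright> whisker [] (u_cross Neg) [\<up>]"
proof -
  define u1 u2 v1 v2 where uv: "u1 = whisker [] (u_cross Pos) [\<up>]" "u2 = whisker [\<up>] (u_cross Pos) []"
    "v1 = whisker [] (u_cross Neg) [\<up>]" "v2 = whisker [\<up>] (u_cross Neg) []"
  have h: "hom u1 [\<up>, \<up>, \<up>] [\<up>, \<up>, \<up>]" "hom u2 [\<up>, \<up>, \<up>] [\<up>, \<up>, \<up>]"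
    "hom v1 [\<up>, \<up>, \<up>] [\<up>, \<up>, \<up>]" "hom v2 [\<up>, \<up>, \<up>] [\<up>, \<up>, \<up>]"
    using hom_whisker_even(1)[of "[]" _ "[\<up>]"] hom_whisker_even(1)[of "[\<up>]" _ "[]"] by (simp_all add: uv)
  have i: "u1 \<triangleright> v1 = cl (Idn [\<up>, \<up>, \<up>])" "v2 \<triangleright> u2 = cl (Idn [\<up>, \<up>, \<up>])"
    unfolding uv by (simp_all add: whisker_inverse[OF _ _ isomeric_relation_classes(1)] whisker_inverse[OF _ _ isomeric_relation_classes(2)])
  have "v2 \<triangleright> (u1 \<triangleright> u2 \<triangleright> u1) \<triangleright> v1 = v2 \<triangleright> (u2 \<triangleright> u1 \<triangleright> u2) \<triangleright> v1"
    using braid by (simp add: uv)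
  then have "v2 \<triangleright> u1 \<triangleright> u2 = u1 \<triangleright> u2 \<triangleright> v1"
    by (simp add: seq_assoc i i[THEN seq_cong] seq_idn[OF h(2)] seq_cong[OF seq_idn(1)[OF h(1)]])
  then show ?thesis by (simp add: uv)
qed

text \<open>Both sides of \<open>braid_mixed\<close> are rotated along the strand that enters on the
  far right and leaves on the far left. It takes part in two of the three crossings; the third one
  is carried along by naturality.\<close>

lemma braid_rotated:
  "whisker [] (l_cross Pos) [\<up>] \<triangleright> whisker [\<up>] (l_cross Neg) [] \<triangleright> whisker [] (u_cross Pos) [\<down>]
    = whisker [\<down>] (u_cross Pos) [] \<triangleright> whisker [] (l_cross Neg) [\<up>] \<triangleright> whisker [\<up>] (l_cross Pos) []"
proof -
  have e: "homog 0 (u_cross e) ([\<up>] @ [\<up>]) (\<up> # [\<up>])" "homog 0 (u_cross e) ([\<up>] @ [\<up>]) ([\<up>] @ [\<up>])"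
    "homog 0 (u_cross e) [\<up>, \<up>] [\<up>, \<up>]" for e
    using even(1) by simp_all
  have h: "homog 0 (whisker [\<up>] (u_cross e) [] \<triangleright> whisker [] (u_cross e') [\<up>]) [\<up>, \<up>, \<up>] [\<up>, \<up>, \<up>]" for e e'
    using homog_seq0[OF homog_whisker_even(1)[of "[\<up>]" e "[]", simplified] homog_whisker_even(1)[of "[]" e' "[\<up>]", simplified]]
    by simp
  have "rho [\<up>, \<up>] [\<up>, \<up>] ((whisker [\<up>] (u_cross Neg) [] \<triangleright> whisker [] (u_cross Pos) [\<up>]) \<triangleright> whisker [\<up>] (u_cross Pos) [])
    = rho [\<up>, \<up>] [\<up>, \<up>] (whisker [\<up>] (u_cross Neg) [] \<triangleright> whisker [] (u_cross Pos) [\<up>]) \<triangleright> whisker [] (u_cross Pos) [\<down>]"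
    by (rule rho_seq_right) (use h e(3) in simp_all)
  moreover have "rho [\<up>, \<up>] [\<up>, \<up>] (whisker [] (u_cross Pos) [\<up>] \<triangleright> (whisker [\<up>] (u_cross Pos) [] \<triangleright> whisker [] (u_cross Neg) [\<up>]))
    = whisker [\<down>] (u_cross Pos) [] \<triangleright> rho [\<up>, \<up>] [\<up>, \<up>] (whisker [\<up>] (u_cross Pos) [] \<triangleright> whisker [] (u_cross Neg) [\<up>])"
    by (rule rho_seq_left) (use h e(3) in simp_all)
  moreover have "rho [\<up>, \<up>] [\<up>, \<up>] (whisker [\<up>] (u_cross e) [] \<triangleright> whisker [] (u_cross e') [\<up>]) = whisker [] (l_cross e') [\<up>] \<triangleright> whisker [\<up>] (l_cross e) []" for e e'
    using rho_seq[OF e(1)[of e] e(1)[of e']] by (simp add: l_cross_eq_rho)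
  ultimately show ?thesis
    using braid_mixed by (simp add: seq_assoc)
qed

text \<open>The same argument applied to \<open>braid_rotated\<close>: its rightmost incoming strand
  still points up and leaves on the far left.\<close>

lemma braid_rotated_twice:
  "whisker [\<down>] (l_cross Pos) [] \<triangleright> whisker [] (l_cross Pos) [\<down>] \<triangleright> whisker [\<up>] (d_cross Neg) []
    = whisker [] (d_cross Neg) [\<up>] \<triangleright> whisker [\<down>] (l_cross Pos) [] \<triangleright> whisker [] (l_cross Pos) [\<down>]"
proof -
  have e: "homog 0 (u_cross e) ([\<up>] @ [\<up>]) (\<up> # [\<up>])" "homog 0 (l_cross e) ([\<down>] @ [\<up>]) (\<up> # [\<down>])"
     "homog 0 (l_cross e) [\<down>, \<up>] [\<up>, \<down>]" for e
    using even(1) homog_l_cross by simp_all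
  have h: "homog 0 (whisker [\<up>] (l_cross e) [] \<triangleright> whisker [] (u_cross e') [\<down>]) [\<up>, \<down>, \<up>] [\<up>, \<up>, \<down>]"
    "homog 0 (whisker [\<down>] (u_cross e) [] \<triangleright> whisker [] (l_cross e') [\<up>]) [\<down>, \<up>, \<up>] [\<up>, \<down>, \<up>]" for e e'
    using homog_seq0[OF homog_whisker_even(5)[of "[\<up>]" e "[]", simplified] homog_whisker_even(1)[of "[]" e' "[\<down>]", simplified]]
      homog_seq0[OF homog_whisker_even(1)[of "[\<down>]" e "[]", simplified] homog_whisker_even(5)[of "[]" e' "[\<up>]", simplified]]
    by simp_all
  have "rho [\<down>, \<up>] [\<up>, \<down>] (whisker [] (l_cross Pos) [\<up>] \<triangleright> (whisker [\<up>] (l_cross Neg) [] \<triangleright> whisker [] (u_cross Pos) [\<down>]))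
    = whisker [\<down>] (l_cross Pos) [] \<triangleright> rho [\<up>, \<down>] [\<up>, \<down>] (whisker [\<up>] (l_cross Neg) [] \<triangleright> whisker [] (u_cross Pos) [\<down>])"
    by (rule rho_seq_left) (use h e(3) in simp_all)
  moreover have "rho [\<down>, \<up>] [\<up>, \<down>] ((whisker [\<down>] (u_cross Pos) [] \<triangleright> whisker [] (l_cross Neg) [\<up>]) \<triangleright> whisker [\<up>] (l_cross Pos) [])
    = rho [\<down>, \<up>] [\<down>, \<up>] (whisker [\<down>] (u_cross Pos) [] \<triangleright> whisker [] (l_cross Neg) [\<up>]) \<triangleright> whisker [] (l_cross Pos) [\<down>]"
    by (rule rho_seq_right) (use h e(3) in simp_all)
  moreover have "rho [\<up>, \<down>] [\<up>, \<down>] (whisker [\<up>] (l_cross e) [] \<triangleright> whisker [] (u_cross e') [\<down>]) = whisker [] (l_cross e') [\<down>] \<triangleright> whisker [\<up>] (d_cross e) []" for e e'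
    using rho_seq[OF e(2)[of e] e(1)[of e']] by (simp add: l_cross_eq_rho d_cross_eq_rho)
  moreover have "rho [\<down>, \<up>] [\<down>, \<up>] (whisker [\<down>] (u_cross e) [] \<triangleright> whisker [] (l_cross e') [\<up>]) = whisker [] (d_cross e') [\<up>] \<triangleright> whisker [\<down>] (l_cross e) []" for e e'
    using rho_seq[OF e(1)[of e] e(2)[of e']] by (simp add: l_cross_eq_rho d_cross_eq_rho)
  ultimately show ?thesis
    using braid_rotated by (simp add: seq_assoc)
qed

section \<open>Invertibility of the downward crossing\<close>

definition nested_cap :: "'k iterm set" where "nested_cap = whisker [\<down>] cap [\<up>] \<triangleright> cap"

text \<open>Two applications of \<open>rho_cap\<close>, one for each rotation in
  \<open>d_cross\<close>. Thus d is the transpose of u with respect to the nested caps.\<close>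

lemma nested_cap_slide: "whisker [] (d_cross e) [\<up>, \<up>] \<triangleright> nested_cap = whisker [\<down>, \<down>] (u_cross e) [] \<triangleright> nested_cap"
proof -
  have 1: "whisker [] (d_cross e) [\<up>, \<up>] \<triangleright> whisker [\<down>] cap [\<up>] = whisker [\<down>] (l_cross e) [\<up>] \<triangleright> whisker [] cap [\<down>, \<up>]"
    using arg_cong[OF rho_cap[of "l_cross e" "[\<down>]" "[\<down>]"], of "\<lambda>f. whisker [] f [\<up>]"] homog_l_cross
    by (simp add: whisker_seq d_cross_eq_rho[symmetric])
  have 2: "whisker [] cap [\<down>, \<up>] \<triangleright> cap = whisker [\<down>, \<up>] cap [] \<triangleright> cap"
    using whisker_interchange[OF even(3) even(3), of "[]" "[]" "[]"] by (simp add: whisker_Nil[OF even_seq(3)])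
  have 3: "whisker [\<down>] (l_cross e) [\<up>] \<triangleright> whisker [\<down>, \<up>] cap [] = whisker [\<down>, \<down>] (u_cross e) [] \<triangleright> whisker [\<down>] cap [\<up>]"
    using arg_cong[OF rho_cap[of "u_cross e" "[\<up>]" "[\<up>]"], of "\<lambda>f. whisker [\<down>] f []"] even(1)
    by (simp add: whisker_seq l_cross_eq_rho[symmetric])
  show ?thesis
    unfolding nested_cap_def by (simp only: seq_cong[OF 1] 2 seq_cong[OF 3] seq_assoc)
qed

text \<open>
  Precomposition with the two nested caps is injective on endomorphisms of \<open>\<down> \<otimes> \<down>\<close>, since those caps
  are inverted by the nested cups \<open>M\<close>.
\<close>

lemma nested_cap_faithful:
  assumes g: "homog 0 g [\<down>, \<down>] [\<down>, \<down>]" and eq: "whisker [] g [\<up>, \<up>] \<triangleright> nested_cap = nested_cap"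
  shows "g = cl (Idn [\<down>, \<down>])"
proof -
  define M where "M = whisker [\<down>, \<down>] cup [] \<triangleright> whisker [\<down>, \<down>, \<up>] cup [\<down>]"
  have 1: "whisker [\<down>, \<down>, \<up>] cup [\<down>] \<triangleright> whisker [\<down>] cap [\<up>, \<down>, \<down>] = whisker [\<down>] cap [\<down>] \<triangleright> whisker [\<down>] cup [\<down>]"
    using whisker_interchange[OF even(3) even(4), of "[\<down>]" "[]" "[\<down>]"] by simp
  have 2: "whisker [\<down>, \<down>] cup [] \<triangleright> whisker [\<down>] cap [\<down>] = cl (Idn [\<down>, \<down>])"
    "whisker [\<down>] cup [\<down>] \<triangleright> whisker [] cap [\<down>, \<down>] = cl (Idn [\<down>, \<down>])"
    using whisker_zigzag_down[of "[\<down>]" "[]"] whisker_zigzag_down[of "[]" "[\<down>]"] by simp_all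
  have M: "M \<triangleright> whisker [] nested_cap [\<down>, \<down>] = cl (Idn [\<down>, \<down>])"
    unfolding M_def nested_cap_def
    by (simp add: whisker_seq seq_assoc seq_cong[OF 1]) (simp only: seq_cong[OF 2(1)] 2(2) seq_idn[OF hom_intros(1)])
  have 3: "whisker [] g [] \<triangleright> whisker [\<down>, \<down>] cup [] = whisker [\<down>, \<down>] cup [] \<triangleright> whisker [] g [\<up>, \<down>]"
    "whisker [] g [\<up>, \<down>] \<triangleright> whisker [\<down>, \<down>, \<up>] cup [\<down>] = whisker [\<down>, \<down>, \<up>] cup [\<down>] \<triangleright> whisker [] g [\<up>, \<up>, \<down>, \<down>]"
    using whisker_interchange[OF g even(4), of "[]" "[]" "[]"] whisker_interchange[OF g even(4), of "[]" "[\<up>]" "[\<down>]"] by simp_all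
  have "whisker [] g [] \<triangleright> M = M \<triangleright> whisker [] g [\<up>, \<up>, \<down>, \<down>]"
    unfolding M_def by (simp only: seq_assoc seq_cong[OF 3(1)] 3(2))
  then have gM: "g \<triangleright> M = M \<triangleright> whisker [] g [\<up>, \<up>, \<down>, \<down>]"
    unfolding whisker_Nil[OF homog_imp_hom[OF g]] .
  have "g = (g \<triangleright> M) \<triangleright> whisker [] nested_cap [\<down>, \<down>]"
    by (simp only: M seq_assoc seq_idn[OF homog_imp_hom[OF g]])
  also have "\<dots> = M \<triangleright> whisker [] g [\<up>, \<up>, \<down>, \<down>] \<triangleright> whisker [] nested_cap [\<down>, \<down>]"
    by (simp only: gM seq_assoc)
  also have "\<dots> = M \<triangleright> whisker [] (whisker [] g [\<up>, \<up>] \<triangleright> nested_cap) [\<down>, \<down>]"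
    using is_cls_homog[OF g] by (simp add: whisker_seq nested_cap_def)
  also have "\<dots> = cl (Idn [\<down>, \<down>])"
    by (simp add: eq M)
  finally show ?thesis .
qed

text \<open>Invertibility of d is not among the relations. Transposition by the nested caps reverses
  the order and turns the product of d^+ and d^- into a product of u^- and u^+, which is the
  identity.\<close>

lemma d_cross_inverse: "d_cross Pos \<triangleright> d_cross Neg = cl (Idn [\<down>, \<down>])"
proof (rule nested_cap_faithful)
  show "homog 0 (d_cross Pos \<triangleright> d_cross Neg) [\<down>, \<down>] [\<down>, \<down>]"
    using homog_d_cross by (rule homog_seq0) (rule homog_d_cross)
  have i: "whisker [] (d_cross Pos) [\<up>, \<up>] \<triangleright> whisker [\<down>, \<down>] (u_cross Neg) [] = whisker [\<down>, \<down>] (u_cross Neg) [] \<triangleright> whisker [] (d_cross Pos) [\<up>, \<up>]"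
    using whisker_interchange[OF homog_d_cross[of Pos] even(1)[of Neg], of "[]" "[]" "[]"] by simp
  have u: "whisker [\<down>, \<down>] (u_cross Neg) [] \<triangleright> whisker [\<down>, \<down>] (u_cross Pos) [] = cl (Idn [\<down>, \<down>, \<up>, \<up>])"
    using whisker_inverse[OF _ _ isomeric_relation_classes(2), of "[\<down>, \<down>]" "[]"] by simp
  have "hom nested_cap [\<down>, \<down>, \<up>, \<up>] []"
    unfolding nested_cap_def using hom_whisker_even(3)[of "[\<down>]" "[\<up>]"] even_seq(3) by (auto intro: hom_seq)
  note n = seq_idn(1)[OF this]
  have "whisker [] (d_cross Pos \<triangleright> d_cross Neg) [\<up>, \<up>] \<triangleright> nested_cap = whisker [] (d_cross Pos) [\<up>, \<up>] \<triangleright> whisker [\<down>, \<down>] (u_cross Neg) [] \<triangleright> nested_cap"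
    by (simp add: whisker_seq seq_assoc nested_cap_slide)
  also have "\<dots> = nested_cap"
    by (simp add: seq_cong[OF i] seq_assoc nested_cap_slide seq_cong[OF u] n)
  finally show "whisker [] (d_cross Pos \<triangleright> d_cross Neg) [\<up>, \<up>] \<triangleright> nested_cap = nested_cap" .
qed

text \<open>The rotation of the skein relation: on two upward strands, the identity rotates to a cap
  followed by a cup.\<close>

lemma l_cross_Pos_eq: "l_cross Pos = l_cross Neg \<^bold>+ scal z (cap \<triangleright> cup)"
proof -
  have hU: "hom (u_cross e) [\<up>, \<up>] [\<up>, \<up>]" for e by (rule even_seq(1))
  have "scal (\<ominus> \<one> \<oplus> \<one>) (u_cross Neg) = cl (Zer [\<up>, \<up>] [\<up>, \<up>])"
    by (simp add: l_neg scal_zero[OF hU])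
  then have "scal (\<ominus> \<one>) (u_cross Neg) \<^bold>+ u_cross Neg = cl (Zer [\<up>, \<up>] [\<up>, \<up>])"
    using scal_add_left[of "\<ominus> \<one>" \<one>, OF _ _ hU[of Neg]] by (simp add: scal_one[OF hU])
  then have "u_cross Pos = (u_cross Pos \<^bold>+ scal (\<ominus> \<one>) (u_cross Neg)) \<^bold>+ u_cross Neg"
    by (simp add: plus_assoc plus_zero[OF hU])
  then have u_cross: "u_cross Pos = u_cross Neg \<^bold>+ scal z (cl (Idn [\<up>, \<up>]))"
    unfolding isomeric_relation_classes(5) by (simp add: plus_comm)
  have "whisker [\<down>, \<up>] cup [] \<triangleright> whisker [] cap [\<up>, \<down>] = cap \<triangleright> cup"
    using whisker_interchange[OF even(3,4), of "[]" "[]" "[]"]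
    by (simp add: whisker_Nil[OF even_seq(3)] whisker_Nil[OF even_seq(4)])
  moreover have "hom (whisker [] cap [\<up>, \<down>]) [\<down>, \<up>, \<up>, \<down>] [\<up>, \<down>]"
    using hom_whisker_even(3)[of "[]" "[\<up>, \<down>]"] by simp
  ultimately have "rho [\<up>] [\<up>] (cl (Idn [\<up>, \<up>])) = cap \<triangleright> cup"
    unfolding rho_def by (simp add: seq_idn)
  moreover have "rho [\<up>] [\<up>] (u_cross Neg \<^bold>+ scal z (cl (Idn [\<up>, \<up>]))) = rho [\<up>] [\<up>] (u_cross Neg) \<^bold>+ scal z (rho [\<up>] [\<up>] (cl (Idn [\<up>, \<up>])))"
    unfolding rho_def by (simp add: whisker_plus whisker_scal distrib seq_scal_left seq_scal_right del: whisker_Idn)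
  ultimately show ?thesis
    unfolding l_cross_eq_rho u_cross[symmetric] using u_cross by simp
qed

text \<open>With l^+ in place of l^- this is the relation that l^+ inverts r^-. The difference of
  the two contains the bubble cap_R cup_L, which vanishes.\<close>

lemma cup_rneg_l_cross_Neg: "cup \<triangleright> rneg \<triangleright> l_cross Neg = cup"
proof -
  have "cup = cup \<triangleright> rneg \<triangleright> l_cross Pos"
    by (simp add: isomeric_relation_classes(3) seq_idn[OF even_seq(4)])
  also have "\<dots> = (cup \<triangleright> rneg \<triangleright> l_cross Neg) \<^bold>+ scal z ((cup \<triangleright> rneg \<triangleright> cap) \<triangleright> cup)"
    unfolding l_cross_Pos_eq by (simp add: distrib seq_scal_right seq_assoc)
  also have "\<dots> = (cup \<triangleright> rneg \<triangleright> l_cross Neg) \<^bold>+ cl (Zer [] [\<up>, \<down>])"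
    by (simp add: isomeric_relation_classes(6) seq_Zer_left[OF even_seq(4)])
  also have "\<dots> = cup \<triangleright> rneg \<triangleright> l_cross Neg"
    by (rule plus_zero) (intro hom_seq[OF even_seq(4) hom_seq[OF even_seq(2) homog_imp_hom[OF homog_l_cross]]])
  finally show ?thesis ..
qed

text \<open>Since d^+ is invertible, \<open>rho_cup\<close> expresses a left cup next to a downward
  strand through the cup on the other side of that strand, at the price of l^+ and d^-. The twice
  rotated braid relation trades these, together with the two r^- of the right cup and cap, for one
  r^- and one d^-. The latter slides over the cap as l^-, which \<open>cup_rneg_l_cross_Neg\<close>
  removes, and a left zigzag remains.\<close>

lemma zigzag_right: "whisker [] (cup \<triangleright> rneg) [\<down>] \<triangleright> whisker [\<down>] (rneg \<triangleright> cap) [] = cl (Idn [\<down>])"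
proof -
  have 1: "whisker [] cup [\<down>] \<triangleright> whisker [\<up>] (d_cross e) [] = whisker [\<down>] cup [] \<triangleright> whisker [] (l_cross e) [\<down>]" for e
    using rho_cup[of "l_cross e" "[\<down>]" "[\<down>]"] homog_l_cross by (simp add: d_cross_eq_rho[symmetric])
  have d: "whisker [\<up>] (d_cross Pos) [] \<triangleright> whisker [\<up>] (d_cross Neg) [] = cl (Idn [\<up>, \<down>, \<down>])"
    using whisker_inverse[OF _ _ d_cross_inverse, of "[\<up>]" "[]"] by simp
  have "hom (whisker [] cup [\<down>]) [\<down>] [\<up>, \<down>, \<down>]"
    using hom_whisker_even(4)[of "[]" "[\<down>]"] by simp
  then have 2: "whisker [] cup [\<down>] = whisker [\<down>] cup [] \<triangleright> whisker [] (l_cross Pos) [\<down>] \<triangleright> whisker [\<up>] (d_cross Neg) []"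
    unfolding seq_cong[OF 1[symmetric]] by (simp add: seq_assoc d seq_idn)
  have r: "whisker [\<down>] rneg [] \<triangleright> whisker [\<down>] (l_cross Pos) [] = cl (Idn [\<down>, \<up>, \<down>])"
    "whisker [\<down>] (l_cross Pos) [] \<triangleright> whisker [\<down>] rneg [] = cl (Idn [\<down>, \<down>, \<up>])"
    "whisker [] (l_cross Pos) [\<down>] \<triangleright> whisker [] rneg [\<down>] = cl (Idn [\<down>, \<up>, \<down>])"
    using whisker_inverse[OF _ _ isomeric_relation_classes(3), of "[\<down>]" "[]"]
      whisker_inverse[OF _ _ isomeric_relation_classes(4), of "[\<down>]" "[]"]
      whisker_inverse[OF _ _ isomeric_relation_classes(4), of "[]" "[\<down>]"] by simp_all
  have h: "hom (whisker [] (l_cross Pos) [\<down>]) [\<down>, \<up>, \<down>] [\<up>, \<down>, \<down>]"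
    "hom (whisker [\<down>] rneg []) [\<down>, \<up>, \<down>] [\<down>, \<down>, \<up>]"
    "hom (whisker [] (d_cross Neg) [\<up>]) [\<down>, \<down>, \<up>] [\<down>, \<down>, \<up>]"
    using hom_whisker_even(5)[of "[]" Pos "[\<down>]"] hom_whisker_even(2)[of "[\<down>]" "[]"] hom_whisker_even(6)[of "[]" Neg "[\<up>]"] by simp_all
  \<comment> \<open>Inserting r^- followed by l^+ in front completes one side of
    \<open>braid_rotated_twice\<close>. On its other side both copies of l^+ are followed directly
    by an r^- and cancel.\<close>
  have "whisker [] (l_cross Pos) [\<down>] \<triangleright> whisker [\<up>] (d_cross Neg) [] \<triangleright> whisker [] rneg [\<down>] \<triangleright> whisker [\<down>] rneg []
    = (whisker [\<down>] rneg [] \<triangleright> whisker [\<down>] (l_cross Pos) []) \<triangleright> whisker [] (l_cross Pos) [\<down>] \<triangleright> whisker [\<up>] (d_cross Neg) [] \<triangleright> whisker [] rneg [\<down>] \<triangleright> whisker [\<down>] rneg []"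
    by (simp add: r seq_cong[OF seq_idn(1)[OF h(1)]])
  also have "\<dots> = whisker [\<down>] rneg [] \<triangleright> (whisker [\<down>] (l_cross Pos) [] \<triangleright> whisker [] (l_cross Pos) [\<down>] \<triangleright> whisker [\<up>] (d_cross Neg) []) \<triangleright> whisker [] rneg [\<down>] \<triangleright> whisker [\<down>] rneg []"
    by (simp add: seq_assoc)
  also have "\<dots> = whisker [\<down>] rneg [] \<triangleright> whisker [] (d_cross Neg) [\<up>] \<triangleright> whisker [\<down>] (l_cross Pos) [] \<triangleright> (whisker [] (l_cross Pos) [\<down>] \<triangleright> whisker [] rneg [\<down>]) \<triangleright> whisker [\<down>] rneg []"
    unfolding braid_rotated_twice by (simp add: seq_assoc)
  also have "\<dots> = whisker [\<down>] rneg [] \<triangleright> whisker [] (d_cross Neg) [\<up>]"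
    by (simp add: r seq_idn[OF h(2)] seq_idn[OF h(3)])
  finally have 3: "whisker [] (l_cross Pos) [\<down>] \<triangleright> whisker [\<up>] (d_cross Neg) [] \<triangleright> whisker [] rneg [\<down>] \<triangleright> whisker [\<down>] rneg [] \<triangleright> k
    = whisker [\<down>] rneg [] \<triangleright> whisker [] (d_cross Neg) [\<up>] \<triangleright> k" for k
    by (metis seq_assoc)
  have 4: "whisker [] (d_cross Neg) [\<up>] \<triangleright> whisker [\<down>] cap [] = whisker [\<down>] (l_cross Neg) [] \<triangleright> whisker [] cap [\<down>]"
    using rho_cap[of "l_cross Neg" "[\<down>]" "[\<down>]"] homog_l_cross by (simp add: d_cross_eq_rho[symmetric])
  have "whisker [] (cup \<triangleright> rneg) [\<down>] \<triangleright> whisker [\<down>] (rneg \<triangleright> cap) []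
    = whisker [] cup [\<down>] \<triangleright> whisker [] rneg [\<down>] \<triangleright> whisker [\<down>] rneg [] \<triangleright> whisker [\<down>] cap []"
    by (simp add: whisker_seq seq_assoc)
  also have "\<dots> = whisker [\<down>] cup [] \<triangleright> whisker [\<down>] rneg [] \<triangleright> whisker [] (d_cross Neg) [\<up>] \<triangleright> whisker [\<down>] cap []"
    unfolding 2 seq_assoc 3 ..
  also have "\<dots> = whisker [\<down>] (cup \<triangleright> rneg \<triangleright> l_cross Neg) [] \<triangleright> whisker [] cap [\<down>]"
    by (simp add: 4 whisker_seq seq_assoc)
  also have "\<dots> = cl (Idn [\<down>])"
    unfolding cup_rneg_l_cross_Neg by (rule zigzag_down)
  finally show ?thesis .
qed

section \<open>The flip isomorphism\<close>

definition rpos :: "'k iterm set" where "rpos = cl (cross_r z Pos)"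

lemma rpos_eq: "rpos = rneg \<^bold>+ scal z (rneg \<triangleright> cap \<triangleright> cup \<triangleright> rneg)"
  by (simp add: rpos_def rneg_def cap_def cup_def capR_def cupR_def seq_assoc flip: cl_plus cl_scal cl_seq)

lemma hom_rneg_cap_cup:
  "hom (rneg \<triangleright> cap) [\<up>, \<down>] []" "hom (cup \<triangleright> rneg) [] [\<down>, \<up>]"
  "hom (rneg \<triangleright> cap \<triangleright> cup \<triangleright> rneg) [\<up>, \<down>] [\<down>, \<up>]"
  using even_seq by (blast intro: hom_seq)+

lemma homog_cupr: "homog 0 (cup \<triangleright> rneg) [] [\<down>, \<up>]"
  using even(4) even(2) by (rule homog_seq0)

lemma homog_rpos: "homog 0 rpos [\<up>, \<down>] [\<down>, \<up>]"
proof -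
  have "homog 0 (rneg \<triangleright> cap \<triangleright> cup \<triangleright> rneg) [\<up>, \<down>] [\<down>, \<up>]"
    by (intro homog_seq0[OF even(2) homog_seq0[OF even(3) homog_cupr]])
  then show ?thesis
    unfolding rpos_eq using even(2) by (intro homog_intros(3,4)) simp_all
qed

lemma is_cls_rpos [simp]: "is_cls rpos"
  by (rule is_cls_homog[OF homog_rpos])

text \<open>The correction term of r^+ contains the vanishing bubble. Hence r^+ and r^- give the
  same right cap, and by \<open>cup_rpos\<close> also the same right cup.\<close>

lemma rpos_cap: "rpos \<triangleright> cap = rneg \<triangleright> cap"
proof -
  have "rpos \<triangleright> cap = (rneg \<triangleright> cap) \<^bold>+ scal z (rneg \<triangleright> cap \<triangleright> (cup \<triangleright> rneg \<triangleright> cap))"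
    unfolding rpos_eq by (simp add: distrib seq_scal_left seq_assoc)
  also have "\<dots> = (rneg \<triangleright> cap) \<^bold>+ scal z ((rneg \<triangleright> cap) \<triangleright> cl (Zer [] []))"
    by (simp only: isomeric_relation_classes(6) seq_assoc)
  also have "\<dots> = rneg \<triangleright> cap"
    by (simp only: seq_Zer_right[OF hom_rneg_cap_cup(1)] scal_Zer[OF z_closed] plus_zero[OF hom_rneg_cap_cup(1)])
  finally show ?thesis .
qed

lemma cup_rpos: "cup \<triangleright> rpos = cup \<triangleright> rneg"
proof -
  have "cup \<triangleright> rpos = (cup \<triangleright> rneg) \<^bold>+ scal z ((cup \<triangleright> rneg \<triangleright> cap) \<triangleright> cup \<triangleright> rneg)"
    unfolding rpos_eq by (simp add: distrib seq_scal_right seq_assoc)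
  also have "\<dots> = cup \<triangleright> rneg"
    by (simp only: isomeric_relation_classes(6) seq_Zer_left[OF hom_rneg_cap_cup(2)] scal_Zer[OF z_closed] plus_zero[OF hom_rneg_cap_cup(2)])
  finally show ?thesis .
qed

text \<open>By \<open>cup_rneg_l_cross_Neg\<close>, the correction term of r^+ followed by l^-
  equals r^- followed by the correction term between l^- and l^+. So the product equals that of r^-
  and l^+.\<close>

lemma rpos_l_cross_Neg: "rpos \<triangleright> l_cross Neg = cl (Idn [\<up>, \<down>])"
proof -
  have "rpos \<triangleright> l_cross Neg = (rneg \<triangleright> l_cross Neg) \<^bold>+ scal z (rneg \<triangleright> cap \<triangleright> cup)"
    unfolding rpos_eq by (simp add: distrib seq_scal_left seq_assoc cup_rneg_l_cross_Neg)
  also have "\<dots> = rneg \<triangleright> l_cross Pos"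
    unfolding l_cross_Pos_eq by (simp add: distrib seq_scal_right)
  finally show ?thesis
    by (simp add: isomeric_relation_classes(3))
qed

lemma l_cross_Neg_rneg_cap: "l_cross Neg \<triangleright> rneg \<triangleright> cap = cap"
proof -
  have h: "hom (l_cross Neg \<triangleright> rneg \<triangleright> cap) [\<down>, \<up>] []"
    by (rule hom_seq[OF homog_imp_hom[OF homog_l_cross] hom_rneg_cap_cup(1)])
  have "cap = (l_cross Pos \<triangleright> rneg) \<triangleright> cap"
    by (simp add: isomeric_relation_classes(4) seq_idn[OF even_seq(3)])
  also have "\<dots> = (l_cross Neg \<triangleright> rneg \<triangleright> cap) \<^bold>+ scal z (cap \<triangleright> (cup \<triangleright> rneg \<triangleright> cap))"
    unfolding l_cross_Pos_eq by (simp add: distrib seq_scal_left seq_assoc)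
  also have "\<dots> = l_cross Neg \<triangleright> rneg \<triangleright> cap"
    by (simp only: isomeric_relation_classes(6) seq_Zer_right[OF even_seq(3)] scal_Zer[OF z_closed] plus_zero[OF h])
  finally show ?thesis ..
qed

text \<open>Mirror image of the previous computation, with \<open>l_cross_Neg_rneg_cap\<close> for
  the cap in place of the identity for the cup.\<close>

lemma l_cross_Neg_rpos: "l_cross Neg \<triangleright> rpos = cl (Idn [\<down>, \<up>])"
proof -
  have "l_cross Neg \<triangleright> rpos = (l_cross Neg \<triangleright> rneg) \<^bold>+ scal z ((l_cross Neg \<triangleright> rneg \<triangleright> cap) \<triangleright> cup \<triangleright> rneg)"
    unfolding rpos_eq by (simp add: distrib seq_scal_right seq_assoc)
  also have "\<dots> = (l_cross Neg \<triangleright> rneg) \<^bold>+ scal z (cap \<triangleright> cup \<triangleright> rneg)"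
    unfolding l_cross_Neg_rneg_cap ..
  also have "\<dots> = l_cross Pos \<triangleright> rneg"
    unfolding l_cross_Pos_eq by (simp add: distrib seq_scal_left seq_assoc)
  finally show ?thesis
    by (simp add: isomeric_relation_classes(4))
qed

text \<open>Uniqueness of duals. After interchanging layers, \<open>b\<close> and \<open>a\<close>
  cancel in the middle by \<open>up\<close>, and \<open>b'\<close> and \<open>a'\<close> by
  \<open>down\<close>. One zigzag is taken from each pair, so exchanging the two pairs yields the
  other order of composition.\<close>

lemma comparison_inverse:
  assumes ev: "homog 0 a [\<down>, \<up>] []" "homog 0 b [] [\<up>, \<down>]" "homog 0 a' [\<down>, \<up>] []" "homog 0 b' [] [\<up>, \<down>]"
    and up: "whisker [] b [\<up>] \<triangleright> whisker [\<up>] a [] = cl (Idn [\<up>])"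
    and down: "whisker [\<down>] b' [] \<triangleright> whisker [] a' [\<down>] = cl (Idn [\<down>])"
  shows "(whisker [\<down>] b [] \<triangleright> whisker [] a' [\<down>]) \<triangleright> (whisker [\<down>] b' [] \<triangleright> whisker [] a [\<down>]) = cl (Idn [\<down>])"
proof -
  note c [simp] = ev[THEN is_cls_homog]
  have i: "whisker [] a' [\<down>] \<triangleright> whisker [\<down>] b' [] = whisker [\<down>, \<up>, \<down>] b' [] \<triangleright> whisker [] a' [\<down>, \<up>, \<down>]"
    "whisker [\<down>] b [] \<triangleright> whisker [\<down>, \<up>, \<down>] b' [] = whisker [\<down>] b' [] \<triangleright> whisker [\<down>] b [\<up>, \<down>]"
    "whisker [] a' [\<down>, \<up>, \<down>] \<triangleright> whisker [] a [\<down>] = whisker [\<down>, \<up>] a [\<down>] \<triangleright> whisker [] a' [\<down>]"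
    using whisker_interchange[OF ev(3,4), of "[]" "[\<down>]" "[]"] whisker_interchange[OF ev(2,4), of "[\<down>]" "[]" "[]"]
      whisker_interchange[OF ev(3,1), of "[]" "[]" "[\<down>]"] by simp_all
  have u: "whisker [\<down>] b [\<up>, \<down>] \<triangleright> whisker [\<down>, \<up>] a [\<down>] = cl (Idn [\<down>, \<up>, \<down>])"
    using arg_cong[OF up, of "\<lambda>f. whisker [\<down>] f [\<down>]"] by (simp add: whisker_seq)
  have "hom (whisker [] a' [\<down>]) [\<down>, \<up>, \<down>] [\<down>]"
    using hom_whisker[OF homog_imp_hom[OF ev(3)], of "[]" "[\<down>]"] by simp
  note idn = seq_idn(1)[OF this]
  show ?thesis
    by (simp only: seq_assoc seq_cong[OF i(1)] seq_cong[OF i(2)] i(3) seq_cong[OF u] idn down)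
qed

text \<open>Here \<alpha>, \<beta>, \<rho> stand for the images of cap_L, cup_L, r^- under a
  candidate functor. The assumption \<open>inv\<close> is the image of the relation that r^-
  followed by l^+ is the identity, with l^+ unfolded as a rotation of u^+; \<open>capr\<close>
  expresses that cap_R is preserved.\<close>

lemma adjunction_unique:
  assumes ev: "homog 0 \<alpha> [\<down>, \<up>] []" "homog 0 \<beta> [] [\<up>, \<down>]" "homog 0 \<rho> [\<up>, \<down>] [\<down>, \<up>]"
    and up: "whisker [] \<beta> [\<up>] \<triangleright> whisker [\<up>] \<alpha> [] = cl (Idn [\<up>])"
    and down: "whisker [\<down>] \<beta> [] \<triangleright> whisker [] \<alpha> [\<down>] = cl (Idn [\<down>])"
    and inv: "\<rho> \<triangleright> whisker [\<down>, \<up>] \<beta> [] \<triangleright> whisker [\<down>] (u_cross Neg) [\<down>] \<triangleright> whisker [] \<alpha> [\<up>, \<down>] = cl (Idn [\<up>, \<down>])"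
    and capr: "\<rho> \<triangleright> \<alpha> = rneg \<triangleright> cap"
  shows "\<alpha> = cap" "\<beta> = cup" "\<rho> = rpos"
proof -
  note c [simp] = ev[THEN is_cls_homog]
  note h = ev[THEN homog_imp_hom]
  define \<phi> where "\<phi> = whisker [\<down>] cup [] \<triangleright> whisker [] \<alpha> [\<down>]"
  define \<psi> where "\<psi> = whisker [\<down>] \<beta> [] \<triangleright> whisker [] cap [\<down>]"
  have ev': "homog 0 \<phi> [\<down>] [\<down>]" "homog 0 \<psi> [\<down>] [\<down>]"
    unfolding \<phi>_def \<psi>_def
    using homog_seq0[OF homog_whisker_even(4)[of "[\<down>]" "[]", simplified] homog_whisker[OF ev(1), of "[]" "[\<down>]", simplified]]
     homog_seq0[OF homog_whisker[OF ev(2), of "[\<down>]" "[]", simplified] homog_whisker_even(3)[of "[]" "[\<down>]", simplified]]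
    by simp_all
  note c' [simp] = ev'[THEN is_cls_homog]
  note hw = ev'[THEN homog_imp_hom, THEN hom_whisker]
  have \<psi>\<phi>: "\<psi> \<triangleright> \<phi> = cl (Idn [\<down>])"
    unfolding \<phi>_def \<psi>_def by (rule comparison_inverse[OF ev(1,2) even(3,4) up zigzag_down])
  have \<phi>\<psi>: "\<phi> \<triangleright> \<psi> = cl (Idn [\<down>])"
    unfolding \<phi>_def \<psi>_def by (rule comparison_inverse[OF even(3,4) ev(1,2) zigzag_up down])
  have \<alpha>: "whisker [] \<phi> [\<up>] \<triangleright> cap = \<alpha>"
  proof -
    have "whisker [] \<alpha> [\<down>, \<up>] \<triangleright> cap = whisker [\<down>, \<up>] cap [] \<triangleright> \<alpha>"
      using whisker_interchange[OF ev(1) even(3), of "[]" "[]" "[]"] by (simp add: whisker_Nil[OF h(1)] whisker_Nil[OF even_seq(3)])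
    moreover have "whisker [\<down>] cup [\<up>] \<triangleright> whisker [\<down>, \<up>] cap [] = cl (Idn [\<down>, \<up>])"
      using whisker_zigzag_up[of "[\<down>]" "[]"] by simp
    from seq_cong[OF this] have "whisker [\<down>] cup [\<up>] \<triangleright> whisker [\<down>, \<up>] cap [] \<triangleright> \<alpha> = \<alpha>"
      by (simp only: seq_idn(1)[OF h(1)])
    ultimately show ?thesis
      unfolding \<phi>_def by (simp add: whisker_seq seq_assoc)
  qed
  have \<beta>: "cup \<triangleright> whisker [\<up>] \<psi> [] = \<beta>"
  proof -
    have 1: "cup \<triangleright> whisker [\<up>, \<down>] \<beta> [] = \<beta> \<triangleright> whisker [] cup [\<up>, \<down>]"
      using whisker_interchange[OF even(4) ev(2), of "[]" "[]" "[]"] by (simp add: whisker_Nil[OF h(2)] whisker_Nil[OF even_seq(4)])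
    have 2: "whisker [] cup [\<up>, \<down>] \<triangleright> whisker [\<up>] cap [\<down>] = cl (Idn [\<up>, \<down>])"
      using whisker_zigzag_up[of "[]" "[\<down>]"] by simp
    show ?thesis
      unfolding \<psi>_def by (simp add: whisker_seq) (simp only: seq_cong[OF 1] seq_assoc 2 seq_idn[OF h(2)])
  qed
  \<comment> \<open>The rotation of u^- formed with \<alpha> and \<beta> is l^- transported along
    the comparison maps, since these turn the left cap and cup into \<alpha> and \<beta>.\<close>
  have LL: "whisker [] \<phi> [\<up>] \<triangleright> l_cross Neg \<triangleright> whisker [\<up>] \<psi> [] = whisker [\<down>, \<up>] \<beta> [] \<triangleright> whisker [\<down>] (u_cross Neg) [\<down>] \<triangleright> whisker [] \<alpha> [\<up>, \<down>]"
  proof -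
    have i: "whisker [] \<phi> [\<up>] \<triangleright> whisker [\<down>, \<up>] cup [] = whisker [\<down>, \<up>] cup [] \<triangleright> whisker [] \<phi> [\<up>, \<up>, \<down>]"
      "whisker [] \<phi> [\<up>, \<up>, \<down>] \<triangleright> whisker [\<down>] (u_cross Neg) [\<down>] = whisker [\<down>] (u_cross Neg) [\<down>] \<triangleright> whisker [] \<phi> [\<up>, \<up>, \<down>]"
      "whisker [] \<alpha> [\<up>, \<down>] \<triangleright> whisker [\<up>] \<psi> [] = whisker [\<down>, \<up>, \<up>] \<psi> [] \<triangleright> whisker [] \<alpha> [\<up>, \<down>]"
      "whisker [\<down>] (u_cross Neg) [\<down>] \<triangleright> whisker [\<down>, \<up>, \<up>] \<psi> [] = whisker [\<down>, \<up>, \<up>] \<psi> [] \<triangleright> whisker [\<down>] (u_cross Neg) [\<down>]"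
      using whisker_interchange[OF ev'(1) even(4), of "[]" "[\<up>]" "[]"] whisker_interchange[OF ev'(1) even(1)[of Neg], of "[]" "[]" "[\<down>]"]
        whisker_interchange[OF ev(1) ev'(2), of "[]" "[\<up>]" "[]"] whisker_interchange[OF even(1)[of Neg] ev'(2), of "[\<down>]" "[]" "[]"]
      by simp_all
    have j: "whisker [] \<phi> [\<up>, \<up>, \<down>] \<triangleright> whisker [] cap [\<up>, \<down>] = whisker [] \<alpha> [\<up>, \<down>]"
      "whisker [\<down>, \<up>] cup [] \<triangleright> whisker [\<down>, \<up>, \<up>] \<psi> [] = whisker [\<down>, \<up>] \<beta> []"
      using arg_cong[OF \<alpha>, of "\<lambda>f. whisker [] f [\<up>, \<down>]"] arg_cong[OF \<beta>, of "\<lambda>f. whisker [\<down>, \<up>] f []"]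
      by (simp_all add: whisker_seq)
    show ?thesis
      unfolding l_cross_eq_rho rho_def
      by (simp add: seq_assoc) (simp only: seq_assoc seq_cong[OF i(1)] seq_cong[OF i(2)] seq_cong[OF j(1)] i(3) seq_cong[OF i(4)] seq_cong[OF j(2)])
  qed
  have w: "whisker A \<phi> B \<triangleright> whisker A \<psi> B = cl (Idn (A @ [\<down>] @ B))" "whisker A \<psi> B \<triangleright> whisker A \<phi> B = cl (Idn (A @ [\<down>] @ B))" for A B
    using whisker_inverse[OF c'(1,2) \<phi>\<psi>] whisker_inverse[OF c'(2,1) \<psi>\<phi>] by simp_all
  have hQ: "hom (rpos \<triangleright> whisker [] \<psi> [\<up>]) [\<up>, \<down>] [\<down>, \<up>]"
    using hom_seq[OF homog_imp_hom[OF homog_rpos] hw(2)[of "[]" "[\<up>]", simplified]] by simp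
  have "(whisker [] \<phi> [\<up>] \<triangleright> l_cross Neg \<triangleright> whisker [\<up>] \<psi> []) \<triangleright> (whisker [\<up>] \<phi> [] \<triangleright> rpos \<triangleright> whisker [] \<psi> [\<up>])
    = whisker [] \<phi> [\<up>] \<triangleright> l_cross Neg \<triangleright> (whisker [\<up>] \<psi> [] \<triangleright> whisker [\<up>] \<phi> []) \<triangleright> rpos \<triangleright> whisker [] \<psi> [\<up>]"
    by (simp add: seq_assoc)
  also have "\<dots> = whisker [] \<phi> [\<up>] \<triangleright> (l_cross Neg \<triangleright> rpos) \<triangleright> whisker [] \<psi> [\<up>]"
    by (simp add: w seq_idn[OF hQ] seq_assoc)
  also have "\<dots> = cl (Idn [\<down>, \<up>])"
    unfolding l_cross_Neg_rpos using hw(2)[of "[]" "[\<up>]"] by (simp add: w seq_idn)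
  finally have LQ: "(whisker [\<down>, \<up>] \<beta> [] \<triangleright> whisker [\<down>] (u_cross Neg) [\<down>] \<triangleright> whisker [] \<alpha> [\<up>, \<down>]) \<triangleright> (whisker [\<up>] \<phi> [] \<triangleright> rpos \<triangleright> whisker [] \<psi> [\<up>]) = cl (Idn [\<down>, \<up>])"
    unfolding LL .
  have "hom (whisker [\<up>] \<phi> [] \<triangleright> rpos \<triangleright> whisker [] \<psi> [\<up>]) [\<up>, \<down>] [\<down>, \<up>]"
    using hom_seq[OF hw(1)[of "[\<up>]" "[]", simplified] hQ] by simp
  note Q = seq_idn(1)[OF this]
  \<comment> \<open>By \<open>inv\<close> and \<open>LQ\<close>, \<rho> and the transported r^+ are
    inverses of the same morphism on opposite sides, hence equal.\<close>
  have "\<rho> = \<rho> \<triangleright> cl (Idn [\<down>, \<up>])"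
    by (simp add: seq_idn[OF h(3)])
  also have "\<dots> = (\<rho> \<triangleright> whisker [\<down>, \<up>] \<beta> [] \<triangleright> whisker [\<down>] (u_cross Neg) [\<down>] \<triangleright> whisker [] \<alpha> [\<up>, \<down>]) \<triangleright> (whisker [\<up>] \<phi> [] \<triangleright> rpos \<triangleright> whisker [] \<psi> [\<up>])"
    unfolding LQ[symmetric] by (simp only: seq_assoc)
  finally have \<rho>: "\<rho> = whisker [\<up>] \<phi> [] \<triangleright> rpos \<triangleright> whisker [] \<psi> [\<up>]"
    unfolding inv Q .
  have "rneg \<triangleright> cap = whisker [\<up>] \<phi> [] \<triangleright> rpos \<triangleright> (whisker [] \<psi> [\<up>] \<triangleright> whisker [] \<phi> [\<up>]) \<triangleright> cap"
    unfolding capr[symmetric] \<rho> by (simp only: seq_assoc \<alpha>)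
  also have "\<dots> = whisker [\<up>] \<phi> [] \<triangleright> rneg \<triangleright> cap"
    by (simp add: w seq_idn[OF even_seq(3)] rpos_cap)
  finally have capr': "whisker [\<up>] \<phi> [] \<triangleright> rneg \<triangleright> cap = rneg \<triangleright> cap" ..
  have \<phi>: "\<phi> = cl (Idn [\<down>])"
  proof -
    \<comment> \<open>To isolate \<phi>, a right zigzag is placed after it: \<phi> slides along the
      strand into the right cap, where \<open>capr'\<close> absorbs it.\<close>
    have 1: "whisker [] (cup \<triangleright> rneg) [\<down>] \<triangleright> whisker [\<down>, \<up>] \<phi> [] = \<phi> \<triangleright> whisker [] (cup \<triangleright> rneg) [\<down>]"
      using whisker_interchange[OF homog_cupr ev'(1), of "[]" "[]" "[]"] by (simp add: whisker_Nil[OF homog_imp_hom[OF ev'(1)]])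
    have 2: "whisker [\<down>, \<up>] \<phi> [] \<triangleright> whisker [\<down>] (rneg \<triangleright> cap) [] = whisker [\<down>] (rneg \<triangleright> cap) []"
      using arg_cong[OF capr', of "\<lambda>f. whisker [\<down>] f []"] by (simp add: whisker_seq)
    have "\<phi> = \<phi> \<triangleright> whisker [] (cup \<triangleright> rneg) [\<down>] \<triangleright> whisker [\<down>] (rneg \<triangleright> cap) []"
      unfolding zigzag_right by (simp add: seq_idn[OF homog_imp_hom[OF ev'(1)]])
    also have "\<dots> = whisker [] (cup \<triangleright> rneg) [\<down>] \<triangleright> whisker [\<down>] (rneg \<triangleright> cap) []"
      unfolding seq_cong[OF 1[symmetric]] by (simp only: seq_assoc 2)
    finally show ?thesis
      unfolding zigzag_right .
  qed
  then have \<psi>: "\<psi> = cl (Idn [\<down>])"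
    using \<phi>\<psi> seq_idn(1)[OF homog_imp_hom[OF ev'(2)]] by simp
  show "\<alpha> = cap"
    using \<alpha> unfolding \<phi> by (simp add: seq_idn[OF even_seq(3)])
  show "\<beta> = cup"
    using \<beta> unfolding \<psi> by (simp add: seq_idn[OF even_seq(4)])
  show "\<rho> = rpos"
    using \<rho> homog_imp_hom[OF homog_rpos] unfolding \<phi> \<psi> by (simp add: seq_idn)
qed

end

text \<open>The argument \<open>z\<close> is the parameter of the target category; it enters through
  r^+, the image of r^-. The generators themselves do not depend on the parameter.\<close>

fun flip_gen :: "'k \<Rightarrow> gen \<Rightarrow> 'k iterm" where
  "flip_gen z Gen_u_plus = cross_u Neg"
| "flip_gen z Gen_u_minus = cross_u Pos"
| "flip_gen z Gen_r_minus = cross_r z Pos"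
| "flip_gen z Gen_capL = capL"
| "flip_gen z Gen_cupL = cupL"
| "flip_gen z Gen_c = tok_o"
| "flip_gen z Gen_o = tok_c"

text \<open>The crossings l and d are rotations of u formed with the left cup and cap, which the
  substitution fixes, so the flip of u passes to them already at the level of terms. For r this is
  true only up to the relations.\<close>

lemma subst_flip_cross [simp]:
  "subst_gen (flip_gen z) (cross_u e) = cross_u (flip_sign e)"
  "subst_gen (flip_gen z) (rot a t) = rot a (subst_gen (flip_gen z) t)"
  "subst_gen (flip_gen z) (cross_l e) = cross_l (flip_sign e)"
  "subst_gen (flip_gen z) (cross_d e) = cross_d (flip_sign e)"
proof -
  show u: "subst_gen (flip_gen z) (cross_u e) = cross_u (flip_sign e)" for e
    by (cases e) simp_all
  show rot: "subst_gen (flip_gen z) (rot a t) = rot a (subst_gen (flip_gen z) t)" for a t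
    by (simp add: rot_def)
  show l: "subst_gen (flip_gen z) (cross_l e) = cross_l (flip_sign e)" for e
    by (simp add: cross_l_def rot u)
  show "subst_gen (flip_gen z) (cross_d e) = cross_d (flip_sign e)"
    by (simp add: cross_d_def rot l)
qed

section \<open>The defining relations under the flip\<close>

context affine_isomeric
begin

definition token_c :: "'k iterm set" where "token_c = cl tok_c"
definition token_o :: "'k iterm set" where "token_o = cl tok_o"

lemma homog_tokens: "homog 1 token_c [\<up>] [\<up>]" "homog 1 token_o [\<up>] [\<up>]"
  using homog_gen[of Gen_c] homog_gen[of Gen_o] by (simp_all add: token_c_def token_o_def gen_parity_def)

lemmas hom_tokens = homog_tokens[THEN homog_imp_hom]
lemmas is_cls_tokens [simp] = homog_tokens[THEN is_cls_homog]

lemmas hom_gens = even_seq(1)[of Pos] even_seq(1)[of Neg] even_seq(2-4) hom_tokens homog_imp_hom[OF homog_l_cross]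

lemma class_defs:
  "cl (Gen Gen_u_plus) = u_cross Pos" "cl (Gen Gen_u_minus) = u_cross Neg" "cl (Gen Gen_r_minus) = rneg"
  "cl capL = cap" "cl cupL = cup" "cl tok_c = token_c" "cl tok_o = token_o" "cl (cross_l e) = l_cross e"
  "cl (cross_r z Pos) = rpos"
  by (simp_all add: u_cross_def rneg_def cap_def cup_def token_c_def token_o_def l_cross_def rpos_def)

lemmas tn_gen_eq_whisker = hom_gens[THEN tn_Idn_eq_whisker(1)] hom_gens[THEN tn_Idn_eq_whisker(2)]

lemma token_relation_classes:
  "token_c \<triangleright> token_c = scal (\<ominus> \<one>) (cl (Idn [\<up>]))"
  "token_o \<triangleright> token_o = scal (\<ominus> \<one>) (cl (Idn [\<up>]))"
  "whisker [] token_c [\<up>] \<triangleright> u_cross Pos = u_cross Pos \<triangleright> whisker [\<up>] token_c []"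
  "whisker [\<up>] token_o [] \<triangleright> u_cross Pos = u_cross Pos \<triangleright> whisker [] token_o [\<up>]"
  "cup \<triangleright> whisker [] token_c [\<down>] \<triangleright> rneg \<triangleright> cap = cl (Zer [] [])"
  "cup \<triangleright> whisker [] token_o [\<down>] \<triangleright> rneg \<triangleright> cap = cl (Zer [] [])"
proof -
  have w: "hom (whisker [] f [a]) [\<up>, a] [\<up>, a]" "hom (whisker [a] f []) [a, \<up>] [a, \<up>]" if "hom f [\<up>] [\<up>]" for f a
    using hom_whisker[OF that, of "[]" "[a]"] hom_whisker[OF that, of "[a]" "[]"] by simp_all
  note hs = hom_tokens[THEN w(1)] hom_tokens[THEN w(2)]
  note rules = class_defs tn_gen_eq_whisker isomeric_relations_def affine_relations_def Let_def capR_def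
  have "cl (tok_c \<bullet> tok_c) = cl (Scl (\<ominus> \<one>) (Idn [\<up>]))"
    by (rule rel_imp_eq[of _ _ "[\<up>]" "[\<up>]"]) (simp_all add: rules hom_seq[OF hom_tokens(1) hom_tokens(1)] flip: cl_seq cl_scal)
  then show "token_c \<triangleright> token_c = scal (\<ominus> \<one>) (cl (Idn [\<up>]))"
    by (simp add: class_defs flip: cl_seq cl_scal)
  have "cl (tok_o \<bullet> tok_o) = cl (Scl (\<ominus> \<one>) (Idn [\<up>]))"
    by (rule rel_imp_eq[of _ _ "[\<up>]" "[\<up>]"]) (simp_all add: rules hom_seq[OF hom_tokens(2) hom_tokens(2)] flip: cl_seq cl_scal)
  then show "token_o \<triangleright> token_o = scal (\<ominus> \<one>) (cl (Idn [\<up>]))"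
    by (simp add: class_defs flip: cl_seq cl_scal)
  have "cl (cross_u Pos \<bullet> (tok_c \<boxtimes> Idn [\<up>])) = cl ((Idn [\<up>] \<boxtimes> tok_c) \<bullet> cross_u Pos)"
    by (rule rel_imp_eq[of _ _ "[\<up>, \<up>]" "[\<up>, \<up>]"])
      (simp_all add: rules hom_seq[OF hs(1) even_seq(1)] hom_seq[OF even_seq(1) hs(3)] flip: cl_seq cl_tn)
  then show "whisker [] token_c [\<up>] \<triangleright> u_cross Pos = u_cross Pos \<triangleright> whisker [\<up>] token_c []"
    by (simp add: class_defs tn_gen_eq_whisker flip: cl_seq cl_tn)
  have "cl (cross_u Pos \<bullet> (Idn [\<up>] \<boxtimes> tok_o)) = cl ((tok_o \<boxtimes> Idn [\<up>]) \<bullet> cross_u Pos)"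
    by (rule rel_imp_eq[of _ _ "[\<up>, \<up>]" "[\<up>, \<up>]"])
      (simp_all add: rules hom_seq[OF hs(4) even_seq(1)] hom_seq[OF even_seq(1) hs(2)] flip: cl_seq cl_tn)
  then show "whisker [\<up>] token_o [] \<triangleright> u_cross Pos = u_cross Pos \<triangleright> whisker [] token_o [\<up>]"
    by (simp add: class_defs tn_gen_eq_whisker flip: cl_seq cl_tn)
  have "cl (capR \<bullet> (tok_c \<boxtimes> Idn [\<down>]) \<bullet> cupL) = cl (Zer [] [])"
    by (rule rel_imp_eq[of _ _ "[]" "[]"])
      (simp_all add: rules hom_seq[OF even_seq(4) hom_seq[OF hs(1) hom_rneg_cap_cup(1)]] flip: cl_seq cl_tn)
  then show "cup \<triangleright> whisker [] token_c [\<down>] \<triangleright> rneg \<triangleright> cap = cl (Zer [] [])"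
    by (simp add: class_defs tn_gen_eq_whisker capR_def flip: cl_seq cl_tn)
  have "cl (capR \<bullet> (tok_o \<boxtimes> Idn [\<down>]) \<bullet> cupL) = cl (Zer [] [])"
    by (rule rel_imp_eq[of _ _ "[]" "[]"])
      (simp_all add: rules hom_seq[OF even_seq(4) hom_seq[OF hs(2) hom_rneg_cap_cup(1)]] flip: cl_seq cl_tn)
  then show "cup \<triangleright> whisker [] token_o [\<down>] \<triangleright> rneg \<triangleright> cap = cl (Zer [] [])"
    by (simp add: class_defs tn_gen_eq_whisker capR_def flip: cl_seq cl_tn)
qed

text \<open>Conjugation by u^-. The flip sends the sliding relation of one token to that of the
  other token with u^- for u^+, and this is the inverted form of a known relation.\<close>

lemma slide_inverse:
  assumes f: "hom f [\<up>, \<up>] [\<up>, \<up>]" and g: "hom g [\<up>, \<up>] [\<up>, \<up>]" and eq: "f \<triangleright> u_cross Pos = u_cross Pos \<triangleright> g"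
  shows "g \<triangleright> u_cross Neg = u_cross Neg \<triangleright> f"
proof -
  have "u_cross Neg \<triangleright> f = u_cross Neg \<triangleright> (f \<triangleright> u_cross Pos) \<triangleright> u_cross Neg"
    by (simp add: seq_assoc isomeric_relation_classes(1) seq_idn[OF f])
  also have "\<dots> = (u_cross Neg \<triangleright> u_cross Pos) \<triangleright> g \<triangleright> u_cross Neg"
    unfolding eq by (simp only: seq_assoc)
  also have "\<dots> = g \<triangleright> u_cross Neg"
    by (simp only: isomeric_relation_classes(2) seq_idn(1)[OF hom_seq[OF g even_seq(1)]])
  finally show ?thesis ..
qed

lemma tokens_u_cross_Neg:
  "whisker [\<up>] token_c [] \<triangleright> u_cross Neg = u_cross Neg \<triangleright> whisker [] token_c [\<up>]"
  "whisker [] token_o [\<up>] \<triangleright> u_cross Neg = u_cross Neg \<triangleright> whisker [\<up>] token_o []"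
  using slide_inverse[OF _ _ token_relation_classes(3)] slide_inverse[OF _ _ token_relation_classes(4)]
    hom_tokens[THEN hom_whisker, of "[]" "[\<up>]"] hom_tokens[THEN hom_whisker, of "[\<up>]" "[]"] by simp_all

text \<open>Both sides are the inverses of the two sides of \<open>braid\<close>. They are
  identified by placing one side of \<open>braid\<close> between them, which cancels to the right,
  and its other side, which cancels to the left.\<close>

lemma braid_Neg:
  "whisker [] (u_cross Neg) [\<up>] \<triangleright> whisker [\<up>] (u_cross Neg) [] \<triangleright> whisker [] (u_cross Neg) [\<up>]
    = whisker [\<up>] (u_cross Neg) [] \<triangleright> whisker [] (u_cross Neg) [\<up>] \<triangleright> whisker [\<up>] (u_cross Neg) []"
proof -
  define u1 u2 v1 v2 where uv: "u1 = whisker [] (u_cross Pos) [\<up>]" "u2 = whisker [\<up>] (u_cross Pos) []"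
    "v1 = whisker [] (u_cross Neg) [\<up>]" "v2 = whisker [\<up>] (u_cross Neg) []"
  have h: "hom v1 [\<up>, \<up>, \<up>] [\<up>, \<up>, \<up>]" "hom v2 [\<up>, \<up>, \<up>] [\<up>, \<up>, \<up>]"
    using hom_whisker_even(1)[of "[]" Neg "[\<up>]"] hom_whisker_even(1)[of "[\<up>]" Neg "[]"] by (simp_all add: uv)
  have i: "u1 \<triangleright> v1 = cl (Idn [\<up>, \<up>, \<up>])" "v1 \<triangleright> u1 = cl (Idn [\<up>, \<up>, \<up>])"
    "u2 \<triangleright> v2 = cl (Idn [\<up>, \<up>, \<up>])" "v2 \<triangleright> u2 = cl (Idn [\<up>, \<up>, \<up>])"
    unfolding uv by (simp_all add: whisker_inverse[OF _ _ isomeric_relation_classes(1)] whisker_inverse[OF _ _ isomeric_relation_classes(2)])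
  have s: "cl (Idn [\<up>, \<up>, \<up>]) \<triangleright> v1 \<triangleright> k = v1 \<triangleright> k" "cl (Idn [\<up>, \<up>, \<up>]) \<triangleright> v2 \<triangleright> k = v2 \<triangleright> k" for k
    using seq_cong[OF seq_idn(1)[OF h(1)]] seq_cong[OF seq_idn(1)[OF h(2)]] by simp_all
  have "v1 \<triangleright> v2 \<triangleright> v1 = v1 \<triangleright> v2 \<triangleright> v1 \<triangleright> (u2 \<triangleright> u1 \<triangleright> u2) \<triangleright> v2 \<triangleright> v1 \<triangleright> v2"
    by (simp add: seq_assoc i i[THEN seq_cong] s seq_idn[OF h(1)] seq_idn[OF h(2)])
  also have "\<dots> = v1 \<triangleright> v2 \<triangleright> v1 \<triangleright> (u1 \<triangleright> u2 \<triangleright> u1) \<triangleright> v2 \<triangleright> v1 \<triangleright> v2"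
    using braid by (simp add: uv)
  also have "\<dots> = v2 \<triangleright> v1 \<triangleright> v2"
  proof -
    have "hom (v2 \<triangleright> v1 \<triangleright> v2) [\<up>, \<up>, \<up>] [\<up>, \<up>, \<up>]" "hom u1 [\<up>, \<up>, \<up>] [\<up>, \<up>, \<up>]" "hom u2 [\<up>, \<up>, \<up>] [\<up>, \<up>, \<up>]"
      using h hom_whisker_even(1)[of "[]" Pos "[\<up>]"] hom_whisker_even(1)[of "[\<up>]" Pos "[]"] by (auto simp: uv intro: hom_seq)
    then show ?thesis
      by (simp add: seq_assoc i i[THEN seq_cong] seq_idn seq_cong[OF seq_idn(1)])
  qed
  finally show ?thesis by (simp add: uv)
qed

text \<open>The skein relation times \<open>\<ominus> \<one>\<close>: exchanging u^+ and u^- changes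
  the sign of the parameter, which is why the flip relates z and its negative.\<close>

lemma skein_Neg: "u_cross Neg \<^bold>+ scal (\<ominus> \<one>) (u_cross Pos) = scal (\<ominus> z) (cl (Idn [\<up>, \<up>]))"
proof -
  have "scal (\<ominus> \<one>) (scal z (cl (Idn [\<up>, \<up>]))) = scal (\<ominus> \<one>) (u_cross Pos) \<^bold>+ scal (\<ominus> \<one>) (scal (\<ominus> \<one>) (u_cross Neg))"
    unfolding isomeric_relation_classes(5)[symmetric] by (simp add: scal_plus)
  also have "scal (\<ominus> \<one>) (scal (\<ominus> \<one>) (u_cross Neg)) = u_cross Neg"
    by (simp add: scal_mult[symmetric, OF _ _ even_seq(1)] l_minus r_minus scal_one[OF even_seq(1)])
  also have "scal (\<ominus> \<one>) (scal z (cl (Idn [\<up>, \<up>]))) = scal (\<ominus> z) (cl (Idn [\<up>, \<up>]))"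
    by (simp add: scal_mult[symmetric, OF _ _ hom_intros(1)] l_minus)
  finally show ?thesis by (simp add: plus_comm)
qed

lemma flip_relation:
  assumes "(s, t) \<in> relations (AQ_presentation R (\<ominus> z))"
  shows "cl (subst_gen (flip_gen z) s) = cl (subst_gen (flip_gen z) t)"
proof -
  \<comment> \<open>The bubble relations contain cap_R, whose defining r^- is sent to r^+;
    \<open>rpos_cap\<close> turns this back into r^-.\<close>
  have b: "cup \<triangleright> whisker [] token_c [\<down>] \<triangleright> rpos \<triangleright> cap = cl (Zer [] [])" "cup \<triangleright> whisker [] token_o [\<down>] \<triangleright> rpos \<triangleright> cap = cl (Zer [] [])"
     "cup \<triangleright> rpos \<triangleright> cap = cl (Zer [] [])"
    unfolding rpos_cap by (rule token_relation_classes isomeric_relation_classes)+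
  note defs = class_defs cross_r.simps(2) isomeric_relation_classes rpos_l_cross_Neg l_cross_Neg_rpos token_relation_classes(1,2) tokens_u_cross_Neg braid_Neg skein_Neg b
     zigzag_up zigzag_down tn_gen_eq_whisker
  have "(s, t) \<in> isomeric_relations R (\<ominus> z) \<union> affine_relations R"
    using assms by (simp add: AQ_presentation_def)
  then show ?thesis
    unfolding isomeric_relations_def affine_relations_def Let_def
    by (elim UnE insertE emptyE Pair_inject; hypsubst;
        simp add: capR_def defs del: cross_r.simps(1) flip: cl_seq cl_tn cl_plus cl_scal)
qed

lemma affine_isomeric_minus: "affine_isomeric R (\<ominus> z)"
  by unfold_locales simp

lemma flip_morphism:
  "presentation_morphism R (AQ_presentation R (\<ominus> z)) (AQ_presentation R z) (flip_gen z)"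
proof -
  interpret neg: affine_isomeric R "\<ominus> z" by (rule affine_isomeric_minus)
  have img: "typed R (AQ_presentation R z) (flip_gen z g) (gen_source g) (gen_target g)"
    "has_parity (AQ_presentation R z) (flip_gen z g) (gen_parity g)" for g
  proof -
    have "hom (cl (flip_gen z g)) (gen_source g) (gen_target g)"
      by (cases g) (use hom_gens homog_imp_hom[OF homog_rpos] in \<open>simp_all add: class_defs del: cross_r.simps\<close>)
    then show "typed R (AQ_presentation R z) (flip_gen z g) (gen_source g) (gen_target g)"
      by (simp only: hom_cl_iff)
    have "homogeneous (AQ_presentation R z) (flip_gen z g) \<and> parity_of (AQ_presentation R z) (flip_gen z g) = gen_parity g"
      by (cases g) (simp_all add: AQ_presentation_def gen_parity_def capR_def cupR_def)
    then show "has_parity (AQ_presentation R z) (flip_gen z g) (gen_parity g)"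
      using has_parity_parity_of by metis
  qed
  show ?thesis
  proof unfold_locales
    fix g
    show "typed R (AQ_presentation R z) (flip_gen z g) (source (AQ_presentation R (\<ominus> z)) g) (target (AQ_presentation R (\<ominus> z)) g)"
      using img(1)[of g] unfolding AQ_presentation_def by simp
    show "has_parity (AQ_presentation R z) (flip_gen z g) (parity (AQ_presentation R (\<ominus> z)) g)"
      using img(2)[of g] unfolding AQ_presentation_def by simp
  qed (rule flip_relation)
qed

text \<open>The only generator that needs an argument is r^-. Its first image is r^+ with parameter
  -z; since the flip fixes cup_R and cap_R, the second image is r^+ minus z cup_R cap_R, which is
  r^-.\<close>

lemma flip_flip_gen: "cl (subst_gen (flip_gen z) (flip_gen (\<ominus> z) g)) = cl (Gen g)"
proof (cases "g = Gen_r_minus")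
  case True
  let ?X = "rneg \<triangleright> cap \<triangleright> cup \<triangleright> rneg"
  have X: "rpos \<triangleright> cap \<triangleright> cup \<triangleright> rpos = ?X"
    using rpos_cap by (simp only: cup_rpos seq_assoc[symmetric])
  have "cl (subst_gen (flip_gen z) (cross_r (\<ominus> z) Pos)) = rpos \<^bold>+ scal (\<ominus> z) (rpos \<triangleright> cap \<triangleright> cup \<triangleright> rpos)"
    by (simp add: cupR_def capR_def class_defs seq_assoc cross_r.simps(1)[of "\<ominus> z"] del: cross_r.simps flip: cl_seq cl_plus cl_scal)
  also have "\<dots> = rneg \<^bold>+ (scal z ?X \<^bold>+ scal (\<ominus> z) ?X)"
    unfolding X unfolding rpos_eq by (rule plus_assoc)
  also have "scal z ?X \<^bold>+ scal (\<ominus> z) ?X = scal (z \<oplus> \<ominus> z) ?X"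
    by (rule scal_add_left[symmetric, OF _ _ hom_rneg_cap_cup(3)]) simp_all
  also have "rneg \<^bold>+ \<dots> = rneg"
    by (simp add: r_neg scal_zero[OF hom_rneg_cap_cup(3)] plus_zero[OF even_seq(3)] plus_zero[OF even_seq(2)])
  finally show ?thesis
    using True by (simp add: rneg_def del: cross_r.simps)
next
  case False
  then show ?thesis by (cases g) simp_all
qed

text \<open>This is the functor from parameter -z to parameter z. In this direction the ambient
  calculus is that of the target, where the relations have to be verified; the opposite direction is
  the instance at -z.\<close>

abbreviation "flip_mor \<equiv> presentation_morphism.induced R (AQ_presentation R z) (flip_gen z)"

lemma flip_mor_cls:
  assumes "typed R (AQ_presentation R (\<ominus> z)) t X Y"
  shows "flip_mor (cls R (AQ_presentation R (\<ominus> z)) t) = cl (subst_gen (flip_gen z) t)"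
  by (rule presentation_morphism.induced_cls[OF flip_morphism assms])

text \<open>The laws of a superfunctor apply only to elements of morphism spaces, so the induction
  over diagrams has to know where each diagram lives.\<close>

lemma hom_diagram: "diagram_typed d X Y \<Longrightarrow> hom (diagram_mor R z d) X Y"
proof (induction rule: diagram_typed.induct)
  case (1 X) show ?case by (simp add: AQ_def)
next
  case (2 e) show ?case using even_seq(1)[of e] by (simp add: AQ_mor_def u_cross_def)
next
  case (3 e) show ?case
    using homog_imp_hom[OF homog_rpos] even_seq(2) by (cases e) (simp_all add: AQ_mor_def class_defs del: cross_r.simps(1))
next
  case (4 e) show ?case using homog_imp_hom[OF homog_d_cross[of e]] by (simp add: AQ_mor_def d_cross_def)
next
  case (5 e) show ?case using homog_imp_hom[OF homog_l_cross[of e]] by (simp add: AQ_mor_def l_cross_def)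
next
  case 6 show ?case using even_seq(4) by (simp add: AQ_mor_def cup_def)
next
  case 7 show ?case using hom_rneg_cap_cup(2) by (simp add: AQ_mor_def cupR_def class_defs flip: cl_seq)
next
  case 8 show ?case using even_seq(3) by (simp add: AQ_mor_def cap_def)
next
  case 9 show ?case using hom_rneg_cap_cup(1) by (simp add: AQ_mor_def capR_def class_defs flip: cl_seq)
next
  case 10 show ?case using hom_tokens(1) by (simp add: AQ_mor_def token_c_def)
next
  case 11 show ?case using hom_tokens(2) by (simp add: AQ_mor_def token_o_def)
next
  case (12 e Y Z d X)
  then show ?case by (simp add: AQ_def hom_seq)
next
  case (13 d X Y e X' Y')
  then show ?case by (simp add: AQ_def)
qed

lemma flip_mor_monoidal: "monoidal_superfunctor R (AQ R (\<ominus> z)) (AQ R z) id flip_mor"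
  unfolding AQ_def by (rule presentation_morphism.monoidal_superfunctor_induced[OF flip_morphism])

lemma flip_mor_diagram:
  assumes "diagram_typed d X Y"
  shows "flip_mor (diagram_mor R (\<ominus> z) d) = diagram_mor R z (flip d)"
proof -
  interpret neg: affine_isomeric R "\<ominus> z" by (rule affine_isomeric_minus)
  interpret M: presentation_morphism R "AQ_presentation R (\<ominus> z)" "AQ_presentation R z" "flip_gen z" by (rule flip_morphism)
  interpret FF: monoidal_superfunctor R "AQ R (\<ominus> z)" "AQ R z" id flip_mor by (rule flip_mor_monoidal)
  have leaf: "flip_mor (cls R (AQ_presentation R (\<ominus> z)) t) = cl (subst_gen (flip_gen z) t)"
    if "diagram_typed d X Y" "diagram_mor R (\<ominus> z) d = cls R (AQ_presentation R (\<ominus> z)) t" for d t X Y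
    using neg.hom_diagram[OF that(1)] unfolding that(2) neg.hom_cl_iff by (rule flip_mor_cls)
  show ?thesis
    using assms
  proof (induction rule: diagram_typed.induct)
    case (1 X)
    show ?case using FF.map_ident[of X] by (simp add: AQ_def)
  next
    case (2 e) show ?case
      using leaf[OF diagram_typed.intros(2)[of e]] by (simp add: AQ_mor_def)
  next
    \<comment> \<open>A negative crossing is sent to a positive one by definition of
      \<open>flip_gen\<close>. The converse is the involutivity of the flip on r^-.\<close>
    case (3 e)
    have "flip_mor (cls R (AQ_presentation R (\<ominus> z)) (cross_r (\<ominus> z) e)) = cl (subst_gen (flip_gen z) (cross_r (\<ominus> z) e))"
      using leaf[OF diagram_typed.intros(3)[of e]] by (simp add: AQ_mor_def)
    also have "\<dots> = cl (cross_r z (flip_sign e))"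
      using flip_flip_gen[of Gen_r_minus] by (cases e) (simp_all del: cross_r.simps(1))
    finally show ?case by (simp add: AQ_mor_def)
  next
    case (4 e) show ?case
      using leaf[OF diagram_typed.intros(4)[of e]] by (simp add: AQ_mor_def)
  next
    case (5 e) show ?case
      using leaf[OF diagram_typed.intros(5)[of e]] by (simp add: AQ_mor_def)
  next
    case 6 show ?case using leaf[OF diagram_typed.intros(6)] by (simp add: AQ_mor_def)
  next
    case 7
    \<comment> \<open>The substitution produces the right cup built with r^+, which is the same
      morphism as the one built with r^-.\<close>
    have "cl (cross_r z Pos \<bullet> cupL) = cl cupR"
      using cup_rpos by (simp add: cupR_def class_defs del: cross_r.simps flip: cl_seq)
    then show ?case using leaf[OF diagram_typed.intros(7)] by (simp add: AQ_mor_def cupR_def del: cross_r.simps)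
  next
    case 8 show ?case using leaf[OF diagram_typed.intros(8)] by (simp add: AQ_mor_def)
  next
    case 9
    have "cl (capL \<bullet> cross_r z Pos) = cl capR"
      using rpos_cap by (simp add: capR_def class_defs del: cross_r.simps flip: cl_seq)
    then show ?case using leaf[OF diagram_typed.intros(9)] by (simp add: AQ_mor_def capR_def del: cross_r.simps)
  next
    case 10 show ?case using leaf[OF diagram_typed.intros(10)] by (simp add: AQ_mor_def)
  next
    case 11 show ?case using leaf[OF diagram_typed.intros(11)] by (simp add: AQ_mor_def)
  next
    case (12 e Y Z d X)
    then show ?case
      using FF.map_cmp[of X Y Z] neg.hom_diagram[of e Y Z] neg.hom_diagram[of d X Y]
      by (simp add: AQ_def neg.hom_iff_carrier del: neg.presented_hom_simps(4))
  next
    case (13 d X Y e X' Y')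
    then show ?case
      using FF.map_tens[of X Y X' Y'] neg.hom_diagram[of d X Y] neg.hom_diagram[of e X' Y']
      by (simp add: AQ_def neg.hom_iff_carrier del: neg.presented_hom_simps(4))
  qed
qed

lemma flip_mor_flips_generators: "flips_generators R (\<ominus> z) id flip_mor"
  unfolding flips_generators_def minus_minus[OF z_closed]
  using flip_mor_diagram[OF diagram_typed.intros(10)] flip_mor_diagram[OF diagram_typed.intros(11)]
    flip_mor_diagram[OF diagram_typed.intros(2)[of Pos]] flip_mor_diagram[OF diagram_typed.intros(2)[of Neg]]
    flip_mor_diagram[OF diagram_typed.intros(9)] flip_mor_diagram[OF diagram_typed.intros(7)]
  by simp

text \<open>The composite is a double substitution that fixes every generator up to the relations.
  Only this composite is treated; the other one is the instance at -z.\<close>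

lemma flip_mor_inverse:
  "functors_agree (AQ R z) (id \<circ> id) (flip_mor \<circ> presentation_morphism.induced R (AQ_presentation R (\<ominus> z)) (flip_gen (\<ominus> z))) id id"
proof -
  interpret neg: affine_isomeric R "\<ominus> z" by (rule affine_isomeric_minus)
  have M: "presentation_morphism R (AQ_presentation R z) (AQ_presentation R (\<ominus> z)) (flip_gen (\<ominus> z))"
    using neg.flip_morphism unfolding minus_minus[OF z_closed] .
  have inv: "flip_mor (neg.flip_mor f) = f" if f: "hom f X Y" for f X Y
  proof -
    obtain t where t: "typed R (AQ_presentation R z) t X Y" "f = cl t"
      using f unfolding hom_def by blast
    have 1: "neg.flip_mor f = neg.cl (subst_gen (flip_gen (\<ominus> z)) t)"
      unfolding t(2) by (rule presentation_morphism.induced_cls[OF M t(1)])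
    have 2: "flip_mor (neg.cl (subst_gen (flip_gen (\<ominus> z)) t)) = cl (subst_gen (flip_gen z) (subst_gen (flip_gen (\<ominus> z)) t))"
      by (rule flip_mor_cls[OF presentation_morphism.typed_subst_gen[OF M t(1)]])
    have 3: "cl (subst_gen (flip_gen z) (subst_gen (flip_gen (\<ominus> z)) t)) = f"
      unfolding t(2) by (rule cls_subst_gen_inverse) (rule flip_flip_gen)
    show ?thesis
      unfolding 1 2 3 ..
  qed
  show ?thesis
    unfolding functors_agree_def AQ_def presented_supercat_simps(2) hom_iff_carrier comp_apply id_apply
    by (intro conjI ballI HOL.refl) (erule inv[folded hom_iff_carrier])
qed

text \<open>Two superfunctors agree if they do so on generators. The prescribed values settle u^+,
  u^-, c and o; \<open>adjunction_unique\<close> applied to the images of the other three generators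
  settles the rest.\<close>

lemma flip_mor_unique:
  assumes G: "monoidal_superfunctor R (AQ R (\<ominus> z)) (AQ R z) Go Gm"
    and flips: "flips_generators R (\<ominus> z) Go Gm"
  shows "functors_agree (AQ R (\<ominus> z)) id flip_mor Go Gm"
proof -
  interpret neg: affine_isomeric R "\<ominus> z" by (rule affine_isomeric_minus)
  interpret G: monoidal_superfunctor R "presented_supercat R (AQ_presentation R (\<ominus> z))"
    "presented_supercat R (AQ_presentation R z)" Go Gm
    using G unfolding AQ_def .
  note S = presented_supercat_simps(1,2,4-6) neg.presented_supercat_simps(1,2,4-6) hom_iff_carrier neg.hom_iff_carrier
    homog_iff_Homog neg.homog_iff_Homog presented_hom_simps(1,2) neg.presented_hom_simps(1,2)
  have Go1: "Go [a] = [a]" for a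
    using flips unfolding flips_generators_def by (cases a) auto
  have Go: "Go X = X" for X
  proof (induction X)
    case Nil
    show ?case using G.map_unit_ob[unfolded S] .
  next
    case (Cons a X)
    show ?case using G.map_tens_ob[unfolded S, of "[a]" X] Cons Go1 by simp
  qed
  note Gseq = G.map_cmp[unfolded S, OF UNIV_I UNIV_I UNIV_I]
  note Gtn = G.map_tens[unfolded S, OF UNIV_I UNIV_I UNIV_I UNIV_I]
  note Gid = G.map_ident[unfolded S Go, OF UNIV_I]
  have Gwh: "Gm (neg.whisker A f B) = whisker A (Gm f) B" if "neg.hom f X Y" for A f B X Y
    unfolding neg.whisker_def whisker_def using Gtn[OF neg.hom_intros(1) neg.hom_intros(5)[OF that neg.hom_intros(1)]]
      Gtn[OF that neg.hom_intros(1)] by (simp add: Gid)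
  have flU: "Gm (neg.u_cross e) = u_cross (flip_sign e)" for e
    using flips unfolding flips_generators_def neg.u_cross_def u_cross_def minus_minus[OF z_closed]
    by (cases e) (simp_all add: AQ_mor_def)
  have "Gm (neg.cl capR) = cl capR"
    using flips unfolding flips_generators_def minus_minus[OF z_closed] by (simp add: AQ_mor_def)
  then have capr: "Gm neg.rneg \<triangleright> Gm neg.cap = rneg \<triangleright> cap"
    unfolding capR_def neg.cl_seq[symmetric] cl_seq[symmetric] class_defs neg.class_defs
    using Gseq[OF neg.even_seq(3,2)] by simp
  note ev = neg.even_generators(2-4)[THEN G.hom_parity[unfolded S Go, OF UNIV_I UNIV_I]]
  have up: "whisker [] (Gm neg.cup) [\<up>] \<triangleright> whisker [\<up>] (Gm neg.cap) [] = cl (Idn [\<up>])"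
    using arg_cong[OF neg.zigzag_up, of Gm]
    by (simp add: Gid Gseq[OF neg.hom_whisker_even(3)[of "[\<up>]" "[]", simplified] neg.hom_whisker_even(4)[of "[]" "[\<up>]", simplified]]
        Gwh[OF neg.even_seq(3)] Gwh[OF neg.even_seq(4)])
  have down: "whisker [\<down>] (Gm neg.cup) [] \<triangleright> whisker [] (Gm neg.cap) [\<down>] = cl (Idn [\<down>])"
    using arg_cong[OF neg.zigzag_down, of Gm]
    by (simp add: Gid Gseq[OF neg.hom_whisker_even(3)[of "[]" "[\<down>]", simplified] neg.hom_whisker_even(4)[of "[\<down>]" "[]", simplified]]
        Gwh[OF neg.even_seq(3)] Gwh[OF neg.even_seq(4)])
  note h1 = neg.hom_whisker_even(3)[of "[]" "[\<up>, \<down>]", simplified]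
  note h2 = neg.hom_whisker_even(1)[of "[\<down>]" Pos "[\<down>]", simplified]
  note h3 = neg.hom_whisker_even(4)[of "[\<down>, \<up>]" "[]", simplified]
  \<comment> \<open>A functor carries a rotation to the rotation formed with the images of the left
    cup and cap, which at this point are not known to be the left cup and cap of the target.\<close>
  have "Gm (neg.l_cross Pos) = whisker [\<down>, \<up>] (Gm neg.cup) [] \<triangleright> whisker [\<down>] (u_cross Neg) [\<down>] \<triangleright> whisker [] (Gm neg.cap) [\<up>, \<down>]"
    unfolding neg.l_cross_eq_rho neg.rho_def
    by (simp add: Gseq[OF h1 h2] Gseq[OF neg.hom_seq[OF h2 h1] h3] flU
        Gwh[OF neg.even_seq(3)] Gwh[OF neg.even_seq(4)] Gwh[OF neg.even_seq(1)])
  then have inv: "Gm neg.rneg \<triangleright> whisker [\<down>, \<up>] (Gm neg.cup) [] \<triangleright> whisker [\<down>] (u_cross Neg) [\<down>] \<triangleright> whisker [] (Gm neg.cap) [\<up>, \<down>] = cl (Idn [\<up>, \<down>])"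
    using arg_cong[OF neg.isomeric_relation_classes(3), of Gm]
    by (simp add: Gid Gseq[OF neg.homog_imp_hom[OF neg.homog_l_cross] neg.even_seq(2)])
  note unique = adjunction_unique[OF ev(2,3,1) up down inv capr]
  show ?thesis
    unfolding AQ_def
  proof (rule neg.functors_agreeI)
    show "monoidal_superfunctor R (presented_supercat R (AQ_presentation R (\<ominus> z)))
        (presented_supercat R (AQ_presentation R z)) id flip_mor"
      using flip_mor_monoidal unfolding AQ_def .
    show "monoidal_superfunctor R (presented_supercat R (AQ_presentation R (\<ominus> z)))
        (presented_supercat R (AQ_presentation R z)) Go Gm"
      using G unfolding AQ_def .
    show "id [a] = Go [a]" for a by (simp add: Go)
    show "flip_mor (neg.cl (Gen g)) = Gm (neg.cl (Gen g))" for g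
    proof -
      have "flip_mor (neg.cl (Gen g)) = cl (flip_gen z g)"
        using flip_mor_cls[of "Gen g", OF typed.intros(1)] by simp
      moreover have "Gm (neg.cl (Gen g)) = cl (flip_gen z g)"
        using unique flU[of Pos] flU[of Neg] flips[unfolded flips_generators_def minus_minus[OF z_closed]]
        by (cases g) (simp_all add: class_defs neg.class_defs AQ_mor_def del: cross_r.simps(1))
      ultimately show ?thesis by simp
    qed
  qed
qed

end

theorem lemma6p2:
  fixes R :: "('k, 'x) ring_scheme" and z :: 'k
  assumes "cring R" and "ring_char R \<noteq> 2" and "z \<in> carrier R"
  shows "\<exists>Fo Fm.
    monoidal_superisomorphism R (AQ R z) (AQ R (\<ominus>\<^bsub>R\<^esub> z)) Fo Fm \<and>
    flips_generators R z Fo Fm \<and>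
    (\<forall>Go Gm.
      monoidal_superisomorphism R (AQ R z) (AQ R (\<ominus>\<^bsub>R\<^esub> z)) Go Gm \<and>
      flips_generators R z Go Gm \<longrightarrow> functors_agree (AQ R z) Fo Fm Go Gm) \<and>
    (\<forall>d X Y. diagram_typed d X Y \<longrightarrow>
      Fm (diagram_mor R z d) = diagram_mor R (\<ominus>\<^bsub>R\<^esub> z) (flip d))"
proof -
  interpret pos: affine_isomeric R z
    using assms(1,3) by (intro affine_isomeric.intro affine_isomeric_axioms.intro)
  interpret neg: affine_isomeric R "\<ominus>\<^bsub>R\<^esub> z"
    by (rule pos.affine_isomeric_minus)
  \<comment> \<open>The facts in \<open>neg\<close> concern the flip from the double negative of z
    to -z; this equation turns its source into the category for z.\<close>
  have mm: "\<ominus>\<^bsub>R\<^esub> (\<ominus>\<^bsub>R\<^esub> z) = z"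
    by (rule pos.minus_minus[OF assms(3)])
  have "monoidal_superisomorphism R (AQ R z) (AQ R (\<ominus>\<^bsub>R\<^esub> z)) id neg.flip_mor"
    unfolding monoidal_superisomorphism_def
    using neg.flip_mor_monoidal[unfolded mm] pos.flip_mor_monoidal neg.flip_mor_inverse[unfolded mm] pos.flip_mor_inverse by blast
  moreover have "flips_generators R z id neg.flip_mor"
    using neg.flip_mor_flips_generators unfolding mm .
  moreover have "functors_agree (AQ R z) id neg.flip_mor Go Gm"
    if "monoidal_superisomorphism R (AQ R z) (AQ R (\<ominus>\<^bsub>R\<^esub> z)) Go Gm" "flips_generators R z Go Gm" for Go Gm
    using neg.flip_mor_unique[unfolded mm] that unfolding monoidal_superisomorphism_def by blast
  moreover have "neg.flip_mor (diagram_mor R z d) = diagram_mor R (\<ominus>\<^bsub>R\<^esub> z) (flip d)" if "diagram_typed d X Y" for d X Y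
    using neg.flip_mor_diagram[OF that, unfolded mm] .
  ultimately show ?thesis by blast
qed

end
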